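(* Let $n\ge3$, $\mu_1,\mu_2,\beta>0$, $p=2q+1$ with $\frac{n}{n-2}<p<\frac{n+2}{n-2}$. (3) If $n\ge4$, system (S) has no positive semi-singular solution at $\infty$. (4) Suppose $n\ge4$, or $n=3$ and (S) has no positive semi-singular solution at $\infty$. Then for every positive solution $(u,v)$ of (S), either there is $C_3>0$ with $u(x),v(x)\le C_3|x|^{-(n-2)}$ for all $|x|\ge1$, or there exist constants $0<C_1\le C_2$ with $C_1|x|^{-\frac{2}{p-1}}\le u(x),v(x)\le C_2|x|^{-\frac{2}{p-1}}$ for all $|x|\ge1$.
   Context: System (S): $-\Delta u=\mu_1u^{2q+1}+\beta u^qv^{q+1}$, $-\Delta v=\mu_2v^{2q+1}+\beta v^qu^{q+1}$ in $\mathbb{R}^n\setminus\{0\}$; a positive solution is a pair $u,v\in C^2(\mathbb{R}^n\setminus\{0\})$, $u,v>0$, solving (S). A positive solution $(u,v)$ is semi-singular at $\infty$ if there are constants $C,C_1,C_2>0$ such that, for $|x|$ large, either $u(x)\le C|x|^{-(n-2)}$ and $C_1|x|^{-\frac2{p-1}}\le v(x)\le C_2|x|^{-\frac2{p-1}}$, or the same holds with $u$ and $v$ interchanged. *)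

theory Defs
  imports "HOL-Analysis.Analysis"
begin

definition partial :: "(real^'n \<Rightarrow> real) \<Rightarrow> 'n \<Rightarrow> real^'n \<Rightarrow> real" where
  "partial f i x = deriv (\<lambda>t. f (x + t *\<^sub>R axis i 1)) 0"

definition C2_on :: "(real^'n) set \<Rightarrow> (real^'n \<Rightarrow> real) \<Rightarrow> bool" where
  "C2_on S f \<longleftrightarrow> continuous_on S f \<and>
     (\<forall>i. (\<forall>x\<in>S. (\<lambda>t. f (x + t *\<^sub>R axis i 1)) differentiable (at 0)) \<and>
          continuous_on S (partial f i) \<and>
          (\<forall>j. (\<forall>x\<in>S. (\<lambda>t. partial f i (x + t *\<^sub>R axis j 1)) differentiable (at 0)) \<and>
               continuous_on S (partial (partial f i) j)))"

definition laplacian :: "(real^'n \<Rightarrow> real) \<Rightarrow> real^'n \<Rightarrow> real" where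
  "laplacian f x = (\<Sum>i\<in>UNIV. partial (partial f i) i x)"

definition pos_solution ::
  "real \<Rightarrow> real \<Rightarrow> real \<Rightarrow> real \<Rightarrow> (real^'n \<Rightarrow> real) \<Rightarrow> (real^'n \<Rightarrow> real) \<Rightarrow> bool" where
  "pos_solution q \<mu>1 \<mu>2 \<beta> u v \<longleftrightarrow>
     C2_on (- {0}) u \<and> C2_on (- {0}) v \<and>
     (\<forall>x. x \<noteq> 0 \<longrightarrow> u x > 0 \<and> v x > 0 \<and>
        - laplacian u x = \<mu>1 * u x powr (2*q+1) + \<beta> * u x powr q * v x powr (q+1) \<and>
        - laplacian v x = \<mu>2 * v x powr (2*q+1) + \<beta> * v x powr q * u x powr (q+1))"

definition semi_singular_inf :: "real \<Rightarrow> (real^'n \<Rightarrow> real) \<Rightarrow> (real^'n \<Rightarrow> real) \<Rightarrow> bool" where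
  "semi_singular_inf p u v \<longleftrightarrow>
     (\<exists>C C1 C2 R. C > 0 \<and> C1 > 0 \<and> C2 > 0 \<and>
       ((\<forall>x. norm x \<ge> R \<longrightarrow>
            u x \<le> C * norm x powr (- (real CARD('n) - 2)) \<and>
            C1 * norm x powr (- 2 / (p - 1)) \<le> v x \<and> v x \<le> C2 * norm x powr (- 2 / (p - 1)))
        \<or>
        (\<forall>x. norm x \<ge> R \<longrightarrow>
            v x \<le> C * norm x powr (- (real CARD('n) - 2)) \<and>
            C1 * norm x powr (- 2 / (p - 1)) \<le> u x \<and> u x \<le> C2 * norm x powr (- 2 / (p - 1)))))"

end

theory Submission
  imports Defs
begin

text \<open>
  The method of moving spheres shows that every positive solution on the punctured space is radial: for
  \<open>0 < l < norm x\<close> the Kelvin transforms of \<open>u\<close> and \<open>v\<close> about the sphere of radius \<open>l\<close> centred at \<open>x\<close>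
  stay below \<open>u\<close> and \<open>v\<close> outside this sphere. Only superharmonic comparison is needed, since the
  nonlinearities are increasing and subcriticality makes the difference strictly superharmonic. With
  \<open>x = R e\<close>, \<open>l = R\<close> and \<open>R\<close> tending to infinity the spheres become hyperplanes through the origin.

  In the Emden variables \<open>a t = exp (t / q) * u (exp t)\<close>, \<open>b t = exp (t / q) * v (exp t)\<close> the radial system is
  autonomous with an increasing energy. Hence \<open>a'\<close> and \<open>b'\<close> tend to 0, the limit points are equilibria, and
  the limit of the energy determines that of \<open>a\<^sup>2 + b\<^sup>2\<close>. If this limit is 0, both components have
  the fast decay rate. Otherwise one component could only vanish at infinity if the coupling term
  \<open>a powr q * b powr (q + 1)\<close> were dominated by the linear term, that is for \<open>q > 1\<close>; but subcriticality
  means \<open>q < 2 / (n - 2)\<close>, hence \<open>q < 1\<close> as soon as \<open>n \<ge> 4\<close>.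
\<close>

section \<open>Laplacians along coordinate lines\<close>

text \<open>The obstacle is the origin: for \<open>l < norm x\<close> it lies in the exterior region
  where the comparison takes place, and only positivity of the solutions is known there and at
  infinity. A nonnegative difference is enough at both ends, because adding a small multiple of the
  positive harmonic function \<open>1 + norm y powr (2 - n)\<close> outweighs the barrier there. The
  Kelvin transform of radius 0 is the zero function. So \<open>l = 0\<close> is a sphere for which
  the comparison holds, and starting the motion is a case of continuing it. The Emden system holds
  for all real \<open>t\<close>, since the solutions live on the whole punctured space. Running it
  backwards and forwards gives bounds on the derivatives relative to the functions, and from these
  the a priori bound, without blow-up or Liouville theorems. For \<open>q < 1\<close> the coupling
  is not Lipschitz at 0. It is therefore compared only through monotonicity, and its time derivative
  is estimated relative to its own size.\<close>

text \<open>A relation instead of an operator built on \<open>deriv\<close>: it certifies that the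
  derivatives exist, is linear, and asks only for first derivatives near the point and second ones
  at it, along coordinate lines. This is what a minimum principle needs.\<close>

definition has_lap :: "(real^'n \<Rightarrow> real) \<Rightarrow> real^'n \<Rightarrow> real \<Rightarrow> bool" where
  "has_lap f y l \<longleftrightarrow> (\<exists>g h. (\<forall>i.
      (\<forall>\<^sub>F t in nhds 0. ((\<lambda>s. f (y + s *\<^sub>R axis i 1)) has_real_derivative g i t) (at t)) \<and>
      (g i has_real_derivative h i) (at 0)) \<and> l = (\<Sum>i\<in>UNIV. h i))"

lemma has_lapI:
  assumes "\<And>i. \<forall>\<^sub>F t in nhds 0. ((\<lambda>s. f (y + s *\<^sub>R axis i 1)) has_real_derivative g i t) (at t)"
    and "\<And>i. (g i has_real_derivative h i) (at 0)" and "l = (\<Sum>i\<in>UNIV. h i)"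
  shows "has_lap f y l"
  unfolding has_lap_def using assms by blast

lemma has_lap_const [simp]: "has_lap (\<lambda>x. c) y 0"
  by (rule has_lapI[where g="\<lambda>i t. 0" and h="\<lambda>i. 0"]) auto

lemma has_lap_add:
  assumes "has_lap f y l" "has_lap f' y l'"
  shows "has_lap (\<lambda>x. f x + f' x) y (l + l')"
proof -
  obtain g h where 1: "\<And>i. \<forall>\<^sub>F t in nhds 0. ((\<lambda>s. f (y + s *\<^sub>R axis i 1)) has_real_derivative g i t) (at t)"
    "\<And>i. (g i has_real_derivative h i) (at 0)" "l = (\<Sum>i\<in>UNIV. h i)"
    using assms(1) unfolding has_lap_def by blast
  obtain g' h' where 2: "\<And>i. \<forall>\<^sub>F t in nhds 0. ((\<lambda>s. f' (y + s *\<^sub>R axis i 1)) has_real_derivative g' i t) (at t)"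
    "\<And>i. (g' i has_real_derivative h' i) (at 0)" "l' = (\<Sum>i\<in>UNIV. h' i)"
    using assms(2) unfolding has_lap_def by blast
  show ?thesis
  proof (rule has_lapI[where g="\<lambda>i t. g i t + g' i t" and h="\<lambda>i. h i + h' i"])
    show "\<forall>\<^sub>F t in nhds 0. ((\<lambda>s. f (y + s *\<^sub>R axis i 1) + f' (y + s *\<^sub>R axis i 1)) has_real_derivative g i t + g' i t) (at t)" for i
      using 1(1)[of i] 2(1)[of i] by eventually_elim (rule DERIV_add)
  qed (auto intro!: DERIV_add 1 2 simp: 1 2 sum.distrib)
qed

lemma has_lap_cmult:
  assumes "has_lap f y l"
  shows "has_lap (\<lambda>x. c * f x) y (c * l)"
proof -
  obtain g h where 1: "\<And>i. \<forall>\<^sub>F t in nhds 0. ((\<lambda>s. f (y + s *\<^sub>R axis i 1)) has_real_derivative g i t) (at t)"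
    "\<And>i. (g i has_real_derivative h i) (at 0)" "l = (\<Sum>i\<in>UNIV. h i)"
    using assms(1) unfolding has_lap_def by blast
  show ?thesis
  proof (rule has_lapI[where g="\<lambda>i t. c * g i t" and h="\<lambda>i. c * h i"])
    show "\<forall>\<^sub>F t in nhds 0. ((\<lambda>s. c * f (y + s *\<^sub>R axis i 1)) has_real_derivative c * g i t) (at t)" for i
      using 1(1)[of i] by eventually_elim (rule DERIV_cmult)
  qed (auto intro!: DERIV_cmult 1 simp: 1 sum_distrib_left)
qed

lemma has_lap_diff:
  assumes "has_lap f y l" "has_lap f' y l'"
  shows "has_lap (\<lambda>x. f x - f' x) y (l - l')"
  using has_lap_add[OF assms(1) has_lap_cmult[OF assms(2), of "-1"]] by simp

section \<open>Minimum principle for strictly superharmonic functions\<close>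

text \<open>If \<open>h < 0\<close>, then \<open>g\<close>, which vanishes at the minimum, is
  negative just to the right of it, and the mean value theorem pushes \<open>\<phi>\<close> below
  its minimum.\<close>

lemma second_derivative_nonneg_at_local_min:
  fixes \<phi> g :: "real \<Rightarrow> real"
  assumes d: "\<forall>\<^sub>F t in nhds x. (\<phi> has_real_derivative g t) (at t)"
    and d2: "(g has_real_derivative h) (at x)"
    and mn: "\<forall>\<^sub>F t in nhds x. \<phi> x \<le> \<phi> t"
  shows "h \<ge> 0"
proof (rule ccontr)
  assume "\<not> h \<ge> 0" then have h: "h < 0" by simp
  obtain e where e: "e > 0" "\<And>t. \<bar>t - x\<bar> < e \<Longrightarrow> (\<phi> has_real_derivative g t) (at t)"
    using d unfolding eventually_nhds_metric by (auto simp: dist_real_def)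
  obtain e' where e': "e' > 0" "\<And>t. \<bar>t - x\<bar> < e' \<Longrightarrow> \<phi> x \<le> \<phi> t"
    using mn unfolding eventually_nhds_metric by (auto simp: dist_real_def)
  have g0: "g x = 0"
    by (rule DERIV_local_min[OF e(2) e'(1)]) (use e e' in \<open>auto simp: abs_minus_commute\<close>)
  obtain d where dd: "d > 0" "\<And>k. k > 0 \<Longrightarrow> k < d \<Longrightarrow> g (x + k) < 0"
    using DERIV_neg_dec_right[OF d2 h] g0 by auto
  define r where "r = min d (min e e') / 2"
  have r: "r > 0" "r < d" "r < e" "r < e'" unfolding r_def using dd e e' by (auto simp: min_def)
  obtain z where z: "x < z" "z < x + r" "\<phi> (x + r) - \<phi> x = (x + r - x) * g z"
    using MVT2[of x "x + r" \<phi> g] r e(2) by auto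
  have "\<phi> (x + r) - \<phi> x < 0" using z dd(2)[of "z - x"] r by (simp add: mult_pos_neg)
  then show False using e'(2)[of "x + r"] r by auto
qed

lemma has_lap_nonneg_at_local_min:
  assumes "has_lap f y l" "\<forall>\<^sub>F z in nhds y. f y \<le> f z"
  shows "l \<ge> 0"
proof -
  obtain g h where 1: "\<And>i. \<forall>\<^sub>F t in nhds 0. ((\<lambda>s. f (y + s *\<^sub>R axis i 1)) has_real_derivative g i t) (at t)"
    "\<And>i. (g i has_real_derivative h i) (at 0)" "l = (\<Sum>i\<in>UNIV. h i)"
    using assms(1) unfolding has_lap_def by blast
  have "h i \<ge> 0" for i
  proof (rule second_derivative_nonneg_at_local_min[OF 1(1)[of i] 1(2)])
    have "((\<lambda>t::real. y + t *\<^sub>R axis i 1) \<longlongrightarrow> y + 0 *\<^sub>R axis i 1) (nhds 0)"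
      by (intro tendsto_intros filterlim_ident)
    then have "filterlim (\<lambda>t::real. y + t *\<^sub>R axis i 1) (nhds y) (nhds 0)" by simp
    from eventually_compose_filterlim[OF assms(2) this]
    show "\<forall>\<^sub>F t in nhds 0. f (y + 0 *\<^sub>R axis i 1) \<le> f (y + t *\<^sub>R axis i 1)" by simp
  qed
  then show ?thesis unfolding 1(3) by (simp add: sum_nonneg)
qed

text \<open>At a negative minimum the Laplacian would be nonnegative, so strictness gives a
  contradiction at once. Since only negative points are constrained, boundary conditions take the
  form "a negative point is interior".\<close>

lemma minimum_principle:
  fixes f :: "real^'n \<Rightarrow> real"
  assumes "compact K" "continuous_on K f"
    and neg: "\<And>y. y \<in> K \<Longrightarrow> f y < 0 \<Longrightarrow> y \<in> interior K \<and> (\<exists>l<0. has_lap f y l)"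
    and y: "y \<in> K"
  shows "f y \<ge> 0"
proof (rule ccontr)
  assume a: "\<not> f y \<ge> 0"
  obtain z where z: "z \<in> K" "\<forall>w\<in>K. f z \<le> f w"
    using continuous_attains_inf[OF assms(1) _ assms(2)] y by blast
  then have fz: "f z < 0" using a y by force
  from neg[OF z(1) fz] obtain l where l: "z \<in> interior K" "l < 0" "has_lap f z l" by blast
  have "\<forall>\<^sub>F w in nhds z. w \<in> interior K"
    using l(1) by (simp add: eventually_nhds_in_open)
  then have "\<forall>\<^sub>F w in nhds z. f z \<le> f w"
    by eventually_elim (use z interior_subset in blast)
  from has_lap_nonneg_at_local_min[OF l(3) this] l(2) show False by simp
qed

section \<open>From \<open>C2_on\<close> to Laplacians and total derivatives\<close>

lemma partial_has_derivative:
  fixes f :: "real^'n \<Rightarrow> real"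
  assumes "(\<lambda>t. f (x + t *\<^sub>R axis i 1)) differentiable (at 0)"
  shows "((\<lambda>t. f (x + t *\<^sub>R axis i 1)) has_real_derivative partial f i x) (at 0)"
  using assms unfolding partial_def
  by (metis DERIV_imp_deriv real_differentiableE)

lemma partial_has_derivative_shift:
  fixes f :: "real^'n \<Rightarrow> real"
  assumes "(\<lambda>t. f ((x + s *\<^sub>R axis i 1) + t *\<^sub>R axis i 1)) differentiable (at 0)"
  shows "((\<lambda>t. f (x + t *\<^sub>R axis i 1)) has_real_derivative partial f i (x + s *\<^sub>R axis i 1)) (at s)"
proof -
  have "((\<lambda>t. f (x + s *\<^sub>R axis i 1 + t *\<^sub>R axis i 1)) has_real_derivative partial f i (x + s *\<^sub>R axis i 1)) (at 0)"
    by (rule partial_has_derivative[OF assms])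
  moreover have "(\<lambda>t. f (x + s *\<^sub>R axis i 1 + t *\<^sub>R axis i 1)) = (\<lambda>t. f (x + t *\<^sub>R axis i 1)) \<circ> (\<lambda>t. s + t)"
    by (auto simp: fun_eq_iff scaleR_add_left algebra_simps)
  ultimately show ?thesis
    using DERIV_at_within_shift[of "\<lambda>t. f (x + t *\<^sub>R axis i 1)" "partial f i (x + s *\<^sub>R axis i 1)" s 0 UNIV]
    by (simp add: o_def)
qed

lemma C2_onD:
  assumes "C2_on S f"
  shows "continuous_on S f" "continuous_on S (partial f i)" "continuous_on S (partial (partial f i) j)"
    "x \<in> S \<Longrightarrow> (\<lambda>t. f (x + t *\<^sub>R axis i 1)) differentiable (at 0)"
    "x \<in> S \<Longrightarrow> (\<lambda>t. partial f i (x + t *\<^sub>R axis j 1)) differentiable (at 0)"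
  using assms unfolding C2_on_def by blast+

lemma eventually_line_in_open:
  fixes x :: "real^'n"
  assumes "open S" "x \<in> S"
  shows "\<forall>\<^sub>F t in nhds 0. x + t *\<^sub>R axis i 1 \<in> S"
proof -
  have "((\<lambda>t::real. x + t *\<^sub>R axis i 1) \<longlongrightarrow> x + 0 *\<^sub>R axis i 1) (nhds 0)"
    by (intro tendsto_intros filterlim_ident)
  then have "filterlim (\<lambda>t::real. x + t *\<^sub>R axis i 1) (nhds x) (nhds 0)" by simp
  from eventually_compose_filterlim[OF eventually_nhds_in_open[OF assms] this] show ?thesis .
qed

lemma has_lap_laplacian:
  assumes "C2_on S f" "open S" "x \<in> S"
  shows "has_lap f x (laplacian f x)"
proof (rule has_lapI[where g="\<lambda>i t. partial f i (x + t *\<^sub>R axis i 1)" and h="\<lambda>i. partial (partial f i) i x"])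
  fix i
  show "\<forall>\<^sub>F t in nhds 0. ((\<lambda>s. f (x + s *\<^sub>R axis i 1)) has_real_derivative partial f i (x + t *\<^sub>R axis i 1)) (at t)"
    using eventually_line_in_open[OF assms(2,3), of i]
    by eventually_elim (intro partial_has_derivative_shift C2_onD[OF assms(1)])
  show "((\<lambda>t. partial f i (x + t *\<^sub>R axis i 1)) has_real_derivative partial (partial f i) i x) (at 0)"
    by (intro partial_has_derivative C2_onD[OF assms(1)] assms)
qed (simp add: laplacian_def)

text \<open>\<open>C2_on\<close> speaks only of derivatives along the axes, whereas inversions and
  rays run across them. Changing one coordinate at a time and using the mean value theorem on each
  leg gives total differentiability.\<close>

lemma has_derivative_of_continuous_partials:
  fixes f :: "real^'n \<Rightarrow> real"
  assumes S: "open S" "x \<in> S"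
    and diff: "\<And>i y. y \<in> S \<Longrightarrow> (\<lambda>t. f (y + t *\<^sub>R axis i 1)) differentiable (at 0)"
    and cont: "\<And>i. continuous_on S (partial f i)"
  shows "(f has_derivative (\<lambda>h. \<Sum>i\<in>UNIV. h $ i * partial f i x)) (at x)"
proof -
  let ?r = "\<lambda>A h. \<Sum>i\<in>A. (h $ i) *\<^sub>R (axis i 1 :: real^'n)"
  have comp: "?r A h $ j = (if j \<in> A then h $ j else 0)" if "finite A" for A h j
    using that by (simp add: sum_component axis_def if_distrib cong: if_cong)
  have small: "norm (?r A h) \<le> norm h" if "finite A" for A h
  proof (rule norm_le_componentwise_cart)
    show "norm (?r A h $ j) \<le> norm (h $ j)" for j using comp[OF that] by auto
  qed
  \<comment> \<open>\<open>A\<close> is the set of coordinates already changed. Dropping coordinates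
    never increases the norm, so all intermediate points stay in the ball on which the partials vary
    by at most \<open>e\<close>.\<close>
  have key: "\<bar>f (x + ?r A h) - f x - (\<Sum>i\<in>A. h $ i * partial f i x)\<bar> \<le> (\<Sum>i\<in>A. e * \<bar>h $ i\<bar>)"
    if "finite A" "ball x d \<subseteq> S" "norm h < d"
      "\<And>i y. y \<in> ball x d \<Longrightarrow> \<bar>partial f i y - partial f i x\<bar> \<le> e" for A h d e
    using that(1)
  proof (induction A rule: finite_induct)
    case empty then show ?case by simp
  next
    case (insert j A)
    let ?b = "x + ?r A h"
    have seg: "?b + s *\<^sub>R axis j 1 \<in> ball x d" if s: "\<bar>s\<bar> \<le> \<bar>h $ j\<bar>" for s
    proof -
      have "norm (?r A h + s *\<^sub>R axis j 1) \<le> norm h"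
      proof (rule norm_le_componentwise_cart)
        show "norm ((?r A h + s *\<^sub>R axis j 1) $ k) \<le> norm (h $ k)" for k
          using comp[OF insert(1), of h k] insert(2) s by (auto simp: axis_def)
      qed
      moreover have "?b + s *\<^sub>R axis j 1 - x = ?r A h + s *\<^sub>R axis j 1" by simp
      ultimately have "norm (?b + s *\<^sub>R axis j 1 - x) < d" using \<open>norm h < d\<close> by simp
      then show ?thesis by (simp only: mem_ball dist_norm norm_minus_commute[of x])
    qed
    have der: "((\<lambda>t. f (?b + t *\<^sub>R axis j 1)) has_real_derivative partial f j (?b + s *\<^sub>R axis j 1)) (at s)"
      if "\<bar>s\<bar> \<le> \<bar>h $ j\<bar>" for s
      by (rule partial_has_derivative_shift, rule diff) (use seg[OF that] \<open>ball x d \<subseteq> S\<close> in blast)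
    have mv: "\<exists>s. \<bar>s\<bar> \<le> \<bar>h $ j\<bar> \<and> f (?b + (h $ j) *\<^sub>R axis j 1) - f ?b = h $ j * partial f j (?b + s *\<^sub>R axis j 1)"
    proof -
      consider "h $ j = 0" | "h $ j > 0" | "h $ j < 0" by linarith
      then show ?thesis
      proof cases
        case 1 then show ?thesis by (intro exI[of _ 0]) simp
      next
        case 2
        from MVT2[OF 2, of "\<lambda>t. f (?b + t *\<^sub>R axis j 1)" "\<lambda>s. partial f j (?b + s *\<^sub>R axis j 1)"] der
        obtain z where "0 < z" "z < h $ j" "f (?b + (h $ j) *\<^sub>R axis j 1) - f ?b = h $ j * partial f j (?b + z *\<^sub>R axis j 1)"
          by auto
        then show ?thesis by (intro exI[of _ z]) auto
      next
        case 3
        from MVT2[OF 3, of "\<lambda>t. f (?b + t *\<^sub>R axis j 1)" "\<lambda>s. partial f j (?b + s *\<^sub>R axis j 1)"] der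
        obtain z where "z < 0" "h $ j < z" "f ?b - f (?b + (h $ j) *\<^sub>R axis j 1) = (0 - h $ j) * partial f j (?b + z *\<^sub>R axis j 1)"
          by auto
        then show ?thesis by (intro exI[of _ z]) (auto simp: algebra_simps)
      qed
    qed
    then obtain s where s: "\<bar>s\<bar> \<le> \<bar>h $ j\<bar>" "f (?b + (h $ j) *\<^sub>R axis j 1) - f ?b = h $ j * partial f j (?b + s *\<^sub>R axis j 1)" by blast
    have "\<bar>h $ j * partial f j (?b + s *\<^sub>R axis j 1) - h $ j * partial f j x\<bar> \<le> e * \<bar>h $ j\<bar>"
      using mult_left_mono[OF that(4)[OF seg[OF s(1)], of j], of "\<bar>h $ j\<bar>"]
      by (simp add: right_diff_distrib[symmetric] abs_mult mult.commute)
    then show ?case using insert s by (simp add: algebra_simps)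
  qed
  show ?thesis
    unfolding has_derivative_at_alt
  proof (intro conjI allI impI)
    show "bounded_linear (\<lambda>h. \<Sum>i\<in>UNIV. h $ i * partial f i x)"
      by (intro bounded_linear_sum bounded_linear_mult_const bounded_linear_vec_nth)
    fix e0 :: real assume "e0 > 0"
    \<comment> \<open>One error term arises per coordinate, each at most \<open>e\<close> times the
      norm of the increment; together they give \<open>e0\<close>.\<close>
    define e where "e = e0 / real CARD('n)"
    have e: "e > 0" using \<open>e0 > 0\<close> by (simp add: e_def)
    have "\<forall>\<^sub>F y in nhds x. \<forall>i. \<bar>partial f i y - partial f i x\<bar> < e"
    proof (intro eventually_all_finite)
      fix i
      have "isCont (partial f i) x" using cont S by (simp add: continuous_on_eq_continuous_at)
      then have "(partial f i \<longlongrightarrow> partial f i x) (nhds x)"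
        by (simp add: isCont_def tendsto_at_iff_tendsto_nhds)
      from tendstoD[OF this e] show "\<forall>\<^sub>F y in nhds x. \<bar>partial f i y - partial f i x\<bar> < e" by (simp add: dist_real_def)
    qed
    with eventually_nhds_in_open[OF S] have "\<forall>\<^sub>F y in nhds x. y \<in> S \<and> (\<forall>i. \<bar>partial f i y - partial f i x\<bar> < e)"
      by eventually_elim simp
    then obtain d where d: "d > 0" "\<And>y. dist y x < d \<Longrightarrow> y \<in> S \<and> (\<forall>i. \<bar>partial f i y - partial f i x\<bar> < e)"
      unfolding eventually_nhds_metric by auto
    have "norm (f y - f x - (\<Sum>i\<in>UNIV. (y - x) $ i * partial f i x)) \<le> e0 * norm (y - x)" if "norm (y - x) < d" for y
    proof -
      have "?r UNIV (y - x) = y - x"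
        by (simp only: vec_eq_iff comp[OF finite]) simp
      moreover have "\<bar>f (x + ?r UNIV (y - x)) - f x - (\<Sum>i\<in>UNIV. (y - x) $ i * partial f i x)\<bar> \<le> (\<Sum>i\<in>(UNIV::'n set). e * \<bar>(y - x) $ i\<bar>)"
        by (rule key[of UNIV d]) (use d that in \<open>auto simp: dist_commute less_imp_le\<close>)
      moreover have "(\<Sum>i\<in>(UNIV::'n set). e * \<bar>(y - x) $ i\<bar>) \<le> (\<Sum>i\<in>(UNIV::'n set). e * norm (y - x))"
        by (intro sum_mono mult_left_mono component_le_norm_cart) (use e in auto)
      ultimately show ?thesis by (simp add: e_def)
    qed
    then show "\<exists>d>0. \<forall>y. norm (y - x) < d \<longrightarrow> norm (f y - f x - (\<Sum>i\<in>UNIV. (y - x) $ i * partial f i x)) \<le> e0 * norm (y - x)"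
      using d by blast
  qed
qed

lemma chain_rule_partials:
  fixes f :: "real^'n \<Rightarrow> real"
  assumes "open S" "\<gamma> t \<in> S"
    and "\<And>i y. y \<in> S \<Longrightarrow> (\<lambda>t. f (y + t *\<^sub>R axis i 1)) differentiable (at 0)"
    and "\<And>i. continuous_on S (partial f i)"
    and "(\<gamma> has_vector_derivative \<gamma>') (at t)"
  shows "((\<lambda>t. f (\<gamma> t)) has_real_derivative (\<Sum>i\<in>UNIV. \<gamma>' $ i * partial f i (\<gamma> t))) (at t)"
proof -
  have "(f has_derivative (\<lambda>h. \<Sum>i\<in>UNIV. h $ i * partial f i (\<gamma> t))) (at (\<gamma> t))"
    by (rule has_derivative_of_continuous_partials) (use assms in auto)
  from vector_derivative_diff_chain_within[OF assms(5) has_derivative_at_withinI[OF this]]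
  show ?thesis by (simp add: o_def has_real_derivative_iff_has_vector_derivative)
qed

section \<open>The Kelvin transform\<close>

definition kelvin :: "real^'n \<Rightarrow> real \<Rightarrow> (real^'n \<Rightarrow> real) \<Rightarrow> real^'n \<Rightarrow> real" where
  "kelvin x l u y = (l / norm (y - x)) powr (real CARD('n) - 2) * u (x + (l / norm (y - x))\<^sup>2 *\<^sub>R (y - x))"

lemma inner_power_half:
  fixes w :: "'a::real_inner"
  shows "(w \<bullet> w) powr (a / 2) = norm w powr a"
proof -
  have "w \<bullet> w = norm w powr 2" by (cases "w = 0") (simp_all add: power2_norm_eq_inner)
  then show ?thesis by (simp only: powr_powr) simp
qed

text \<open>Along a coordinate line the inner product of \<open>y - x\<close> with itself is a
  quadratic polynomial in \<open>t\<close>, so this form can be differentiated without square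
  roots.\<close>

lemma kelvin_alt:
  fixes x :: "real^'n"
  assumes "l > 0"
  shows "kelvin x l u y = l powr (real CARD('n) - 2) * (((y - x) \<bullet> (y - x)) powr ((2 - real CARD('n)) / 2) *
     u (x + (l\<^sup>2 / ((y - x) \<bullet> (y - x))) *\<^sub>R (y - x)))"
proof -
  have "norm (y - x) powr (2 - real CARD('n)) = inverse (norm (y - x) powr (real CARD('n) - 2))"
    by (metis minus_diff_eq powr_minus)
  then show ?thesis
    unfolding kelvin_def inner_power_half using assms
    by (simp add: power_divide power2_norm_eq_inner powr_divide field_simps)
qed

text \<open>Conformal covariance of the Laplacian. The exponent is \<open>(n - 2) + 4\<close>: the
  first part is the weight of the transform, the 4 comes from the squared conformal factor of the
  inversion. Two differentiations along each coordinate line are summed, and the coefficients of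
  \<open>u\<close>, of its gradient and of its Hessian are evaluated separately.\<close>

lemma has_lap_kelvin:
  fixes x y :: "real^'n"
  assumes l: "l > 0" and yx: "y \<noteq> x" and S: "open S" and C2: "C2_on S u"
    and X: "x + (l / norm (y - x))\<^sup>2 *\<^sub>R (y - x) \<in> S"
  shows "has_lap (kelvin x l u) y ((l / norm (y - x)) powr (real CARD('n) + 2) *
            laplacian u (x + (l / norm (y - x))\<^sup>2 *\<^sub>R (y - x)))"
proof -
  define N where "N = real CARD('n)"
  define m where "m = (2 - N) / 2"
  define z where "z = y - x"
  define s0 where "s0 = z \<bullet> z"
  \<comment> \<open>Along the line \<open>y + t *\<^sub>R axis i 1\<close>, \<open>s\<close> is the
    squared distance to \<open>x\<close> and \<open>G\<close> the inverted point. The digits 1 and 2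
    count derivatives; \<open>g1\<close>, \<open>g2\<close>, \<open>k2\<close> are values at
    \<open>t = 0\<close>. The functions \<open>g\<close> and \<open>h\<close> are the first
    derivative and the second derivative at 0 of the product \<open>s powr m * u G\<close>.\<close>
  define s where "s i t = s0 + 2 * z $ i * t + t\<^sup>2" for i t
  define k1 where "k1 i t = m * s i t powr (m - 1) * (2 * z $ i + 2 * t)" for i t
  define k2 where "k2 i = m * ((m - 1) * s0 powr (m - 2) * (2 * z $ i)) * (2 * z $ i) + m * s0 powr (m - 1) * 2" for i
  define G where "G i t = x + (l\<^sup>2 / s i t) *\<^sub>R (z + t *\<^sub>R axis i 1)" for i t
  define G1 where "G1 i t = (l\<^sup>2 / s i t) *\<^sub>R axis i 1 - (l\<^sup>2 * (2 * z $ i + 2 * t) / (s i t)\<^sup>2) *\<^sub>R (z + t *\<^sub>R axis i 1)" for i t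
  define Y where "Y = x + (l\<^sup>2 / s0) *\<^sub>R z"
  define A where "A j = partial u j Y" for j
  define B where "B j k = partial (partial u j) k Y" for j k
  define d where "d i j = (if i = j then 1 else 0 :: real)" for i j :: 'n
  define g1 where "g1 i j = l\<^sup>2 / s0 * (d i j - 2 * z $ i * z $ j / s0)" for i j
  define g2 where "g2 i j = l\<^sup>2 * (- 4 * z $ i * d i j / s0\<^sup>2 - 2 * z $ j / s0\<^sup>2 + 8 * (z $ i)\<^sup>2 * z $ j / s0 ^ 3)" for i j
  define g where "g i t = k1 i t * u (G i t) + s i t powr m * (\<Sum>j\<in>UNIV. G1 i t $ j * partial u j (G i t))" for i t
  define D where "D i = (\<Sum>j\<in>UNIV. g1 i j * A j)" for i
  define P where "P = s0 powr m"
  define h where "h i = k2 i * u Y + D i * k1 i 0 + (k1 i 0 * D i +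
      (\<Sum>j\<in>UNIV. g2 i j * A j + (\<Sum>k\<in>UNIV. g1 i k * B j k) * g1 i j) * P)" for i
  have z0: "z \<noteq> 0" using yx by (simp add: z_def)
  then have s0: "s0 > 0" by (simp add: s0_def)
  have line: "(z + t *\<^sub>R axis i 1) \<bullet> (z + t *\<^sub>R axis i 1) = s i t" for i t
    unfolding s_def s0_def
    by (simp add: inner_add_left inner_add_right inner_axis inner_axis_axis inner_commute[of "axis i 1" z] power2_eq_square algebra_simps)
  have Yeq: "x + (l / norm (y - x))\<^sup>2 *\<^sub>R (y - x) = Y"
    unfolding Y_def s0_def z_def by (simp add: power_divide power2_norm_eq_inner)
  have YS: "Y \<in> S" using X Yeq by simp
  have s_0: "s i 0 = s0" and G_0: "G i 0 = Y" for i by (simp_all add: s_def G_def Y_def)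
  have G1_0: "G1 i 0 $ j = g1 i j" for i j
    unfolding G1_def s_0 g1_def d_def using s0 by (simp add: axis_def power2_eq_square field_simps)
  have ds: "((\<lambda>t. s i t) has_real_derivative 2 * z $ i + 2 * t) (at t)" for i t
    unfolding s_def by (auto intro!: derivative_eq_intros)
  have dk: "((\<lambda>t. s i t powr m) has_real_derivative k1 i t) (at t)" if "s i t > 0" for i t
    using DERIV_fun_powr[OF ds that] by (simp add: k1_def)
  have dk1: "((\<lambda>t. k1 i t) has_real_derivative k2 i) (at 0)" for i
  proof -
    have pw: "((\<lambda>t. s i t powr (m - 1)) has_real_derivative (m - 1) * s0 powr (m - 2) * (2 * z $ i)) (at 0)"
      using DERIV_fun_powr[OF ds, of i 0 "m - 1"] s0 by (simp add: s_0)
    show ?thesis unfolding k1_def k2_def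
      by (rule derivative_eq_intros pw refl | simp add: s_0)+
  qed
  have dG: "((\<lambda>t. G i t) has_vector_derivative G1 i t) (at t)" if "s i t > 0" for i t
  proof -
    have 1: "((\<lambda>t. l\<^sup>2 / s i t) has_real_derivative - (l\<^sup>2 * (2 * z $ i + 2 * t) / (s i t)\<^sup>2)) (at t)"
      using that by (auto intro!: derivative_eq_intros ds simp: power2_eq_square)
    have 2: "((\<lambda>t. z + t *\<^sub>R axis i 1) has_vector_derivative axis i 1) (at t)"
      by (auto intro!: derivative_eq_intros)
    have "((\<lambda>t. x + (l\<^sup>2 / s i t) *\<^sub>R (z + t *\<^sub>R axis i 1)) has_vector_derivative
        ((l\<^sup>2 / s i t) *\<^sub>R axis i 1 + (- (l\<^sup>2 * (2 * z $ i + 2 * t) / (s i t)\<^sup>2)) *\<^sub>R (z + t *\<^sub>R axis i 1))) (at t)"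
      using has_vector_derivative_add[OF has_vector_derivative_const has_vector_derivative_scaleR[OF 1 2]] by simp
    then show ?thesis unfolding G_def G1_def by simp
  qed
  have dG1: "((\<lambda>t. G1 i t $ j) has_real_derivative g2 i j) (at 0)" for i j
  proof -
    have e: "(\<lambda>t. G1 i t $ j) = (\<lambda>t. l\<^sup>2 / s i t * d i j - (l\<^sup>2 * (2 * z $ i + 2 * t) / (s i t)\<^sup>2) * (z $ j + t * d i j))"
      by (auto simp: G1_def d_def axis_def fun_eq_iff)
    show ?thesis unfolding e
      apply (rule derivative_eq_intros ds refl | simp add: s_0 s0 less_imp_neq[OF s0, symmetric])+
      apply (use s0 in \<open>simp add: s_0 g2_def divide_simps\<close>)
      apply (simp add: algebra_simps power_numeral_reduce)
      done
  qed
  have ev_s: "\<forall>\<^sub>F t in nhds 0. s i t > 0" for i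
  proof -
    have "isCont (s i) 0" by (rule DERIV_isCont[OF ds])
    then have "(s i \<longlongrightarrow> s i 0) (nhds 0)"
      by (simp only: isCont_def tendsto_at_iff_tendsto_nhds)
    then have "(s i \<longlongrightarrow> s0) (nhds 0)" by (simp only: s_0)
    then show ?thesis using s0 by (rule order_tendstoD)
  qed
  have ev_S: "\<forall>\<^sub>F t in nhds 0. G i t \<in> S" for i
  proof -
    have "isCont (G i) 0"
      using has_vector_derivative_continuous[OF dG[of i 0]] s0 by (simp add: s_0)
    then have "filterlim (G i) (nhds (G i 0)) (nhds 0)"
      by (simp only: isCont_def tendsto_at_iff_tendsto_nhds)
    then have "filterlim (G i) (nhds Y) (nhds 0)" by (simp only: G_0)
    from eventually_compose_filterlim[OF eventually_nhds_in_open[OF S YS] this] show ?thesis .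
  qed
  have main: "has_lap (\<lambda>y. ((y - x) \<bullet> (y - x)) powr m * u (x + (l\<^sup>2 / ((y - x) \<bullet> (y - x))) *\<^sub>R (y - x))) y (\<Sum>i\<in>UNIV. h i)"
  proof (rule has_lapI[where g=g and h=h])
    fix i
    have eq: "((y + t *\<^sub>R axis i 1 - x) \<bullet> (y + t *\<^sub>R axis i 1 - x)) powr m * u (x + (l\<^sup>2 / ((y + t *\<^sub>R axis i 1 - x) \<bullet> (y + t *\<^sub>R axis i 1 - x))) *\<^sub>R (y + t *\<^sub>R axis i 1 - x))
       = s i t powr m * u (G i t)" for t
    proof -
      have "y + t *\<^sub>R axis i 1 - x = z + t *\<^sub>R axis i 1" by (simp add: z_def)
      then show ?thesis by (simp only: line G_def)
    qed
    show "\<forall>\<^sub>F t in nhds 0. ((\<lambda>t. ((y + t *\<^sub>R axis i 1 - x) \<bullet> (y + t *\<^sub>R axis i 1 - x)) powr m * u (x + (l\<^sup>2 / ((y + t *\<^sub>R axis i 1 - x) \<bullet> (y + t *\<^sub>R axis i 1 - x))) *\<^sub>R (y + t *\<^sub>R axis i 1 - x)))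
        has_real_derivative g i t) (at t)"
      unfolding eq using ev_s[of i] ev_S[of i]
    proof eventually_elim
      case (elim t)
      have "((\<lambda>t. u (G i t)) has_real_derivative (\<Sum>j\<in>UNIV. G1 i t $ j * partial u j (G i t))) (at t)"
        by (rule chain_rule_partials[OF S]) (use elim dG C2_onD[OF C2] in auto)
      from DERIV_mult[OF dk[OF elim(1)] this] show ?case by (simp add: g_def algebra_simps)
    qed
    have p: "s i 0 > 0" using s0 by (simp add: s_0)
    have YS': "G i 0 \<in> S" using YS by (simp add: G_0)
    have c1: "((\<lambda>t. u (G i t)) has_real_derivative D i) (at 0)"
      using chain_rule_partials[OF S YS' C2_onD(4)[OF C2] C2_onD(2)[OF C2] dG[OF p]]
      by (simp add: D_def A_def G1_0 G_0)
    have c2: "((\<lambda>t. partial u j (G i t)) has_real_derivative (\<Sum>k\<in>UNIV. g1 i k * B j k)) (at 0)" for j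
      using chain_rule_partials[OF S YS' C2_onD(5)[OF C2] C2_onD(3)[OF C2] dG[OF p]]
      by (simp add: B_def G1_0 G_0)
    have c3: "((\<lambda>t. \<Sum>j\<in>UNIV. G1 i t $ j * partial u j (G i t)) has_real_derivative
        (\<Sum>j\<in>UNIV. g2 i j * A j + (\<Sum>k\<in>UNIV. g1 i k * B j k) * g1 i j)) (at 0)"
      by (rule DERIV_sum) (use DERIV_mult[OF dG1 c2] in \<open>simp add: G1_0 G_0 A_def\<close>)
    show "(g i has_real_derivative h i) (at 0)"
      unfolding g_def h_def
      using DERIV_add[OF DERIV_mult[OF dk1[of i] c1] DERIV_mult[OF dk[OF p] c3]]
      by (simp add: G1_0 G_0 s_0 P_def D_def A_def)
  qed simp
  have zz: "(\<Sum>i\<in>UNIV. z $ i * z $ i) = s0" by (simp add: s0_def inner_vec_def)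
  have dsum: "(\<Sum>i\<in>UNIV. d i j * c i) = c j" for j c
    by (simp add: d_def if_distrib[of "\<lambda>a. a * _"] cong: if_cong)
  have pw1: "s0 powr (m - 1) = P / s0" and pw2: "s0 powr (m - 2) = P / s0\<^sup>2"
    using s0 by (simp_all add: P_def powr_diff powr_numeral)
  have k10: "k1 i 0 = 2 * m * P / s0 * z $ i" for i
    by (simp add: k1_def s_0 pw1)
  have k2': "k2 i = (4 * m * (m - 1) * P / s0\<^sup>2) * (z $ i * z $ i) + 2 * m * P / s0" for i
    using s0 by (simp add: k2_def pw1 pw2 field_simps)
  \<comment> \<open>Coefficient of \<open>u\<close>: the weight is harmonic, which fixes
    \<open>m = (2 - n) / 2\<close>.\<close>
  have S1: "(\<Sum>i\<in>UNIV. k2 i) = 0"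
  proof -
    have "(\<Sum>i\<in>UNIV. k2 i) = (4 * m * (m - 1) * P / s0\<^sup>2) * s0 + N * (2 * m * P / s0)"
      unfolding k2' sum.distrib sum_distrib_left[symmetric] zz by (simp add: N_def)
    also have "\<dots> = 0" using s0 by (simp add: field_simps power2_eq_square m_def)
    finally show ?thesis .
  qed
  \<comment> \<open>Coefficient of the gradient: the cross terms with the weight cancel the second
    derivatives of the inversion, again by the choice of \<open>m\<close>.\<close>
  have S2: "(\<Sum>i\<in>UNIV. 2 * k1 i 0 * g1 i j + P * g2 i j) = 0" for j
  proof -
    have e: "2 * k1 i 0 * g1 i j + P * g2 i j =
       P * l\<^sup>2 / s0\<^sup>2 * ((4 * m - 4) * (d i j * z $ i) + (8 - 8 * m) * z $ j / s0 * (z $ i * z $ i) - 2 * z $ j)" for i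
      unfolding k10 g1_def g2_def using s0 by (simp add: field_simps power2_eq_square power3_eq_cube)
    have "(\<Sum>i\<in>UNIV. 2 * k1 i 0 * g1 i j + P * g2 i j) =
       P * l\<^sup>2 / s0\<^sup>2 * ((4 * m - 4) * z $ j + (8 - 8 * m) * z $ j / s0 * s0 - N * (2 * z $ j))"
      unfolding e sum_distrib_left[symmetric] sum_subtractf sum.distrib zz dsum by (simp add: N_def)
    also have "\<dots> = 0" using s0 by (simp add: m_def field_simps)
    finally show ?thesis .
  qed
  \<comment> \<open>Coefficient of the Hessian: the Jacobian of the inversion is
    \<open>l\<^sup>2 / s0\<close> times an orthogonal matrix, so only the trace of the Hessian
    survives.\<close>
  have S3: "(\<Sum>i\<in>UNIV. g1 i j * g1 i k) = (l\<^sup>2 / s0)\<^sup>2 * d j k" for j k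
  proof -
    have e: "g1 i j * g1 i k = (l\<^sup>2 / s0)\<^sup>2 * (d i j * d i k - 2 * z $ k / s0 * (d i j * z $ i) - 2 * z $ j / s0 * (d i k * z $ i)
        + 4 * z $ j * z $ k / s0\<^sup>2 * (z $ i * z $ i))" for i
      unfolding g1_def using s0 by (simp add: field_simps power2_eq_square)
    show ?thesis
      unfolding e sum_distrib_left[symmetric] sum_subtractf sum.distrib zz dsum
      using s0 by (simp add: field_simps power2_eq_square)
  qed
  have "(\<Sum>i\<in>UNIV. h i) = (\<Sum>i\<in>UNIV. k2 i * u Y + (\<Sum>j\<in>UNIV. (2 * k1 i 0 * g1 i j + P * g2 i j) * A j)
      + P * (\<Sum>j\<in>UNIV. \<Sum>k\<in>UNIV. g1 i j * g1 i k * B j k))"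
    unfolding h_def D_def
    by (intro sum.cong refl) (simp add: sum.distrib sum_distrib_left sum_distrib_right algebra_simps)
  also have "\<dots> = (\<Sum>i\<in>UNIV. k2 i) * u Y + (\<Sum>j\<in>UNIV. (\<Sum>i\<in>UNIV. 2 * k1 i 0 * g1 i j + P * g2 i j) * A j)
      + P * (\<Sum>j\<in>UNIV. \<Sum>k\<in>UNIV. (\<Sum>i\<in>UNIV. g1 i j * g1 i k) * B j k)"
  proof -
    have a: "(\<Sum>i\<in>UNIV. \<Sum>j\<in>UNIV. (2 * k1 i 0 * g1 i j + P * g2 i j) * A j) = (\<Sum>j\<in>UNIV. (\<Sum>i\<in>UNIV. 2 * k1 i 0 * g1 i j + P * g2 i j) * A j)"
      unfolding sum_distrib_right by (rule sum.swap)
    have b: "(\<Sum>i\<in>UNIV. \<Sum>j\<in>UNIV. \<Sum>k\<in>UNIV. g1 i j * g1 i k * B j k) = (\<Sum>j\<in>UNIV. \<Sum>k\<in>UNIV. (\<Sum>i\<in>UNIV. g1 i j * g1 i k) * B j k)"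
      unfolding sum_distrib_right by (subst sum.swap) (intro sum.cong refl sum.swap)
    show ?thesis unfolding sum.distrib sum_distrib_left[of P, symmetric] sum_distrib_right[of _ _ "u Y", symmetric] a b ..
  qed
  also have "\<dots> = P * (l\<^sup>2 / s0)\<^sup>2 * laplacian u Y"
  proof -
    have "(\<Sum>j\<in>UNIV. \<Sum>k\<in>UNIV. (l\<^sup>2 / s0)\<^sup>2 * d j k * B j k) = (l\<^sup>2 / s0)\<^sup>2 * (\<Sum>j\<in>UNIV. B j j)"
      unfolding sum_distrib_left
      by (simp add: d_def if_distrib[of "\<lambda>a. a * _"] if_distrib[of "\<lambda>a. _ * a"] cong: if_cong)
    then show ?thesis unfolding S1 S2 S3 laplacian_def B_def by simp
  qed
  finally have hs: "(\<Sum>i\<in>UNIV. h i) = P * (l\<^sup>2 / s0)\<^sup>2 * laplacian u Y" .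
  have nz: "norm z > 0" using z0 by simp
  have P': "P = norm z powr (2 - N)" unfolding P_def m_def s0_def inner_power_half ..
  have s0': "s0 = norm z powr 2" using nz by (simp add: s0_def power2_norm_eq_inner)
  have co: "l powr (N - 2) * (P * (l\<^sup>2 / s0)\<^sup>2) = (l / norm z) powr (N + 2)"
  proof -
    have "l powr (N - 2) * (l\<^sup>2)\<^sup>2 = l powr (N + 2)"
    proof -
      have "(l\<^sup>2)\<^sup>2 = l powr 4" using l by (simp flip: power_mult)
      then show ?thesis by (simp add: add.commute flip: powr_add)
    qed
    moreover have "P / s0\<^sup>2 = 1 / norm z powr (N + 2)"
    proof -
      have "s0\<^sup>2 = norm z powr 4" using nz by (simp add: s0' powr_powr flip: powr_numeral)
      then have "P / s0\<^sup>2 = norm z powr (2 - N) / norm z powr 4" by (simp only: P')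
      also have "\<dots> = norm z powr (2 - N - 4)" by (rule powr_diff[symmetric])
      also have "2 - N - 4 = - (N + 2)" by simp
      finally show ?thesis by (simp only: powr_minus_divide)
    qed
    moreover have "l powr (N - 2) * (P * (l\<^sup>2 / s0)\<^sup>2) = (l powr (N - 2) * (l\<^sup>2)\<^sup>2) * (P / s0\<^sup>2)"
      by (simp add: power_divide)
    ultimately show ?thesis using l nz by (simp add: powr_divide)
  qed
  have "has_lap (\<lambda>y. l powr (N - 2) * (((y - x) \<bullet> (y - x)) powr m * u (x + (l\<^sup>2 / ((y - x) \<bullet> (y - x))) *\<^sub>R (y - x)))) y
    (l powr (N - 2) * (P * (l\<^sup>2 / s0)\<^sup>2 * laplacian u Y))"
    using has_lap_cmult[OF main] unfolding hs .
  moreover have "(\<lambda>y. l powr (N - 2) * (((y - x) \<bullet> (y - x)) powr m * u (x + (l\<^sup>2 / ((y - x) \<bullet> (y - x))) *\<^sub>R (y - x)))) = kelvin x l u"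
    unfolding m_def N_def by (rule ext) (rule kelvin_alt[OF l, symmetric])
  moreover have "l powr (N - 2) * (P * (l\<^sup>2 / s0)\<^sup>2 * laplacian u Y) = (l / norm z) powr (N + 2) * laplacian u Y"
    using co by (simp add: algebra_simps)
  moreover have "x + (l / norm z)\<^sup>2 *\<^sub>R z = Y" using Yeq by (simp only: z_def)
  ultimately show ?thesis unfolding N_def[symmetric] z_def[symmetric] by simp
qed

text \<open>The function is the Kelvin transform of the constant 1 about the unit sphere, so
  harmonicity is inherited from the constant.\<close>

lemma has_lap_fundamental:
  fixes x y :: "real^'n"
  assumes "y \<noteq> x"
  shows "has_lap (\<lambda>y. norm (y - x) powr (2 - real CARD('n))) y 0"
proof -
  have p: "partial (\<lambda>_::real^'n. c) i = (\<lambda>_. 0)" for c :: real and i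
    by (auto simp: partial_def fun_eq_iff)
  have "C2_on UNIV (\<lambda>_::real^'n. 1)" by (simp add: C2_on_def p)
  from has_lap_kelvin[OF _ assms _ this, of 1]
  have "has_lap (kelvin x 1 (\<lambda>_. 1)) y 0" by (simp add: laplacian_def p)
  moreover have "kelvin x 1 (\<lambda>_. 1) = (\<lambda>y. norm (y - x) powr (2 - real CARD('n)))"
    unfolding kelvin_alt[of 1, simplified] inner_power_half[symmetric] by (simp add: fun_eq_iff)
  ultimately show ?thesis by simp
qed

section \<open>The damped scalar equation\<close>

lemma not_pos_if_derivative_le_neg:
  fixes \<psi> \<psi>' :: "real \<Rightarrow> real"
  assumes "\<And>t. t \<ge> t0 \<Longrightarrow> (\<psi> has_real_derivative \<psi>' t) (at t)" "\<And>t. t \<ge> t0 \<Longrightarrow> \<psi>' t \<le> - K" "K > 0"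
  shows "\<exists>t\<ge>t0. \<psi> t \<le> 0"
proof (cases "\<psi> t0 \<le> 0")
  case False
  define t1 where "t1 = t0 + \<psi> t0 / K"
  have "t0 < t1" using False assms(3) by (simp add: t1_def)
  from MVT2[OF this, of \<psi> \<psi>'] assms(1)
  obtain z where z: "t0 < z" "\<psi> t1 - \<psi> t0 = (t1 - t0) * \<psi>' z" by auto
  have "(t1 - t0) * \<psi>' z \<le> (t1 - t0) * (- K)"
    using assms(2)[of z] z \<open>t0 < t1\<close> by (intro mult_left_mono) auto
  then have "\<psi> t1 \<le> 0" using z assms(3) by (simp add: t1_def)
  then show ?thesis using \<open>t0 < t1\<close> by (intro exI[of _ t1]) auto
qed auto

lemma not_pos_if_derivative_ge_pos:
  fixes \<psi> \<psi>' :: "real \<Rightarrow> real"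
  assumes "\<And>t. t \<le> t0 \<Longrightarrow> (\<psi> has_real_derivative \<psi>' t) (at t)" "\<And>t. t \<le> t0 \<Longrightarrow> \<psi>' t \<ge> K" "K > 0"
  shows "\<exists>t\<le>t0. \<psi> t \<le> 0"
proof -
  have "\<exists>t\<ge>-t0. \<psi> (- t) \<le> 0"
  proof (rule not_pos_if_derivative_le_neg)
    show "((\<lambda>t. \<psi> (- t)) has_real_derivative - \<psi>' (- t)) (at t)" if "t \<ge> - t0" for t
      using assms(1)[of "- t"] that by (simp add: DERIV_mirror)
  qed (use assms in auto)
  then obtain t where "t \<ge> - t0" "\<psi> (- t) \<le> 0" by blast
  then show ?thesis by (intro exI[of _ "- t"]) auto
qed

lemma antimono_if_derivative_nonpos:
  fixes f f' :: "real \<Rightarrow> real"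
  assumes "\<And>x. (f has_real_derivative f' x) (at x)" "\<And>x. s \<le> x \<Longrightarrow> x \<le> t \<Longrightarrow> f' x \<le> 0" "s \<le> t"
  shows "f t \<le> f s"
  by (rule DERIV_nonpos_imp_nonincreasing[OF assms(3)]) (use assms in blast)

text \<open>Comparison principle on a half line: \<open>w\<close> starts nonpositive and tends to 0,
  so a positive value would produce an interior positive maximum. The differential inequality is
  therefore only demanded at positive critical points, where the first-order term of an equation can
  be substituted.\<close>

lemma no_positive_max:
  fixes w w1 w2 :: "real \<Rightarrow> real"
  assumes d1: "\<And>t. (w has_real_derivative w1 t) (at t)" and d2: "\<And>t. (w1 has_real_derivative w2 t) (at t)"
    and T: "w T \<le> 0" and lim: "(w \<longlongrightarrow> 0) at_top"
    and conv: "\<And>t. t \<ge> T \<Longrightarrow> w t > 0 \<Longrightarrow> w1 t = 0 \<Longrightarrow> w2 t > 0"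
    and t: "t \<ge> T"
  shows "w t \<le> 0"
proof (rule ccontr)
  assume "\<not> w t \<le> 0" then have wt: "w t > 0" by simp
  obtain T2 where T2: "\<And>s. s \<ge> T2 \<Longrightarrow> w s < w t"
    using order_tendstoD(2)[OF lim wt] unfolding eventually_at_top_linorder by blast
  define T3 where "T3 = max T2 t"
  have "continuous_on {T..T3} w"
    using d1 DERIV_isCont by (intro continuous_at_imp_continuous_on) blast
  moreover have "T \<le> T3" using t by (simp add: T3_def)
  ultimately obtain m where m: "m \<in> {T..T3}" "\<And>s. s \<in> {T..T3} \<Longrightarrow> w s \<le> w m"
    using continuous_attains_sup[of "{T..T3}" w] by auto
  have mt: "w m \<ge> w t" using m(2)[of t] t by (simp add: T3_def)
  have "m \<noteq> T" "m \<noteq> T3" using mt wt T T2[of T3] by (auto simp: T3_def)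
  with m(1) have int: "T < m" "m < T3" by auto
  have "w1 m = 0"
    by (rule DERIV_local_max[OF d1, of "min (m - T) (T3 - m)"]) (use int in \<open>auto intro!: m(2) simp: abs_less_iff\<close>)
  moreover have "- w2 m \<ge> 0"
  proof (rule second_derivative_nonneg_at_local_min[of "\<lambda>t. - w t" "\<lambda>t. - w1 t"])
    show "\<forall>\<^sub>F t in nhds m. ((\<lambda>t. - w t) has_real_derivative - w1 t) (at t)"
      by (intro always_eventually allI DERIV_minus d1)
    show "((\<lambda>t. - w1 t) has_real_derivative - w2 m) (at m)" by (intro DERIV_minus d2)
    have "\<forall>\<^sub>F s in nhds m. s \<in> {T<..<T3}" by (rule eventually_nhds_in_open) (use int in auto)
    then show "\<forall>\<^sub>F s in nhds m. - w m \<le> - w s" by eventually_elim (use m(2) in auto)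
  qed
  ultimately show False using conv[of m] m mt wt by auto
qed

text \<open>Barbalat's lemma. Over a step of length \<open>d = e / (2 * M')\<close> the derivative
  changes by at most \<open>e / 2\<close>, while its mean over the step becomes small because the
  function converges.\<close>

lemma derivative_tendsto_0:
  fixes \<phi> g h :: "real \<Rightarrow> real"
  assumes d1: "\<And>t. (\<phi> has_real_derivative g t) (at t)" and d2: "\<And>t. (g has_real_derivative h t) (at t)"
    and bd: "\<And>t. \<bar>h t\<bar> \<le> M" and lim: "(\<phi> \<longlongrightarrow> l) at_top"
  shows "(g \<longlongrightarrow> 0) at_top"
proof (rule tendstoI)
  fix e :: real assume e: "e > 0"
  define M' where "M' = \<bar>M\<bar> + 1"
  have M': "M' > 0" unfolding M'_def by simp
  have hM: "\<bar>h t\<bar> \<le> M'" for t using bd[of t] unfolding M'_def by linarith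
  define d where "d = e / (2 * M')"
  have d: "d > 0" using e M' by (simp add: d_def)
  have "((\<lambda>t. \<phi> (t + d)) \<longlongrightarrow> l) at_top"
    by (rule filterlim_compose[OF lim], subst add.commute)
       (rule filterlim_tendsto_add_at_top[OF tendsto_const filterlim_ident])
  then have "((\<lambda>t. \<phi> (t + d) - \<phi> t) \<longlongrightarrow> l - l) at_top" using lim by (intro tendsto_diff)
  then have "((\<lambda>t. \<phi> (t + d) - \<phi> t) \<longlongrightarrow> 0) at_top" by simp
  from tendstoD[OF this, of "d * (e / 2)"] d e
  have "\<forall>\<^sub>F t in at_top. \<bar>\<phi> (t + d) - \<phi> t\<bar> < d * (e / 2)" by (simp add: dist_real_def)
  then show "\<forall>\<^sub>F t in at_top. dist (g t) 0 < e"
  proof eventually_elim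
    case (elim t)
    obtain z where z: "t < z" "z < t + d" "\<phi> (t + d) - \<phi> t = (t + d - t) * g z"
      using MVT2[of t "t + d" \<phi> g] d d1 by auto
    have gz: "\<bar>g z\<bar> < e / 2"
      using elim z d by (simp add: abs_mult)
    obtain y where y: "g z - g t = (z - t) * h y"
      using MVT2[of t z g h] z d2 by auto
    have "\<bar>g z - g t\<bar> \<le> d * M'"
      unfolding y abs_mult by (rule mult_mono) (use z hM M' d in auto)
    then have "\<bar>g z - g t\<bar> \<le> e / 2" using M' by (simp add: d_def)
    then show ?case using gz unfolding dist_real_def by linarith
  qed
qed

lemma increasing_bounded_convergent:
  fixes E :: "real \<Rightarrow> real"
  assumes mono: "\<And>s t. s \<le> t \<Longrightarrow> E s \<le> E t" and bd: "\<And>t. E t \<le> M"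
  shows "\<exists>l. (E \<longlongrightarrow> l) at_top"
proof
  have bdd: "bdd_above (range E)" using bdd_aboveI2[of UNIV E M] bd by simp
  show "(E \<longlongrightarrow> Sup (range E)) at_top"
  proof (rule increasing_tendsto)
    show "\<forall>\<^sub>F t in at_top. E t \<le> Sup (range E)"
      by (intro always_eventually allI cSup_upper bdd) auto
    fix x assume "x < Sup (range E)"
    then obtain s where s: "x < E s" using less_cSup_iff[OF _ bdd] by auto
    show "\<forall>\<^sub>F t in at_top. x < E t"
      using eventually_ge_at_top[of s] by eventually_elim (use mono s in force)
  qed
qed

section \<open>Positive entire solutions of the scalar equation\<close>

text \<open>The linear part factors as \<open>(D - \<alpha>) (D + \<gamma>) a = - f\<close> with
  \<open>D\<close> the derivative. Since \<open>f\<close> is positive, each factor yields a monotone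
  quantity once multiplied by its integrating exponential; all bounds below come from these
  two.\<close>

locale damped_eq =
  fixes a a1 f :: "real \<Rightarrow> real" and \<alpha> \<gamma> :: real
  assumes \<gamma>: "0 < \<gamma>" "\<gamma> < \<alpha>"
    and apos: "a t > 0" and fpos: "f t > 0"
    and da: "(a has_real_derivative a1 t) (at t)"
    and da1: "(a1 has_real_derivative (\<alpha> - \<gamma>) * a1 t + \<alpha> * \<gamma> * a t - f t) (at t)"
begin

lemma exp_c: "((\<lambda>t. exp (\<gamma> * t) * (a1 t - \<alpha> * a t)) has_real_derivative - exp (\<gamma> * t) * f t) (at t)"
  by (auto intro!: derivative_eq_intros da da1 simp: algebra_simps)

lemma exp_d: "((\<lambda>t. exp (- \<alpha> * t) * (a1 t + \<gamma> * a t)) has_real_derivative - exp (- \<alpha> * t) * f t) (at t)"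
  by (auto intro!: derivative_eq_intros da da1 simp: algebra_simps)

lemma exp_a: "((\<lambda>t. exp (- \<alpha> * t) * a t) has_real_derivative exp (- \<alpha> * t) * (a1 t - \<alpha> * a t)) (at t)"
  by (auto intro!: derivative_eq_intros da da1 simp: algebra_simps)

lemma exp_a': "((\<lambda>t. exp (\<gamma> * t) * a t) has_real_derivative exp (\<gamma> * t) * (a1 t + \<gamma> * a t)) (at t)"
  by (auto intro!: derivative_eq_intros da da1 simp: algebra_simps)

text \<open>A violation at \<open>t\<close> persists for all earlier times, because
  \<open>exp (\<gamma> * s) * (a1 s - \<alpha> * a s)\<close> decreases in \<open>s\<close>. Then
  \<open>exp (- \<alpha> * s) * a s\<close> has a derivative bounded below by a positive constant on
  the past half line and must become nonpositive.\<close>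

lemma a1_le: "a1 t \<le> \<alpha> * a t"
proof (rule ccontr)
  assume "\<not> ?thesis"
  then have c: "a1 t - \<alpha> * a t > 0" by simp
  define K where "K = exp (\<gamma> * t) * (a1 t - \<alpha> * a t)"
  have K: "K > 0" using c by (simp add: K_def)
  have ge: "exp (\<gamma> * s) * (a1 s - \<alpha> * a s) \<ge> K" if "s \<le> t" for s
    unfolding K_def by (rule antimono_if_derivative_nonpos[OF exp_c _ that]) (simp add: less_imp_le[OF fpos])
  have "\<exists>s\<le>t. exp (- \<alpha> * s) * a s \<le> 0"
  proof (rule not_pos_if_derivative_ge_pos[OF exp_a])
    fix s assume s: "s \<le> t"
    have "exp (- (\<alpha> + \<gamma>) * t) * K \<le> exp (- (\<alpha> + \<gamma>) * s) * K"
      using s \<gamma> K by (intro mult_right_mono) auto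
    also have "\<dots> \<le> exp (- (\<alpha> + \<gamma>) * s) * (exp (\<gamma> * s) * (a1 s - \<alpha> * a s))"
      by (intro mult_left_mono ge s) auto
    also have "\<dots> = exp (- \<alpha> * s) * (a1 s - \<alpha> * a s)"
      by (simp add: algebra_simps mult_exp_exp)
    finally show "exp (- (\<alpha> + \<gamma>) * t) * K \<le> exp (- \<alpha> * s) * (a1 s - \<alpha> * a s)" .
  qed (use K in auto)
  then show False using apos by (auto simp: mult_le_0_iff not_le[symmetric])
qed

text \<open>The mirror image of the upper bound, run forwards in time with the other factor of the
  linear part.\<close>

lemma a1_ge: "a1 t \<ge> - \<gamma> * a t"
proof (rule ccontr)
  assume "\<not> ?thesis"
  then have c: "a1 t + \<gamma> * a t < 0" by simp
  define K where "K = - exp (- \<alpha> * t) * (a1 t + \<gamma> * a t)"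
  have K: "K > 0" using c by (simp add: K_def mult_pos_neg)
  have ge: "exp (- \<alpha> * s) * (a1 s + \<gamma> * a s) \<le> - K" if "t \<le> s" for s
  proof -
    have "exp (- \<alpha> * s) * (a1 s + \<gamma> * a s) \<le> exp (- \<alpha> * t) * (a1 t + \<gamma> * a t)"
      by (rule antimono_if_derivative_nonpos[OF exp_d _ that]) (simp add: less_imp_le[OF fpos])
    then show ?thesis by (simp add: K_def)
  qed
  have "\<exists>s\<ge>t. exp (\<gamma> * s) * a s \<le> 0"
  proof (rule not_pos_if_derivative_le_neg[OF exp_a'])
    fix s assume s: "s \<ge> t"
    have "exp (\<gamma> * s) * (a1 s + \<gamma> * a s) = exp ((\<alpha> + \<gamma>) * s) * (exp (- \<alpha> * s) * (a1 s + \<gamma> * a s))"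
      by (simp add: algebra_simps mult_exp_exp)
    also have "\<dots> \<le> exp ((\<alpha> + \<gamma>) * s) * (- K)"
      by (intro mult_left_mono ge s) auto
    also have "\<dots> \<le> exp ((\<alpha> + \<gamma>) * t) * (- K)"
      using s \<gamma> K by (intro mult_right_mono_neg) auto
    finally show "exp (\<gamma> * s) * (a1 s + \<gamma> * a s) \<le> - (exp ((\<alpha> + \<gamma>) * t) * K)" by simp
  qed (use K in auto)
  then show False using apos by (auto simp: mult_le_0_iff not_le[symmetric])
qed

lemma abs_a1_le: "\<bar>a1 t\<bar> \<le> \<alpha> * a t"
proof -
  have "\<gamma> * a t \<le> \<alpha> * a t" using \<gamma> apos[of t] by (intro mult_right_mono) auto
  then show ?thesis using a1_le[of t] a1_ge[of t] by simp
qed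

text \<open>A Harnack argument over unit time: \<open>exp (- \<alpha> * s) * a s\<close> decreases,
  so \<open>a\<close> is at least \<open>exp (- \<alpha>) * a t\<close> on the preceding unit
  interval. The superlinear \<open>f\<close> lowers \<open>c\<close> there by a multiple of
  \<open>a t powr (r + 1)\<close>, but \<open>c\<close> is never positive and \<open>- c t\<close>
  is at most linear in \<open>a t\<close>.\<close>

lemma bounded_above:
  assumes f: "\<And>t. f t \<ge> m * a t powr (r + 1)" and m: "m > 0" "r > 0"
  shows "\<exists>M>0. \<forall>t. a t \<le> M"
proof -
  define c where "c t = exp (\<gamma> * t) * (a1 t - \<alpha> * a t)" for t
  define k where "k = m * exp (- \<alpha> * (r + 1)) * exp (- \<gamma>)"
  have k: "k > 0" using m by (simp add: k_def)
  have "a t \<le> ((\<alpha> + \<gamma>) / k) powr (1 / r)" for t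
  proof -
    have lower: "a s \<ge> exp (- \<alpha>) * a t" if s: "t - 1 \<le> s" "s \<le> t" for s
    proof -
      have "exp (- \<alpha> * t) * a t \<le> exp (- \<alpha> * s) * a s"
        by (rule antimono_if_derivative_nonpos[OF exp_a _ s(2)]) (simp add: mult_nonneg_nonpos a1_le)
      then have "exp (\<alpha> * s) * (exp (- \<alpha> * t) * a t) \<le> exp (\<alpha> * s) * (exp (- \<alpha> * s) * a s)"
        by (intro mult_left_mono) auto
      moreover have "exp (\<alpha> * s) * (exp (- \<alpha> * t) * a t) = exp (\<alpha> * (s - t)) * a t"
        by (simp add: mult.assoc[symmetric] mult_exp_exp right_diff_distrib)
      moreover have "exp (\<alpha> * s) * (exp (- \<alpha> * s) * a s) = a s"
        by (simp add: mult.assoc[symmetric] mult_exp_exp)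
      ultimately have "exp (\<alpha> * (s - t)) * a t \<le> a s" by (simp only:)
      moreover have "- \<alpha> \<le> \<alpha> * (s - t)"
        using mult_left_mono[of "-1" "s - t" \<alpha>] s \<gamma> by simp
      then have "exp (- \<alpha>) * a t \<le> exp (\<alpha> * (s - t)) * a t"
        using apos[of t] by (intro mult_right_mono) auto
      ultimately show ?thesis by linarith
    qed
    obtain z where z: "t - 1 < z" "z < t" "c t - c (t - 1) = (t - (t - 1)) * (- exp (\<gamma> * z) * f z)"
      using MVT2[of "t - 1" t c "\<lambda>z. - exp (\<gamma> * z) * f z"] exp_c unfolding c_def by auto
    have "c (t - 1) \<le> 0" unfolding c_def using a1_le by (intro mult_nonneg_nonpos) auto
    then have "exp (\<gamma> * z) * f z \<le> - c t" using z by simp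
    moreover have "- c t \<le> exp (\<gamma> * t) * ((\<alpha> + \<gamma>) * a t)"
    proof -
      have "- c t = exp (\<gamma> * t) * (\<alpha> * a t - a1 t)" by (simp add: c_def algebra_simps)
      also have "\<dots> \<le> exp (\<gamma> * t) * ((\<alpha> + \<gamma>) * a t)"
        using a1_ge[of t] by (intro mult_left_mono) (auto simp: distrib_right)
      finally show ?thesis .
    qed
    moreover have "exp (\<gamma> * (t - 1)) * (m * (exp (- \<alpha>) * a t) powr (r + 1)) \<le> exp (\<gamma> * z) * f z"
    proof (intro mult_mono)
      have "m * (exp (- \<alpha>) * a t) powr (r + 1) \<le> m * a z powr (r + 1)"
        using m apos[of t] by (intro mult_left_mono powr_mono2 lower) (use z in auto)
      then show "m * (exp (- \<alpha>) * a t) powr (r + 1) \<le> f z" using f[of z] by linarith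
    qed (use z \<gamma> m in auto)
    moreover have "exp (\<gamma> * (t - 1)) * (m * (exp (- \<alpha>) * a t) powr (r + 1)) = exp (\<gamma> * t) * (k * a t powr r) * a t"
    proof -
      have "(exp (- \<alpha>) * a t) powr (r + 1) = exp (- \<alpha> * (r + 1)) * (a t powr r * a t)"
        using apos[of t] by (simp add: powr_mult exp_powr_real powr_add mult_exp_exp distrib_left)
      moreover have "exp (\<gamma> * (t - 1)) = exp (\<gamma> * t) * exp (- \<gamma>)"
        by (simp add: mult_exp_exp right_diff_distrib)
      ultimately show ?thesis by (simp only: k_def mult_ac)
    qed
    ultimately have "exp (\<gamma> * t) * (k * a t powr r) * a t \<le> exp (\<gamma> * t) * ((\<alpha> + \<gamma>) * a t)" by linarith
    then have "k * a t powr r \<le> \<alpha> + \<gamma>" using apos[of t] by (simp add: mult.assoc[symmetric])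
    then have "a t powr r \<le> (\<alpha> + \<gamma>) / k" using k by (simp add: field_simps)
    then have "(a t powr r) powr (1 / r) \<le> ((\<alpha> + \<gamma>) / k) powr (1 / r)"
      using m by (intro powr_mono2) auto
    then show ?thesis using apos[of t] m by (simp add: powr_powr)
  qed
  then show ?thesis using k \<gamma> by (intro exI[of _ "((\<alpha> + \<gamma>) / k) powr (1 / r)"]) auto
qed

text \<open>Where \<open>a\<close> is below \<open>e0\<close> it cannot have a local minimum with
  zero slope, since the second derivative there is \<open>\<alpha> * \<gamma> * a - f < 0\<close>.
  Once below both \<open>e0\<close> and its initial value, \<open>a\<close> keeps decreasing, is
  concave, and would reach zero.\<close>

lemma bounded_below:
  assumes e0: "e0 > 0" and T: "\<And>t. t \<ge> T \<Longrightarrow> a t < e0 \<Longrightarrow> \<alpha> * \<gamma> * a t < f t"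
  shows "\<exists>e>0. \<forall>t\<ge>T. a t \<ge> e"
proof (intro exI[of _ "min e0 (a T)"] conjI allI impI)
  show "min e0 (a T) > 0" using e0 apos by simp
  fix t2 assume t2: "t2 \<ge> T"
  show "min e0 (a T) \<le> a t2"
  proof (rule ccontr)
    assume "\<not> ?thesis" then have lt: "a t2 < e0" "a t2 < a T" by auto
    have dec: "a1 t3 \<le> 0" if t3: "t3 \<ge> t2" for t3
    proof (rule ccontr)
      assume "\<not> a1 t3 \<le> 0" then have pos: "a1 t3 > 0" by simp
      have "continuous_on {T..t3} a"
        using da DERIV_isCont by (intro continuous_at_imp_continuous_on) blast
      then obtain m where m: "m \<in> {T..t3}" "\<And>s. s \<in> {T..t3} \<Longrightarrow> a m \<le> a s"
        using continuous_attains_inf[of "{T..t3}" a] t2 t3 by auto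
      have mt: "a m \<le> a t2" using m(2) t2 t3 by auto
      then have "m \<noteq> T" using lt by auto
      moreover have "m \<noteq> t3"
      proof
        assume "m = t3"
        obtain d where d: "d > 0" "\<And>h. h > 0 \<Longrightarrow> h < d \<Longrightarrow> a (t3 - h) < a t3"
          using DERIV_pos_inc_left[OF da pos] by blast
        have "T < t3" using \<open>m = t3\<close> \<open>m \<noteq> T\<close> m(1) by auto
        define e where "e = min d (t3 - T) / 2"
        have e: "e > 0" "e < d" "e < t3 - T" using d(1) \<open>T < t3\<close> by (auto simp: e_def min_def)
        then have "a m \<le> a (t3 - e)" by (intro m(2)) auto
        then show False using d(2)[OF e(1,2)] \<open>m = t3\<close> by simp
      qed
      ultimately have int: "T < m" "m < t3" using m(1) by auto
      have "a1 m = 0"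
        by (rule DERIV_local_min[OF da, of "min (m - T) (t3 - m)"]) (use int in \<open>auto intro!: m(2) simp: abs_less_iff\<close>)
      moreover have "(\<alpha> - \<gamma>) * a1 m + \<alpha> * \<gamma> * a m - f m \<ge> 0"
      proof (rule second_derivative_nonneg_at_local_min[OF _ da1])
        have "\<forall>\<^sub>F s in nhds m. s \<in> {T<..<t3}" by (rule eventually_nhds_in_open) (use int in auto)
        then show "\<forall>\<^sub>F s in nhds m. a m \<le> a s" by eventually_elim (use m(2) in auto)
      qed (use da in auto)
      ultimately show False using T[of m] int mt lt by auto
    qed
    have le: "a s < e0" if "s \<ge> t2" for s
    proof -
      have "a s \<le> a t2"
        by (rule antimono_if_derivative_nonpos[OF da _ that]) (use dec in auto)
      then show ?thesis using lt by simp
    qed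
    have neg: "(\<alpha> - \<gamma>) * a1 s + \<alpha> * \<gamma> * a s - f s < 0" if "s \<ge> t2" for s
    proof -
      have "(\<alpha> - \<gamma>) * a1 s \<le> 0" using dec[OF that] \<gamma> by (simp add: mult_nonneg_nonpos)
      then show ?thesis using T[of s] le[OF that] that t2 by linarith
    qed
    \<comment> \<open>At \<open>t2\<close> the slope is only known to be nonpositive; after one unit
      of strict concavity it is strictly negative, and it stays at most \<open>- K\<close>.\<close>
    define K where "K = - a1 (t2 + 1)"
    have "a1 (t2 + 1) < a1 t2"
      by (rule DERIV_neg_imp_decreasing[of t2 "t2 + 1" a1]) (simp, metis da1 neg)
    then have K: "K > 0" using dec[of t2] by (simp add: K_def)
    have "\<exists>s\<ge>t2 + 1. a s \<le> 0"
    proof (rule not_pos_if_derivative_le_neg[OF da _ K])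
      fix s assume "s \<ge> t2 + 1"
      have "a1 s \<le> a1 (t2 + 1)"
        by (rule antimono_if_derivative_nonpos[OF da1 _ \<open>s \<ge> t2 + 1\<close>]) (use neg in \<open>auto intro: less_imp_le\<close>)
      then show "a1 s \<le> - K" by (simp add: K_def)
    qed
    then show False using apos by (auto simp: not_le[symmetric])
  qed
qed

text \<open>A first barrier gives exponential decay at some small rate \<delta>. This makes
  \<open>f / a\<close> exponentially small, and a second barrier, a perturbation of
  \<open>exp (- \<gamma> * t)\<close>, then yields the exact rate.\<close>

lemma fast_decay:
  assumes lim: "(a \<longlongrightarrow> 0) at_top" and f: "\<And>t. t \<ge> T0 \<Longrightarrow> f t \<le> C * a t powr (1 + \<epsilon>)" and eps: "\<epsilon> > 0"
  shows "\<exists>K>0. \<exists>T. \<forall>t\<ge>T. a t \<le> K * exp (- \<gamma> * t)"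
proof -
  define L where "L = \<alpha> * \<gamma>"
  define \<kappa> where "\<kappa> = \<alpha> - \<gamma>"
  have L: "L > 0" and \<kappa>: "\<kappa> > 0" using \<gamma> by (simp_all add: L_def \<kappa>_def)
  have quot: "f t / a t \<le> C * a t powr \<epsilon>" if "t \<ge> T0" for t
    using f[OF that] apos[of t] by (simp add: field_simps powr_add)
  have "((\<lambda>t. C * a t powr \<epsilon>) \<longlongrightarrow> C * 0) at_top"
    by (intro tendsto_mult tendsto_const tendsto_zero_powrI[OF lim tendsto_const _ eps]) (use apos in \<open>simp add: less_imp_le\<close>)
  then have "((\<lambda>t. C * a t powr \<epsilon>) \<longlongrightarrow> 0) at_top" by simp
  then have "\<forall>\<^sub>F t in at_top. C * a t powr \<epsilon> < L / 2" by (rule order_tendstoD) (use L in simp)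
  then obtain T1' where T1': "\<And>t. t \<ge> T1' \<Longrightarrow> C * a t powr \<epsilon> < L / 2"
    unfolding eventually_at_top_linorder by blast
  define T1 where "T1 = max T0 T1'"
  have T1: "f t / a t \<le> C * a t powr \<epsilon>" "f t / a t < L / 2" if "t \<ge> T1" for t
  proof -
    show "f t / a t \<le> C * a t powr \<epsilon>" using quot[of t] that by (simp add: T1_def)
    then show "f t / a t < L / 2" using T1'[of t] that unfolding T1_def by linarith
  qed
  \<comment> \<open>Small enough that
    \<open>\<delta>\<^sup>2 + \<kappa> * \<delta> \<le> L / 2\<close>, so
    \<open>exp (- \<delta> * t)\<close> is a supersolution of the linear equation with
    \<open>L\<close> replaced by \<open>L / 2\<close>; the other half absorbs
    \<open>f\<close>.\<close>
  define \<delta> where "\<delta> = min 1 (L / 2 / (1 + \<kappa>))"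
  have \<delta>: "\<delta> > 0" "\<delta> \<le> 1" using L \<kappa> by (auto simp: \<delta>_def)
  have "\<delta> * (1 + \<kappa>) \<le> L / 2 / (1 + \<kappa>) * (1 + \<kappa>)"
    using \<kappa> by (intro mult_right_mono) (auto simp: \<delta>_def)
  moreover have "L / 2 / (1 + \<kappa>) * (1 + \<kappa>) = L / 2" using \<kappa> by (simp add: field_simps)
  ultimately have "\<delta> * (1 + \<kappa>) \<le> L / 2" by (simp only:)
  moreover have "\<delta> * \<delta> \<le> \<delta>" using \<delta> mult_left_mono[of \<delta> 1 \<delta>] by simp
  ultimately have \<delta>L: "\<delta>\<^sup>2 + \<kappa> * \<delta> \<le> L / 2" by (simp add: algebra_simps power2_eq_square)
  have exp0: "((\<lambda>t::real. exp (- c * t)) \<longlongrightarrow> 0) at_top" if "c > 0" for c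
    using filterlim_compose[OF exp_at_bot, of "\<lambda>t. - c * t" at_top] that
    by (simp add: filterlim_uminus_at_bot filterlim_tendsto_pos_mult_at_top[OF tendsto_const that filterlim_ident])
  define K1 where "K1 = a T1 * exp (\<delta> * T1)"
  have K1: "K1 > 0" using apos by (simp add: K1_def)
  have step1: "a t - K1 * exp (- \<delta> * t) \<le> 0" if t: "t \<ge> T1" for t
  proof (rule no_positive_max[where w="\<lambda>t. a t - K1 * exp (- \<delta> * t)" and ?w1.0="\<lambda>t. a1 t + \<delta> * K1 * exp (- \<delta> * t)"
        and ?w2.0="\<lambda>t. (\<alpha> - \<gamma>) * a1 t + \<alpha> * \<gamma> * a t - f t - \<delta>\<^sup>2 * K1 * exp (- \<delta> * t)" and T=T1])
    show "((\<lambda>t. a t - K1 * exp (- \<delta> * t)) has_real_derivative a1 t + \<delta> * K1 * exp (- \<delta> * t)) (at t)" for t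
      by (auto intro!: derivative_eq_intros da)
    show "((\<lambda>t. a1 t + \<delta> * K1 * exp (- \<delta> * t)) has_real_derivative (\<alpha> - \<gamma>) * a1 t + \<alpha> * \<gamma> * a t - f t - \<delta>\<^sup>2 * K1 * exp (- \<delta> * t)) (at t)" for t
      by (auto intro!: derivative_eq_intros da1 simp: power2_eq_square)
    show "a T1 - K1 * exp (- \<delta> * T1) \<le> 0" by (simp add: K1_def mult.assoc flip: exp_add)
    have "((\<lambda>t. a t - K1 * exp (- \<delta> * t)) \<longlongrightarrow> 0 - K1 * 0) at_top"
      by (intro tendsto_intros lim exp0 \<delta>)
    then show "((\<lambda>t. a t - K1 * exp (- \<delta> * t)) \<longlongrightarrow> 0) at_top" by simp
    fix s assume s: "s \<ge> T1" "a s - K1 * exp (- \<delta> * s) > 0" "a1 s + \<delta> * K1 * exp (- \<delta> * s) = 0"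
    define X where "X = K1 * exp (- \<delta> * s)"
    have X: "X > 0" using K1 by (simp add: X_def)
    have "f s < L / 2 * a s" using T1(2)[OF s(1)] apos[of s] by (simp add: field_simps)
    moreover have "(\<delta>\<^sup>2 + \<kappa> * \<delta>) * X \<le> L / 2 * X" using \<delta>L X by (intro mult_right_mono) auto
    moreover have "L / 2 * X < L / 2 * a s" using s(2) L unfolding X_def by (intro mult_strict_left_mono) auto
    moreover have "a1 s = - (\<delta> * X)" using s(3) by (simp add: X_def algebra_simps)
    ultimately have "\<kappa> * a1 s + L * a s - f s - \<delta>\<^sup>2 * X > 0" by (simp add: algebra_simps)
    then show "(\<alpha> - \<gamma>) * a1 s + \<alpha> * \<gamma> * a s - f s - \<delta>\<^sup>2 * K1 * exp (- \<delta> * s) > 0"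
      by (simp add: L_def \<kappa>_def X_def mult.assoc)
  qed (use t in auto)
  \<comment> \<open>The quotient \<open>f / a\<close> decays at rate
    \<open>\<epsilon> * \<delta> = 2 * \<sigma>\<close>: one \<sigma> goes into the correction term
    of \<open>\<psi>\<close>, the other makes the constant small.\<close>
  define \<sigma> where "\<sigma> = \<epsilon> * \<delta> / 2"
  have \<sigma>: "\<sigma> > 0" using eps \<delta> by (simp add: \<sigma>_def)
  define C' where "C' = \<bar>C\<bar> * K1 powr \<epsilon>"
  have quot2: "f t / a t \<le> C' * exp (- 2 * \<sigma> * t)" if "t \<ge> T1" for t
  proof -
    have "f t / a t \<le> C * a t powr \<epsilon>" by (rule T1(1)[OF that])
    also have "\<dots> \<le> \<bar>C\<bar> * a t powr \<epsilon>" by (intro mult_right_mono) auto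
    also have "\<dots> \<le> \<bar>C\<bar> * (K1 * exp (- \<delta> * t)) powr \<epsilon>"
      using step1[OF that] apos[of t] eps by (intro mult_left_mono powr_mono2) auto
    also have "\<dots> = C' * exp (- 2 * \<sigma> * t)"
      using K1 by (simp add: C'_def powr_mult \<sigma>_def exp_powr_real algebra_simps)
    finally show ?thesis .
  qed
  define Q where "Q = \<sigma> * (\<sigma> + \<alpha> + \<gamma>)"
  have Q: "Q > 0" using \<sigma> \<gamma> by (simp add: Q_def)
  have "((\<lambda>t. C' * exp (- \<sigma> * t)) \<longlongrightarrow> C' * 0) at_top" by (intro tendsto_intros exp0 \<sigma>)
  then have "\<forall>\<^sub>F t in at_top. C' * exp (- \<sigma> * t) < Q" using Q by (intro order_tendstoD(2)) auto
  then obtain T2' where T2': "\<And>t. t \<ge> T2' \<Longrightarrow> C' * exp (- \<sigma> * t) < Q"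
    unfolding eventually_at_top_linorder by blast
  \<comment> \<open>Positivity of \<open>\<psi>\<close> needs \<open>t > 0\<close>, hence the
    1.\<close>
  define T2 where "T2 = max (max T1 1) T2'"
  have T2: "T2 \<ge> T1" "T2 \<ge> 1" "\<And>t. t \<ge> T2 \<Longrightarrow> C' * exp (- \<sigma> * t) < Q"
    using T2' by (auto simp: T2_def)
  \<comment> \<open>Since \<open>- \<gamma>\<close> is a characteristic root, only the subtracted
    term is seen by the linear operator. It contributes
    \<open>- Q * exp (- (\<gamma> + \<sigma>) * t)\<close>, where \<open>Q\<close> is the
    characteristic polynomial at \<open>- (\<gamma> + \<sigma>)\<close>, and this outweighs
    \<open>(f / a) * \<psi>\<close>.\<close>
  define \<psi> where "\<psi> t = exp (- \<gamma> * t) - exp (- (\<gamma> + \<sigma>) * t)" for t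
  define \<psi>1 where "\<psi>1 t = - \<gamma> * exp (- \<gamma> * t) + (\<gamma> + \<sigma>) * exp (- (\<gamma> + \<sigma>) * t)" for t
  define \<psi>2 where "\<psi>2 t = \<gamma>\<^sup>2 * exp (- \<gamma> * t) - (\<gamma> + \<sigma>)\<^sup>2 * exp (- (\<gamma> + \<sigma>) * t)" for t
  have d\<psi>: "(\<psi> has_real_derivative \<psi>1 t) (at t)" for t
    unfolding \<psi>_def \<psi>1_def by (auto intro!: derivative_eq_intros simp: algebra_simps)
  have d\<psi>1: "(\<psi>1 has_real_derivative \<psi>2 t) (at t)" for t
    unfolding \<psi>1_def \<psi>2_def by (auto intro!: derivative_eq_intros simp: algebra_simps power2_eq_square)
  have \<psi>eq: "\<psi>2 t - \<kappa> * \<psi>1 t - L * \<psi> t = - Q * exp (- (\<gamma> + \<sigma>) * t)" for t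
    unfolding \<psi>2_def \<psi>1_def \<psi>_def Q_def \<kappa>_def L_def by (simp add: algebra_simps power2_eq_square)
  have \<psi>pos: "\<psi> t > 0" if "t \<ge> T2" for t
  proof -
    have "0 < \<sigma> * t" using \<sigma> that T2 by simp
    then show ?thesis unfolding \<psi>_def by (simp add: algebra_simps)
  qed
  have \<psi>lim: "(\<psi> \<longlongrightarrow> 0) at_top"
  proof -
    have "(\<psi> \<longlongrightarrow> 0 - 0) at_top" unfolding \<psi>_def by (intro tendsto_diff exp0) (use \<gamma> \<sigma> in auto)
    then show ?thesis by simp
  qed
  define K2 where "K2 = a T2 / \<psi> T2"
  have K2: "K2 > 0" using apos \<psi>pos by (simp add: K2_def)
  have step2: "a t - K2 * \<psi> t \<le> 0" if t: "t \<ge> T2" for t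
  proof (rule no_positive_max[where w="\<lambda>t. a t - K2 * \<psi> t" and ?w1.0="\<lambda>t. a1 t - K2 * \<psi>1 t"
        and ?w2.0="\<lambda>t. (\<alpha> - \<gamma>) * a1 t + \<alpha> * \<gamma> * a t - f t - K2 * \<psi>2 t" and T=T2])
    show "((\<lambda>t. a t - K2 * \<psi> t) has_real_derivative a1 t - K2 * \<psi>1 t) (at t)" for t
      by (intro DERIV_diff da DERIV_cmult d\<psi>)
    show "((\<lambda>t. a1 t - K2 * \<psi>1 t) has_real_derivative (\<alpha> - \<gamma>) * a1 t + \<alpha> * \<gamma> * a t - f t - K2 * \<psi>2 t) (at t)" for t
      by (intro DERIV_diff da1 DERIV_cmult d\<psi>1)
    show "a T2 - K2 * \<psi> T2 \<le> 0" using \<psi>pos[of T2] by (simp add: K2_def)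
    have "((\<lambda>t. a t - K2 * \<psi> t) \<longlongrightarrow> 0 - K2 * 0) at_top" by (intro tendsto_intros lim \<psi>lim)
    then show "((\<lambda>t. a t - K2 * \<psi> t) \<longlongrightarrow> 0) at_top" by simp
    fix s assume s: "s \<ge> T2" "a s - K2 * \<psi> s > 0" "a1 s - K2 * \<psi>1 s = 0"
    define h where "h = f s / a s"
    have h: "h < L / 2" "h \<le> C' * exp (- 2 * \<sigma> * s)" "f s = h * a s"
      using T1(2)[of s] quot2[of s] s T2 apos[of s] by (auto simp: h_def)
    have "h * \<psi> s \<le> C' * exp (- 2 * \<sigma> * s) * exp (- \<gamma> * s)"
    proof (rule mult_mono)
      show "\<psi> s \<le> exp (- \<gamma> * s)" by (simp add: \<psi>_def)
    qed (use h \<psi>pos[OF s(1)] fpos[of s] in \<open>auto simp: C'_def\<close>)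
    also have "\<dots> = (C' * exp (- \<sigma> * s)) * exp (- (\<gamma> + \<sigma>) * s)"
      by (simp add: mult.assoc algebra_simps flip: exp_add)
    also have "\<dots> \<le> Q * exp (- (\<gamma> + \<sigma>) * s)"
      using T2(3)[OF s(1)] by (intro mult_right_mono) auto
    finally have hq: "K2 * (h * \<psi> s) \<le> K2 * (Q * exp (- (\<gamma> + \<sigma>) * s))"
      using K2 by (intro mult_left_mono) auto
    have "(L - h) * (a s - K2 * \<psi> s) > 0" using h(1) L s(2) by (intro mult_pos_pos) auto
    moreover have "K2 * \<psi>2 s = K2 * (\<kappa> * \<psi>1 s + L * \<psi> s - Q * exp (- (\<gamma> + \<sigma>) * s))"
    proof -
      have "\<psi>2 s = \<kappa> * \<psi>1 s + L * \<psi> s - Q * exp (- (\<gamma> + \<sigma>) * s)" using \<psi>eq[of s] by linarith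
      then show ?thesis by (simp only:)
    qed
    moreover have "a1 s = K2 * \<psi>1 s" using s(3) by simp
    ultimately have "\<kappa> * a1 s + L * a s - h * a s - K2 * \<psi>2 s > 0"
      using hq by (simp add: algebra_simps)
    then show "(\<alpha> - \<gamma>) * a1 s + \<alpha> * \<gamma> * a s - f s - K2 * \<psi>2 s > 0"
      by (simp add: L_def \<kappa>_def h(3))
  qed (use t in auto)
  have "a t \<le> K2 * exp (- \<gamma> * t)" if "t \<ge> T2" for t
  proof -
    have "K2 * \<psi> t \<le> K2 * exp (- \<gamma> * t)" using K2 by (intro mult_left_mono) (auto simp: \<psi>_def)
    then show ?thesis using step2[OF that] by simp
  qed
  then show ?thesis using K2 by blast
qed

end

section \<open>The Emden system\<close>

definition nl :: "real \<Rightarrow> real \<Rightarrow> real \<Rightarrow> real \<Rightarrow> real \<Rightarrow> real" where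
  "nl \<mu> \<beta> q x y = \<mu> * x powr (2 * q + 1) + \<beta> * x powr q * y powr (q + 1)"

lemma nl_pos: "\<mu> > 0 \<Longrightarrow> \<beta> > 0 \<Longrightarrow> x > 0 \<Longrightarrow> y > 0 \<Longrightarrow> nl \<mu> \<beta> q x y > 0"
  unfolding nl_def by (intro add_pos_pos mult_pos_pos) auto

lemma nl_mono:
  assumes "\<mu> > 0" "\<beta> > 0" "q > 0" "0 \<le> x" "x \<le> x'" "0 \<le> y" "y \<le> y'"
  shows "nl \<mu> \<beta> q x y \<le> nl \<mu> \<beta> q x' y'"
  unfolding nl_def using assms by (intro add_mono mult_mono mult_left_mono powr_mono2) auto

text \<open>Homogeneity of degree \<open>p = 2 * q + 1\<close> serves twice: for comparing Kelvin
  transforms and for making the Emden system autonomous.\<close>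

lemma nl_scale:
  assumes "k > 0" "x > 0" "y > 0"
  shows "nl \<mu> \<beta> q (k * x) (k * y) = k powr (2 * q + 1) * nl \<mu> \<beta> q x y"
proof -
  have "k powr q * k powr (q + 1) = k powr (2 * q + 1)" by (simp flip: powr_add)
  then show ?thesis
    unfolding nl_def using assms by (simp add: powr_mult distrib_left mult_ac)
qed

text \<open>The threshold solves \<open>\<beta> * x powr q * c powr (q + 1) = L * x\<close>; below
  it the coupling alone exceeds the linear term because \<open>q < 1\<close>.\<close>

lemma nl_small_dominates_linear:
  assumes "\<beta> > 0" "\<mu> > 0" "q < 1" "q > 0" "c > 0" "L > 0"
  shows "\<exists>e>0. \<forall>x y. 0 < x \<longrightarrow> x < e \<longrightarrow> c \<le> y \<longrightarrow> L * x < nl \<mu> \<beta> q x y"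
proof (intro exI[of _ "(\<beta> * c powr (q + 1) / L) powr (1 / (1 - q))"] conjI allI impI)
  show "0 < (\<beta> * c powr (q + 1) / L) powr (1 / (1 - q))" using assms by simp
  fix x y :: real assume x: "0 < x" "x < (\<beta> * c powr (q + 1) / L) powr (1 / (1 - q))" and y: "c \<le> y"
  have "x powr (1 - q) < ((\<beta> * c powr (q + 1) / L) powr (1 / (1 - q))) powr (1 - q)"
    using x assms by (intro powr_less_mono2) auto
  also have "\<dots> = \<beta> * c powr (q + 1) / L" using assms by (simp add: powr_powr)
  finally have "L * x powr (1 - q) < \<beta> * c powr (q + 1)" using assms by (simp add: field_simps)
  then have "x powr q * (L * x powr (1 - q)) < x powr q * (\<beta> * c powr (q + 1))"
    using x by (intro mult_strict_left_mono) auto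
  moreover have "x powr q * (L * x powr (1 - q)) = L * x"
    using x by (simp add: mult.left_commute flip: powr_add)
  moreover have "x powr q * (\<beta> * c powr (q + 1)) \<le> \<beta> * x powr q * y powr (q + 1)"
  proof -
    have "c powr (q + 1) \<le> y powr (q + 1)" using assms y by (intro powr_mono2) auto
    then have "\<beta> * x powr q * c powr (q + 1) \<le> \<beta> * x powr q * y powr (q + 1)"
      using assms by (intro mult_left_mono) auto
    then show ?thesis by (simp add: mult_ac)
  qed
  moreover have "\<mu> * x powr (2 * q + 1) \<ge> 0" using assms by simp
  ultimately show "L * x < nl \<mu> \<beta> q x y" unfolding nl_def by linarith
qed

text \<open>For \<open>q > 1\<close> and bounded \<open>y\<close> the quotient of the nonlinearity
  by \<open>x\<close> tends to 0 with \<open>x\<close>.\<close>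

lemma nl_small_below_linear:
  assumes "\<beta> > 0" "\<mu> > 0" "q > 1" "M > 0" "L > 0"
  shows "\<exists>e>0. \<forall>x y. 0 < x \<longrightarrow> x < e \<longrightarrow> 0 < y \<longrightarrow> y \<le> M \<longrightarrow> nl \<mu> \<beta> q x y \<le> L * x"
proof -
  have "((\<lambda>x. \<mu> * x powr (2 * q) + \<beta> * x powr (q - 1) * M powr (q + 1)) \<longlongrightarrow> \<mu> * 0 + \<beta> * 0 * M powr (q + 1)) (at_right 0)"
    by (intro tendsto_intros tendsto_zero_powrI[where b="2 * q"] tendsto_zero_powrI[where b="q - 1"] eventually_at_right_less[THEN eventually_mono])
       (use assms in auto)
  then have "\<forall>\<^sub>F x in at_right 0. \<mu> * x powr (2 * q) + \<beta> * x powr (q - 1) * M powr (q + 1) < L"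
    using assms by (intro order_tendstoD(2)) auto
  then obtain e where e: "e > 0" "\<And>x. 0 < x \<Longrightarrow> x < e \<Longrightarrow> \<mu> * x powr (2 * q) + \<beta> * x powr (q - 1) * M powr (q + 1) < L"
    unfolding eventually_at_right_field by auto
  have "nl \<mu> \<beta> q x y \<le> L * x" if "0 < x" "x < e" "0 < y" "y \<le> M" for x y
  proof -
    have "nl \<mu> \<beta> q x y \<le> nl \<mu> \<beta> q x M" using that assms by (intro nl_mono) auto
    also have "\<dots> = (\<mu> * x powr (2 * q) + \<beta> * x powr (q - 1) * M powr (q + 1)) * x"
      using that(1) unfolding nl_def by (simp add: powr_add powr_diff field_simps)
    also have "\<dots> \<le> L * x" using e(2)[OF that(1,2)] that(1) by (intro mult_right_mono) auto
    finally show ?thesis .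
  qed
  then show ?thesis using e(1) by blast
qed

section \<open>Energy and limits of Emden trajectories\<close>

locale emden_system =
  fixes a a1 b b1 :: "real \<Rightarrow> real" and \<mu>1 \<mu>2 \<beta> q \<alpha> \<gamma> :: real
  assumes par: "\<mu>1 > 0" "\<mu>2 > 0" "\<beta> > 0" "q > 0"
    and ag: "0 < \<gamma>" "\<gamma> < \<alpha>"
    and apos: "a t > 0" and bpos: "b t > 0"
    and da: "(a has_real_derivative a1 t) (at t)"
    and da1: "(a1 has_real_derivative (\<alpha> - \<gamma>) * a1 t + \<alpha> * \<gamma> * a t - nl \<mu>1 \<beta> q (a t) (b t)) (at t)"
    and db: "(b has_real_derivative b1 t) (at t)"
    and db1: "(b1 has_real_derivative (\<alpha> - \<gamma>) * b1 t + \<alpha> * \<gamma> * b t - nl \<mu>2 \<beta> q (b t) (a t)) (at t)"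
begin

lemma swapped: "emden_system b b1 a a1 \<mu>2 \<mu>1 \<beta> q \<alpha> \<gamma>"
  by unfold_locales (use par ag apos bpos da da1 db db1 in auto)

sublocale A: damped_eq a a1 "\<lambda>t. nl \<mu>1 \<beta> q (a t) (b t)" \<alpha> \<gamma>
  by unfold_locales (use par ag apos bpos da da1 nl_pos in auto)

sublocale B: damped_eq b b1 "\<lambda>t. nl \<mu>2 \<beta> q (b t) (a t)" \<alpha> \<gamma>
  by unfold_locales (use par ag apos bpos db db1 nl_pos in auto)

lemma bounded_a: "\<exists>M>0. \<forall>t. a t \<le> M"
proof (rule A.bounded_above)
  show "\<mu>1 * a t powr (2 * q + 1) \<le> nl \<mu>1 \<beta> q (a t) (b t)" for t
    unfolding nl_def using par by simp
qed (use par in auto)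

lemma bounded_b: "\<exists>M>0. \<forall>t. b t \<le> M"
  using emden_system.bounded_a[OF swapped] .

text \<open>Differentiating a power produces \<open>a powr (q - 1)\<close>, unbounded near 0 if
  \<open>q < 1\<close>. Logarithmic derivatives avoid this: \<open>a1 / a\<close> and
  \<open>b1 / b\<close> are bounded by \<alpha>, and both monomials have total degree
  \<open>2 * q + 1\<close>.\<close>

lemma nl_deriv:
  "\<exists>d. ((\<lambda>t. nl \<mu>1 \<beta> q (a t) (b t)) has_real_derivative d) (at t) \<and> \<bar>d\<bar> \<le> (2 * q + 1) * \<alpha> * nl \<mu>1 \<beta> q (a t) (b t)"
proof -
  define ra where "ra = a1 t / a t"
  define rb where "rb = b1 t / b t"
  have r: "\<bar>ra\<bar> \<le> \<alpha>" "\<bar>rb\<bar> \<le> \<alpha>"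
    using A.abs_a1_le[of t] B.abs_a1_le[of t] apos[of t] bpos[of t] by (simp_all add: ra_def rb_def field_simps)
  have pa: "((\<lambda>t. a t powr r) has_real_derivative a t powr r * (r * ra)) (at t)" for r
    using DERIV_fun_powr[OF da[of t] apos[of t], of r] apos[of t] by (simp add: ra_def powr_diff field_simps)
  have pb: "((\<lambda>t. b t powr r) has_real_derivative b t powr r * (r * rb)) (at t)" for r
    using DERIV_fun_powr[OF db[of t] bpos[of t], of r] bpos[of t] by (simp add: rb_def powr_diff field_simps)
  define P where "P = \<mu>1 * a t powr (2 * q + 1)"
  define Q where "Q = \<beta> * a t powr q * b t powr (q + 1)"
  have PQ: "P > 0" "Q > 0" using par apos[of t] bpos[of t] by (simp_all add: P_def Q_def)
  have D: "((\<lambda>t. nl \<mu>1 \<beta> q (a t) (b t)) has_real_derivative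
      P * ((2 * q + 1) * ra) + Q * (q * ra + (q + 1) * rb)) (at t)"
    unfolding nl_def
    by (rule DERIV_cong[OF DERIV_add[OF DERIV_cmult[OF pa] DERIV_mult[OF DERIV_cmult[OF pa] pb]]])
       (simp add: P_def Q_def algebra_simps)
  have 1: "\<bar>(2 * q + 1) * ra\<bar> \<le> (2 * q + 1) * \<alpha>"
    using par r by (simp add: abs_mult)
  have "\<bar>q * ra + (q + 1) * rb\<bar> \<le> \<bar>q * ra\<bar> + \<bar>(q + 1) * rb\<bar>" by (rule abs_triangle_ineq)
  also have "\<dots> \<le> q * \<alpha> + (q + 1) * \<alpha>"
    using par r by (intro add_mono) (simp_all add: abs_mult)
  finally have 2: "\<bar>q * ra + (q + 1) * rb\<bar> \<le> (2 * q + 1) * \<alpha>" by (simp add: algebra_simps)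
  have "\<bar>P * ((2 * q + 1) * ra) + Q * (q * ra + (q + 1) * rb)\<bar> \<le> \<bar>P * ((2 * q + 1) * ra)\<bar> + \<bar>Q * (q * ra + (q + 1) * rb)\<bar>"
    by (rule abs_triangle_ineq)
  also have "\<dots> \<le> P * ((2 * q + 1) * \<alpha>) + Q * ((2 * q + 1) * \<alpha>)"
    using PQ by (intro add_mono; subst abs_mult) (simp_all add: 1 2 del: abs_mult)
  also have "\<dots> = (2 * q + 1) * \<alpha> * nl \<mu>1 \<beta> q (a t) (b t)"
    by (simp add: nl_def P_def Q_def algebra_simps)
  finally show ?thesis using D by blast
qed

text \<open>Barbalat's lemma once more, applied to \<open>a1\<close> itself: its second derivative
  is bounded thanks to \<open>nl_deriv\<close>, so the second derivative of \<open>a\<close>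
  vanishes in the limit and the equation leaves the residual of the equilibrium condition.\<close>

lemma a1_tendsto_0_imp:
  assumes "(a1 \<longlongrightarrow> 0) at_top"
  shows "((\<lambda>t. \<alpha> * \<gamma> * a t - nl \<mu>1 \<beta> q (a t) (b t)) \<longlongrightarrow> 0) at_top"
proof -
  obtain Ma Mb where M: "\<And>t. a t \<le> Ma" "\<And>t. b t \<le> Mb"
    using bounded_a bounded_b by blast
  obtain fd where fd: "\<And>t. ((\<lambda>t. nl \<mu>1 \<beta> q (a t) (b t)) has_real_derivative fd t) (at t)"
    "\<And>t. \<bar>fd t\<bar> \<le> (2 * q + 1) * \<alpha> * nl \<mu>1 \<beta> q (a t) (b t)"
    using nl_deriv by metis
  define N where "N = nl \<mu>1 \<beta> q Ma Mb"
  have N: "nl \<mu>1 \<beta> q (a t) (b t) \<le> N" for t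
    unfolding N_def using par apos[of t] bpos[of t] M by (intro nl_mono) auto
  define a2 where "a2 t = (\<alpha> - \<gamma>) * a1 t + \<alpha> * \<gamma> * a t - nl \<mu>1 \<beta> q (a t) (b t)" for t
  have a1b: "\<bar>a1 t\<bar> \<le> \<alpha> * Ma" for t
  proof -
    have "\<alpha> * a t \<le> \<alpha> * Ma" using ag M by (intro mult_left_mono) auto
    then show ?thesis using A.abs_a1_le[of t] by linarith
  qed
  have a2b: "\<bar>a2 t\<bar> \<le> (\<alpha> - \<gamma>) * (\<alpha> * Ma) + \<alpha> * \<gamma> * Ma + N" for t
  proof -
    have "\<bar>(\<alpha> - \<gamma>) * a1 t\<bar> \<le> (\<alpha> - \<gamma>) * (\<alpha> * Ma)"
      unfolding abs_mult using ag a1b[of t] by (intro mult_mono) auto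
    moreover have "\<alpha> * \<gamma> * a t \<le> \<alpha> * \<gamma> * Ma" "\<alpha> * \<gamma> * a t \<ge> 0"
      using ag M(1)[of t] apos[of t] by (auto intro!: mult_left_mono)
    moreover have "nl \<mu>1 \<beta> q (a t) (b t) > 0" by (rule A.fpos)
    ultimately show ?thesis using N[of t] unfolding a2_def by linarith
  qed
  have "(a2 \<longlongrightarrow> 0) at_top"
  proof (rule derivative_tendsto_0[OF _ _ _ assms])
    show "(a1 has_real_derivative a2 t) (at t)" for t unfolding a2_def by (rule da1)
    show "(a2 has_real_derivative (\<alpha> - \<gamma>) * a2 t + \<alpha> * \<gamma> * a1 t - fd t) (at t)" for t
      using DERIV_diff[OF DERIV_add[OF DERIV_cmult[OF da1, of "\<alpha> - \<gamma>"] DERIV_cmult[OF da, of "\<alpha> * \<gamma>"]] fd(1)]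
      unfolding a2_def .
    show "\<bar>(\<alpha> - \<gamma>) * a2 t + \<alpha> * \<gamma> * a1 t - fd t\<bar> \<le>
      (\<alpha> - \<gamma>) * ((\<alpha> - \<gamma>) * (\<alpha> * Ma) + \<alpha> * \<gamma> * Ma + N) + \<alpha> * \<gamma> * (\<alpha> * Ma) + (2 * q + 1) * \<alpha> * N" for t
    proof -
      have "\<bar>(\<alpha> - \<gamma>) * a2 t\<bar> \<le> (\<alpha> - \<gamma>) * ((\<alpha> - \<gamma>) * (\<alpha> * Ma) + \<alpha> * \<gamma> * Ma + N)"
        unfolding abs_mult using ag a2b[of t] by (intro mult_mono) auto
      moreover have "\<bar>\<alpha> * \<gamma> * a1 t\<bar> \<le> \<alpha> * \<gamma> * (\<alpha> * Ma)"
        unfolding abs_mult[of _ "a1 t"] using ag a1b[of t] by (intro mult_mono) auto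
      moreover have "\<bar>fd t\<bar> \<le> (2 * q + 1) * \<alpha> * N"
      proof -
        have "(2 * q + 1) * \<alpha> * nl \<mu>1 \<beta> q (a t) (b t) \<le> (2 * q + 1) * \<alpha> * N"
          using ag par N[of t] by (intro mult_left_mono) auto
        then show ?thesis using fd(2)[of t] by linarith
      qed
      ultimately show ?thesis by linarith
    qed
  qed
  then have "((\<lambda>t. a2 t - (\<alpha> - \<gamma>) * a1 t) \<longlongrightarrow> 0 - (\<alpha> - \<gamma>) * 0) at_top"
    by (intro tendsto_intros assms)
  then show ?thesis by (simp add: a2_def)
qed

text \<open>The energy \<open>E\<close> grows at rate
  \<open>(\<alpha> - \<gamma>) * (a1\<^sup>2 + b1\<^sup>2)\<close> and is bounded, so it converges
  and this rate tends to 0. The equilibria need not be classified: an algebraic identity recovers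
  the sum of squares from the energy and vanishing quantities, even though \<open>a\<close> and
  \<open>b\<close> are not yet known to converge.\<close>

lemma energy_limits:
  "(a1 \<longlongrightarrow> 0) at_top \<and> (b1 \<longlongrightarrow> 0) at_top \<and> (\<exists>S. ((\<lambda>t. (a t)\<^sup>2 + (b t)\<^sup>2) \<longlongrightarrow> S) at_top)"
proof -
  obtain Ma Mb where M: "\<And>t. a t \<le> Ma" "\<And>t. b t \<le> Mb" "Ma > 0" "Mb > 0"
    using bounded_a bounded_b by blast
  define fa where "fa t = nl \<mu>1 \<beta> q (a t) (b t)" for t
  define fb where "fb t = nl \<mu>2 \<beta> q (b t) (a t)" for t
  \<comment> \<open>By Euler's identity \<open>G / (2 * q + 2)\<close> is a potential for the pair
    \<open>fa\<close>, \<open>fb\<close>; the two coupling terms fit together because they share the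
    coefficient \<beta>.\<close>
  define G where "G t = a t * fa t + b t * fb t" for t
  define L where "L = \<alpha> * \<gamma>"
  have L: "L > 0" using ag by (simp add: L_def)
  define a2 where "a2 t = (\<alpha> - \<gamma>) * a1 t + L * a t - fa t" for t
  define b2 where "b2 t = (\<alpha> - \<gamma>) * b1 t + L * b t - fb t" for t
  have Geq: "G t = \<mu>1 * a t powr (2 * q + 2) + \<mu>2 * b t powr (2 * q + 2) + 2 * \<beta> * (a t powr (q + 1) * b t powr (q + 1))" for t
  proof -
    have p: "x * x powr (2 * q + 1) = x powr (2 * q + 2)" "x * x powr q = x powr (q + 1)" if "x > 0" for x :: real
      using that powr_mult_base[of x "2 * q + 1"] powr_mult_base[of x q] by (simp_all add: add_ac)
    have "G t = \<mu>1 * (a t * a t powr (2 * q + 1)) + \<mu>2 * (b t * b t powr (2 * q + 1))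
       + \<beta> * ((a t * a t powr q) * b t powr (q + 1)) + \<beta> * ((b t * b t powr q) * a t powr (q + 1))"
      unfolding G_def fa_def fb_def nl_def by (simp add: algebra_simps)
    then show ?thesis unfolding p[OF apos] p[OF bpos] by (simp add: algebra_simps)
  qed
  have dG: "(G has_real_derivative (2 * q + 2) * (fa t * a1 t + fb t * b1 t)) (at t)" for t
  proof -
    have pa: "((\<lambda>t. a t powr (r + 1)) has_real_derivative (r + 1) * a t powr r * a1 t) (at t)" for r
      using DERIV_fun_powr[OF da[of t] apos[of t], of "r + 1"] by simp
    have pb: "((\<lambda>t. b t powr (r + 1)) has_real_derivative (r + 1) * b t powr r * b1 t) (at t)" for r
      using DERIV_fun_powr[OF db[of t] bpos[of t], of "r + 1"] by simp
    have e: "2 * q + 2 = (2 * q + 1) + 1" by simp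
    show ?thesis
      unfolding Geq[abs_def] e
      by (rule DERIV_cong[OF DERIV_add[OF DERIV_add[OF DERIV_cmult[OF pa] DERIV_cmult[OF pb]] DERIV_cmult[OF DERIV_mult[OF pa pb]]]])
         (simp add: fa_def fb_def nl_def algebra_simps)
  qed
  define E where "E t = ((a1 t)\<^sup>2 + (b1 t)\<^sup>2) / 2 - L / 2 * ((a t)\<^sup>2 + (b t)\<^sup>2) + G t / (2 * q + 2)" for t
  define E1 where "E1 t = (\<alpha> - \<gamma>) * ((a1 t)\<^sup>2 + (b1 t)\<^sup>2)" for t
  define E2 where "E2 t = (\<alpha> - \<gamma>) * (2 * a1 t * a2 t + 2 * b1 t * b2 t)" for t
  have da2: "(a1 has_real_derivative a2 t) (at t)" and db2: "(b1 has_real_derivative b2 t) (at t)" for t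
    using da1 db1 by (simp_all add: a2_def b2_def fa_def fb_def L_def)
  have dE: "(E has_real_derivative E1 t) (at t)" for t
  proof -
    have G': "((\<lambda>t. G t / (2 * q + 2)) has_real_derivative fa t * a1 t + fb t * b1 t) (at t)"
      using DERIV_cdivide[OF dG[of t], of "2 * q + 2"] par by simp
    have "(E has_real_derivative (2 * a1 t * a2 t + 2 * b1 t * b2 t) / 2 - L / 2 * (2 * a t * a1 t + 2 * b t * b1 t) + (fa t * a1 t + fb t * b1 t)) (at t)"
      unfolding E_def[abs_def]
      by (intro DERIV_add DERIV_diff DERIV_cdivide DERIV_cmult G') (auto intro!: derivative_eq_intros da2 db2 da db)
    then show ?thesis
      by (rule DERIV_cong) (simp add: E1_def a2_def b2_def field_simps power2_eq_square)
  qed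
  have dE1: "(E1 has_real_derivative E2 t) (at t)" for t
    unfolding E1_def[abs_def] E2_def by (auto intro!: derivative_eq_intros da2 db2)
  define N where "N = nl \<mu>1 \<beta> q Ma Mb + nl \<mu>2 \<beta> q Mb Ma"
  have fab: "0 < fa t" "fa t \<le> N" "0 < fb t" "fb t \<le> N" for t
  proof -
    have "fa t \<le> nl \<mu>1 \<beta> q Ma Mb" "fb t \<le> nl \<mu>2 \<beta> q Mb Ma"
      unfolding fa_def fb_def using par apos[of t] bpos[of t] M(1,2)[of t] by (auto intro!: nl_mono)
    moreover have "nl \<mu>1 \<beta> q Ma Mb > 0" "nl \<mu>2 \<beta> q Mb Ma > 0"
      using par M by (auto intro!: nl_pos)
    ultimately show "fa t \<le> N" "fb t \<le> N" unfolding N_def by auto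
    show "0 < fa t" "0 < fb t" unfolding fa_def fb_def by (rule A.fpos B.fpos)+
  qed
  define M where "M = Ma + Mb"
  have "M > 0" using M(3,4) by (simp add: M_def)
  have M': "0 < a t" "a t \<le> M" "0 < b t" "b t \<le> M" for t
    using M(1,2)[of t] M(3,4) apos[of t] bpos[of t] by (auto simp: M_def)
  have a1b: "\<bar>a1 t\<bar> \<le> \<alpha> * M" "\<bar>b1 t\<bar> \<le> \<alpha> * M" for t
  proof -
    have "\<alpha> * a t \<le> \<alpha> * M" "\<alpha> * b t \<le> \<alpha> * M" using ag M' by (auto intro!: mult_left_mono)
    then show "\<bar>a1 t\<bar> \<le> \<alpha> * M" "\<bar>b1 t\<bar> \<le> \<alpha> * M" using A.abs_a1_le[of t] B.abs_a1_le[of t] by linarith+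
  qed
  define R where "R = (\<alpha> - \<gamma>) * (\<alpha> * M) + L * M + N"
  have a2b: "\<bar>a2 t\<bar> \<le> R" "\<bar>b2 t\<bar> \<le> R" for t
  proof -
    have "\<bar>(\<alpha> - \<gamma>) * a1 t\<bar> \<le> (\<alpha> - \<gamma>) * (\<alpha> * M)" "\<bar>(\<alpha> - \<gamma>) * b1 t\<bar> \<le> (\<alpha> - \<gamma>) * (\<alpha> * M)"
      unfolding abs_mult using ag a1b[of t] by (auto intro!: mult_mono)
    moreover have "0 < L * a t" "L * a t \<le> L * M" "0 < L * b t" "L * b t \<le> L * M"
      using L M'[of t] by (auto intro!: mult_left_mono)
    ultimately show "\<bar>a2 t\<bar> \<le> R" "\<bar>b2 t\<bar> \<le> R"
      using fab[of t] unfolding a2_def b2_def R_def by linarith+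
  qed
  have sqb: "(a1 t)\<^sup>2 \<le> (\<alpha> * M)\<^sup>2" "(b1 t)\<^sup>2 \<le> (\<alpha> * M)\<^sup>2" for t
    using a1b[of t] by (metis abs_ge_zero power2_abs power_mono)+
  have "E t \<le> (\<alpha> * M)\<^sup>2 + 2 * (M * N)" for t
  proof -
    have "a t * fa t \<le> M * N" "b t * fb t \<le> M * N" "0 < a t * fa t" "0 < b t * fb t"
      using M'[of t] fab[of t] \<open>M > 0\<close> by (auto intro!: mult_mono)
    then have g: "G t \<le> 2 * (M * N)" "0 \<le> G t" unfolding G_def by linarith+
    have "G t / (2 * q + 2) \<le> G t / 1" using g par by (intro divide_left_mono) auto
    then have "G t / (2 * q + 2) \<le> G t" by simp
    moreover have "E t \<le> ((a1 t)\<^sup>2 + (b1 t)\<^sup>2) / 2 + G t / (2 * q + 2)"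
    proof -
      have "0 \<le> L / 2 * ((a t)\<^sup>2 + (b t)\<^sup>2)" using L by simp
      then show ?thesis unfolding E_def by (simp only: add_le_cancel_right)
    qed
    ultimately show ?thesis using g sqb[of t] by argo
  qed
  moreover have "E s \<le> E t" if "s \<le> t" for s t
    by (rule DERIV_nonneg_imp_nondecreasing[OF that]) (use dE ag in \<open>auto simp: E1_def intro!: exI\<close>)
  ultimately obtain l where l: "(E \<longlongrightarrow> l) at_top" using increasing_bounded_convergent[of E] by blast
  have E2b: "\<bar>E2 t\<bar> \<le> (\<alpha> - \<gamma>) * (2 * (\<alpha> * M) * R + 2 * (\<alpha> * M) * R)" for t
  proof -
    have "\<bar>a1 t * a2 t\<bar> \<le> (\<alpha> * M) * R" "\<bar>b1 t * b2 t\<bar> \<le> (\<alpha> * M) * R"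
      unfolding abs_mult using a1b[of t] a2b[of t] by (auto intro!: mult_mono order_trans[OF abs_ge_zero a1b(1)])
    then have "\<bar>2 * a1 t * a2 t + 2 * b1 t * b2 t\<bar> \<le> 2 * (\<alpha> * M) * R + 2 * (\<alpha> * M) * R" by linarith
    then show ?thesis unfolding E2_def abs_mult using ag by (intro mult_mono) auto
  qed
  have E1lim: "(E1 \<longlongrightarrow> 0) at_top" by (rule derivative_tendsto_0[OF dE dE1 E2b l])
  have sq: "((\<lambda>t. (a1 t)\<^sup>2 + (b1 t)\<^sup>2) \<longlongrightarrow> 0) at_top"
    using tendsto_divide[OF E1lim tendsto_const[of "\<alpha> - \<gamma>"]] ag by (simp add: E1_def)
  have "((\<lambda>t. sqrt ((a1 t)\<^sup>2 + (b1 t)\<^sup>2)) \<longlongrightarrow> sqrt 0) at_top" by (intro tendsto_intros sq)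
  then have sqrt0: "((\<lambda>t. sqrt ((a1 t)\<^sup>2 + (b1 t)\<^sup>2)) \<longlongrightarrow> 0) at_top" by simp
  have la: "(a1 \<longlongrightarrow> 0) at_top"
    by (rule Lim_null_comparison[OF _ sqrt0]) (auto intro!: always_eventually real_sqrt_sum_squares_ge1 simp: real_le_rsqrt)
  have lb: "(b1 \<longlongrightarrow> 0) at_top"
    by (rule Lim_null_comparison[OF _ sqrt0]) (auto intro!: always_eventually simp: real_le_rsqrt)
  have ra: "((\<lambda>t. L * a t - fa t) \<longlongrightarrow> 0) at_top"
    using a1_tendsto_0_imp[OF la] by (simp add: L_def fa_def)
  have rb: "((\<lambda>t. L * b t - fb t) \<longlongrightarrow> 0) at_top"
    using emden_system.a1_tendsto_0_imp[OF swapped lb] by (simp add: L_def fb_def)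
  have ara: "((\<lambda>t. a t * (L * a t - fa t)) \<longlongrightarrow> 0) at_top"
  proof (rule Lim_null_comparison)
    show "((\<lambda>t. M * \<bar>L * a t - fa t\<bar>) \<longlongrightarrow> 0) at_top"
      using tendsto_mult[OF tendsto_const[of M] tendsto_rabs[OF ra]] by simp
    show "\<forall>\<^sub>F t in at_top. norm (a t * (L * a t - fa t)) \<le> M * \<bar>L * a t - fa t\<bar>"
      by (intro always_eventually allI) (simp add: abs_mult abs_of_pos[OF M'(1)] mult_right_mono M')
  qed
  have brb: "((\<lambda>t. b t * (L * b t - fb t)) \<longlongrightarrow> 0) at_top"
  proof (rule Lim_null_comparison)
    show "((\<lambda>t. M * \<bar>L * b t - fb t\<bar>) \<longlongrightarrow> 0) at_top"
      using tendsto_mult[OF tendsto_const[of M] tendsto_rabs[OF rb]] by simp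
    show "\<forall>\<^sub>F t in at_top. norm (b t * (L * b t - fb t)) \<le> M * \<bar>L * b t - fb t\<bar>"
      by (intro always_eventually allI) (simp add: abs_mult abs_of_pos[OF M'(3)] mult_right_mono M')
  qed
  \<comment> \<open>Eliminates \<open>G\<close> between the energy and the equations tested with
    \<open>a\<close> and \<open>b\<close>. The potential carries the factor
    \<open>1 / (2 * q + 2)\<close> in one and 1 in the other, so \<open>q * L\<close> times the sum
    of squares is left over.\<close>
  have Seq: "(a t)\<^sup>2 + (b t)\<^sup>2 = ((q + 1) * ((a1 t)\<^sup>2 + (b1 t)\<^sup>2) - a t * (L * a t - fa t) - b t * (L * b t - fb t) - (2 * q + 2) * E t) / (q * L)" for t
  proof -
    have "(2 * q + 2) * E t = (q + 1) * ((a1 t)\<^sup>2 + (b1 t)\<^sup>2) - (q + 1) * L * ((a t)\<^sup>2 + (b t)\<^sup>2) + G t"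
      unfolding E_def using par by (simp add: field_simps)
    moreover have "a t * (L * a t - fa t) + b t * (L * b t - fb t) = L * ((a t)\<^sup>2 + (b t)\<^sup>2) - G t"
      unfolding G_def by (simp add: algebra_simps power2_eq_square)
    ultimately have "(q + 1) * ((a1 t)\<^sup>2 + (b1 t)\<^sup>2) - a t * (L * a t - fa t) - b t * (L * b t - fb t) - (2 * q + 2) * E t = ((a t)\<^sup>2 + (b t)\<^sup>2) * (q * L)"
      by (simp add: algebra_simps)
    then show ?thesis using par L by simp
  qed
  have "((\<lambda>t. (a t)\<^sup>2 + (b t)\<^sup>2) \<longlongrightarrow> ((q + 1) * 0 - 0 - 0 - (2 * q + 2) * l) / (q * L)) at_top"
    unfolding Seq by (intro tendsto_intros sq ara brb l) (use par L in auto)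
  then show ?thesis using la lb by blast
qed

section \<open>Fast and slow decay and their possible combinations\<close>

text \<open>For \<alpha> equal to \<open>1 / q\<close> and \<gamma> equal to
  \<open>n - 2 - 1 / q\<close> this is the bound by a multiple of
  \<open>norm x powr - (n - 2)\<close> for the original function; \<open>slow\<close> is the lower
  bound by a multiple of \<open>norm x powr - (1 / q)\<close>, and
  \<open>1 / q = 2 / (p - 1)\<close>.\<close>

definition fast :: "(real \<Rightarrow> real) \<Rightarrow> bool" where
  "fast h \<longleftrightarrow> (\<exists>K>0. \<exists>T. \<forall>t\<ge>T. h t \<le> K * exp (- \<gamma> * t))"

definition slow :: "(real \<Rightarrow> real) \<Rightarrow> bool" where
  "slow h \<longleftrightarrow> (\<exists>c>0. \<exists>T. \<forall>t\<ge>T. c \<le> h t)"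

text \<open>A single component may see a coupling of lower order than itself when
  \<open>q < 1\<close>. The sum \<open>a + b\<close> satisfies an equation of the same type, and its
  nonlinearity is bounded by a multiple of the power \<open>2 * q + 1\<close> of the sum.\<close>

lemma fast_if_both_tendsto_0:
  assumes "((\<lambda>t. (a t)\<^sup>2 + (b t)\<^sup>2) \<longlongrightarrow> 0) at_top"
  shows "fast a \<and> fast b"
proof -
  interpret s: damped_eq "\<lambda>t. a t + b t" "\<lambda>t. a1 t + b1 t" "\<lambda>t. nl \<mu>1 \<beta> q (a t) (b t) + nl \<mu>2 \<beta> q (b t) (a t)" \<alpha> \<gamma>
  proof
    show "((\<lambda>t. a1 t + b1 t) has_real_derivative (\<alpha> - \<gamma>) * (a1 t + b1 t) + \<alpha> * \<gamma> * (a t + b t) -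
         (nl \<mu>1 \<beta> q (a t) (b t) + nl \<mu>2 \<beta> q (b t) (a t))) (at t)" for t
      by (rule DERIV_cong[OF DERIV_add[OF da1 db1]]) (simp add: algebra_simps)
  qed (use ag apos bpos A.fpos B.fpos in \<open>auto intro!: add_pos_pos DERIV_add da db\<close>)
  have "((\<lambda>t. sqrt ((a t)\<^sup>2 + (b t)\<^sup>2)) \<longlongrightarrow> sqrt 0) at_top" by (intro tendsto_intros assms)
  then have sqrt0: "((\<lambda>t. sqrt ((a t)\<^sup>2 + (b t)\<^sup>2)) \<longlongrightarrow> 0) at_top" by simp
  have la: "(a \<longlongrightarrow> 0) at_top"
    by (rule Lim_null_comparison[OF _ sqrt0]) (auto intro!: always_eventually real_sqrt_sum_squares_ge1 simp: real_le_rsqrt)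
  have lb: "(b \<longlongrightarrow> 0) at_top"
    by (rule Lim_null_comparison[OF _ sqrt0]) (auto intro!: always_eventually simp: real_le_rsqrt)
  have "\<exists>K>0. \<exists>T. \<forall>t\<ge>T. a t + b t \<le> K * exp (- \<gamma> * t)"
  proof (rule s.fast_decay[where C="\<mu>1 + \<mu>2 + 2 * \<beta>" and \<epsilon>="2 * q"])
    show "((\<lambda>t. a t + b t) \<longlongrightarrow> 0) at_top" using tendsto_add[OF la lb] by simp
    fix t :: real
    have pw: "x powr q * x powr (q + 1) = x powr (1 + 2 * q)" for x :: real by (simp add: add_ac flip: powr_add)
    have "nl \<mu>1 \<beta> q (a t) (b t) \<le> nl \<mu>1 \<beta> q (a t + b t) (a t + b t)" "nl \<mu>2 \<beta> q (b t) (a t) \<le> nl \<mu>2 \<beta> q (a t + b t) (a t + b t)"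
      using par apos[of t] bpos[of t] by (auto intro!: nl_mono)
    moreover have "nl \<mu> \<beta> q x x = (\<mu> + \<beta>) * x powr (1 + 2 * q)" for \<mu> x
      unfolding nl_def mult.assoc pw by (simp add: algebra_simps)
    ultimately show "nl \<mu>1 \<beta> q (a t) (b t) + nl \<mu>2 \<beta> q (b t) (a t) \<le> (\<mu>1 + \<mu>2 + 2 * \<beta>) * (a t + b t) powr (1 + 2 * q)"
      by (simp add: algebra_simps)
  qed (use par in auto)
  then obtain K T where "K > 0" and K: "\<And>t. t \<ge> T \<Longrightarrow> a t + b t \<le> K * exp (- \<gamma> * t)" by blast
  have "a t \<le> K * exp (- \<gamma> * t)" "b t \<le> K * exp (- \<gamma> * t)" if "t \<ge> T" for t
    using K[OF that] apos[of t] bpos[of t] by linarith+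
  then show ?thesis unfolding fast_def using \<open>K > 0\<close> by blast
qed

text \<open>Here \<open>b\<close> is merely bounded, so the coupling is of order
  \<open>a powr q\<close>. As \<open>q > 1\<close>, this exceeds the linear order by
  \<open>q - 1\<close>, the exponent gain handed to \<open>fast_decay\<close>.\<close>

lemma fast_if_tendsto_0:
  assumes q: "q > 1" and lim: "(a \<longlongrightarrow> 0) at_top"
  shows "fast a"
proof -
  obtain M where M: "M > 0" "\<And>t. b t \<le> M" using bounded_b by blast
  have "\<forall>\<^sub>F t in at_top. a t < 1" by (rule order_tendstoD(2)[OF lim]) simp
  then obtain T where T: "\<And>t. t \<ge> T \<Longrightarrow> a t < 1" unfolding eventually_at_top_linorder by blast
  show ?thesis unfolding fast_def
  proof (rule A.fast_decay[OF lim, where ?T0.0=T and C="\<mu>1 + \<beta> * M powr (q + 1)" and \<epsilon>="q - 1"])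
    fix t assume t: "t \<ge> T"
    have "nl \<mu>1 \<beta> q (a t) (b t) \<le> nl \<mu>1 \<beta> q (a t) M"
      using par apos[of t] bpos[of t] M by (intro nl_mono) auto
    also have "\<dots> \<le> \<mu>1 * a t powr q + \<beta> * a t powr q * M powr (q + 1)"
      unfolding nl_def using par apos[of t] T[OF t] by (intro add_right_mono mult_left_mono powr_mono') auto
    finally show "nl \<mu>1 \<beta> q (a t) (b t) \<le> (\<mu>1 + \<beta> * M powr (q + 1)) * a t powr (1 + (q - 1))"
      by (simp add: algebra_simps)
  qed (use q in auto)
qed

text \<open>The sum of squares stays above \<open>S / 2\<close>, so whenever \<open>a\<close> is
  below \<open>sqrt S / 2\<close> the other component is above it. Then the coupling dominates the
  linear term, and \<open>bounded_below\<close> applies.\<close>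

lemma slow_if_sublinear:
  assumes q: "q < 1" and S: "((\<lambda>t. (a t)\<^sup>2 + (b t)\<^sup>2) \<longlongrightarrow> S) at_top" "S > 0"
  shows "slow a"
proof -
  obtain e where e: "e > 0" "\<And>x y. 0 < x \<Longrightarrow> x < e \<Longrightarrow> sqrt S / 2 \<le> y \<Longrightarrow> \<alpha> * \<gamma> * x < nl \<mu>1 \<beta> q x y"
    using nl_small_dominates_linear[of \<beta> \<mu>1 q "sqrt S / 2" "\<alpha> * \<gamma>"] par q S ag by auto
  have "\<forall>\<^sub>F t in at_top. S / 2 < (a t)\<^sup>2 + (b t)\<^sup>2" by (rule order_tendstoD(1)[OF S(1)]) (use S in simp)
  then obtain T where T: "\<And>t. t \<ge> T \<Longrightarrow> S / 2 < (a t)\<^sup>2 + (b t)\<^sup>2" unfolding eventually_at_top_linorder by blast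
  have "\<exists>e>0. \<forall>t\<ge>T. a t \<ge> e"
  proof (rule A.bounded_below[of "min e (sqrt S / 2)"])
    fix t assume t: "t \<ge> T" "a t < min e (sqrt S / 2)"
    have "(a t)\<^sup>2 < (sqrt S / 2)\<^sup>2" using t(2) apos[of t] by (intro power_strict_mono) auto
    then have "(sqrt S / 2)\<^sup>2 \<le> (b t)\<^sup>2" using T[OF t(1)] S(2) by (simp add: power_divide)
    then have "sqrt S / 2 \<le> b t" by (rule power2_le_imp_le) (use bpos[of t] in simp)
    then show "\<alpha> * \<gamma> * a t < nl \<mu>1 \<beta> q (a t) (b t)" using e(2)[of "a t" "b t"] apos[of t] t(2) by simp
  qed (use e S in auto)
  then show ?thesis unfolding slow_def by blast
qed

text \<open>For \<open>a < e\<close> the residual \<open>r\<close> is at least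
  \<open>L / 2 * a\<close>, and it tends to 0. Late values of \<open>a\<close> thus avoid the
  interval from \<open>e / 2\<close> to \<open>e\<close>, and by continuity \<open>a\<close> either
  stays above it or is trapped below and tends to 0.\<close>

lemma slow_or_fast_if_superlinear:
  assumes q: "q > 1" and S: "((\<lambda>t. (a t)\<^sup>2 + (b t)\<^sup>2) \<longlongrightarrow> S) at_top" "S > 0"
  shows "slow a \<or> (fast a \<and> slow b)"
proof -
  define L where "L = \<alpha> * \<gamma>"
  have L: "L > 0" using ag by (simp add: L_def)
  obtain M where M: "M > 0" "\<And>t. b t \<le> M" using bounded_b by blast
  obtain e where e: "e > 0" "\<And>x y. 0 < x \<Longrightarrow> x < e \<Longrightarrow> 0 < y \<Longrightarrow> y \<le> M \<Longrightarrow> nl \<mu>1 \<beta> q x y \<le> L / 2 * x"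
    using nl_small_below_linear[of \<beta> \<mu>1 q M "L / 2"] par q M L by auto
  define r where "r t = L * a t - nl \<mu>1 \<beta> q (a t) (b t)" for t
  have r: "(r \<longlongrightarrow> 0) at_top"
    using a1_tendsto_0_imp energy_limits unfolding r_def L_def by blast
  have ar: "a t \<le> 2 / L * r t" if "a t < e" for t
    using e(2)[OF apos that bpos M(2)] L unfolding r_def by (simp add: field_simps)
  have "\<forall>\<^sub>F t in at_top. r t < L * e / 4" by (rule order_tendstoD(2)[OF r]) (use L e in simp)
  then obtain T where T: "\<And>t. t \<ge> T \<Longrightarrow> r t < L * e / 4" unfolding eventually_at_top_linorder by blast
  have gap: "a t < e / 2" if "t \<ge> T" "a t < e" for t
  proof -
    have "2 / L * r t < 2 / L * (L * e / 4)" using T[OF that(1)] L by (intro mult_strict_left_mono) auto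
    then show ?thesis using ar[OF that(2)] L by simp
  qed
  show ?thesis
  proof (cases "\<exists>t1\<ge>T. a t1 < e")
    case False
    then have "slow a" unfolding slow_def using e(1) by (auto simp: not_less)
    then show ?thesis ..
  next
    case True
    then obtain t1 where t1: "t1 \<ge> T" "a t1 < e" by blast
    have stay: "a t < e" if t: "t \<ge> t1" for t
    proof (rule ccontr)
      assume "\<not> a t < e"
      moreover have "a t1 < e / 2" by (rule gap[OF t1])
      ultimately have "a t1 \<le> 3 / 4 * e" "3 / 4 * e \<le> a t" using e(1) by auto
      moreover have "continuous_on {t1..t} a"
        using da DERIV_isCont by (intro continuous_at_imp_continuous_on) blast
      ultimately obtain s where s: "t1 \<le> s" "a s = 3 / 4 * e"
        using IVT'[of a t1 "3 / 4 * e" t] t by blast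
      then show False using gap[of s] t1 e(1) by auto
    qed
    have la: "(a \<longlongrightarrow> 0) at_top"
    proof (rule Lim_null_comparison)
      show "((\<lambda>t. 2 / L * r t) \<longlongrightarrow> 0) at_top" using tendsto_mult[OF tendsto_const[of "2 / L"] r] by simp
      show "\<forall>\<^sub>F t in at_top. norm (a t) \<le> 2 / L * r t"
        using eventually_ge_at_top[of t1] by eventually_elim (use ar[OF stay] apos in \<open>auto simp: less_imp_le\<close>)
    qed
    have "((\<lambda>t. (a t)\<^sup>2 + (b t)\<^sup>2 - (a t)\<^sup>2) \<longlongrightarrow> S - 0\<^sup>2) at_top" by (intro tendsto_intros S la)
    then have "((\<lambda>t. (b t)\<^sup>2) \<longlongrightarrow> S) at_top" by simp
    then have "\<forall>\<^sub>F t in at_top. S / 4 < (b t)\<^sup>2" by (rule order_tendstoD) (use S in simp)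
    then obtain T2 where T2: "\<And>t. t \<ge> T2 \<Longrightarrow> S / 4 < (b t)\<^sup>2" unfolding eventually_at_top_linorder by blast
    have "sqrt S / 2 \<le> b t" if "t \<ge> T2" for t
    proof (rule power2_le_imp_le)
      show "(sqrt S / 2)\<^sup>2 \<le> (b t)\<^sup>2" using T2[OF that] S by (simp add: power_divide)
    qed (use bpos[of t] in simp)
    then have "slow b" unfolding slow_def using S(2) by (intro exI[of _ "sqrt S / 2"]) auto
    then show ?thesis using fast_if_tendsto_0[OF q la] by blast
  qed
qed

text \<open>If \<open>b\<close> stays away from 0, the sublinear coupling keeps \<open>a\<close>
  away from 0 as well, which contradicts exponential decay.\<close>

lemma not_fast_slow:
  assumes q: "q < 1" and "fast a" "slow b"
  shows False
proof -
  obtain K T where K: "K > 0" "\<And>t. t \<ge> T \<Longrightarrow> a t \<le> K * exp (- \<gamma> * t)" using \<open>fast a\<close> unfolding fast_def by blast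
  obtain c T' where c: "c > 0" "\<And>t. t \<ge> T' \<Longrightarrow> c \<le> b t" using \<open>slow b\<close> unfolding slow_def by blast
  obtain e where e: "e > 0" "\<And>x y. 0 < x \<Longrightarrow> x < e \<Longrightarrow> c \<le> y \<Longrightarrow> \<alpha> * \<gamma> * x < nl \<mu>1 \<beta> q x y"
    using nl_small_dominates_linear[of \<beta> \<mu>1 q c "\<alpha> * \<gamma>"] par q c ag by auto
  have "\<exists>e>0. \<forall>t\<ge>T'. a t \<ge> e"
    by (rule A.bounded_below[OF e(1)]) (use e(2) c apos in auto)
  then obtain d where d: "d > 0" "\<And>t. t \<ge> T' \<Longrightarrow> a t \<ge> d" by blast
  \<comment> \<open>At this time \<open>K * exp (- \<gamma> * t)\<close> is at most
    \<open>d / exp 1\<close>, hence below the lower bound \<open>d\<close>.\<close>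
  define t where "t = max (max T T') ((ln (K / d) + 1) / \<gamma>)"
  have "T \<le> t" "T' \<le> t" by (simp_all add: t_def)
  then have "d \<le> K * exp (- \<gamma> * t)" using d(2) K(2) order_trans by blast
  then have "exp (\<gamma> * t) \<le> K / d" using d(1) by (simp add: exp_minus field_simps)
  then have "\<gamma> * t \<le> ln (K / d)" using K(1) d(1) by (simp add: ln_ge_iff)
  moreover have "ln (K / d) + 1 \<le> \<gamma> * t"
  proof -
    have "(ln (K / d) + 1) / \<gamma> \<le> t" by (simp add: t_def)
    then show ?thesis using ag by (simp add: field_simps)
  qed
  ultimately show False by simp
qed

text \<open>The borderline \<open>q = 1\<close> is left out: there the coupling and the linear term
  have the same order in a small component, so neither argument decides.\<close>

lemma alternatives:
  assumes "q \<noteq> 1"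
  shows "fast a \<and> fast b \<or> slow a \<and> slow b \<or> (q > 1 \<and> (fast a \<and> slow b \<or> fast b \<and> slow a))"
proof -
  interpret R: emden_system b b1 a a1 \<mu>2 \<mu>1 \<beta> q \<alpha> \<gamma> by (rule swapped)
  have eq: "R.fast = fast" "R.slow = slow" by (simp_all add: fun_eq_iff R.fast_def R.slow_def fast_def slow_def)
  obtain S where S: "((\<lambda>t. (a t)\<^sup>2 + (b t)\<^sup>2) \<longlongrightarrow> S) at_top" using energy_limits by blast
  have S': "((\<lambda>t. (b t)\<^sup>2 + (a t)\<^sup>2) \<longlongrightarrow> S) at_top" using S by (simp add: add.commute)
  have "S \<ge> 0" by (rule tendsto_lowerbound[OF S]) auto
  then consider "S = 0" | "S > 0" "q < 1" | "S > 0" "q > 1" using assms by linarith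
  then show ?thesis
  proof cases
    case 1 then show ?thesis using fast_if_both_tendsto_0 S by simp
  next
    case 2 then show ?thesis using slow_if_sublinear[OF _ S] R.slow_if_sublinear[OF _ S'] eq by simp
  next
    case 3 then show ?thesis
      using slow_or_fast_if_superlinear[OF _ S] R.slow_or_fast_if_superlinear[OF _ S'] eq by auto
  qed
qed

text \<open>Times \<open>t \<ge> 0\<close> correspond to \<open>norm x \<ge> 1\<close>. On the part
  before \<open>T\<close> the global bound \<open>M\<close> is absorbed into the constant.\<close>

lemma fast_global:
  assumes "fast a"
  shows "\<exists>K>0. \<forall>t\<ge>0. a t \<le> K * exp (- \<gamma> * t)"
proof -
  obtain K T where K: "K > 0" "\<And>t. t \<ge> T \<Longrightarrow> a t \<le> K * exp (- \<gamma> * t)" using assms unfolding fast_def by blast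
  obtain M where M: "M > 0" "\<And>t. a t \<le> M" using bounded_a by blast
  have "a t \<le> max K (M * exp (\<gamma> * T)) * exp (- \<gamma> * t)" if "t \<ge> 0" for t
  proof (cases "t \<ge> T")
    case True
    have "K * exp (- \<gamma> * t) \<le> max K (M * exp (\<gamma> * T)) * exp (- \<gamma> * t)" by (intro mult_right_mono) auto
    then show ?thesis using K(2)[OF True] by linarith
  next
    case False
    have "a t \<le> M * 1" using M by simp
    also have "\<dots> \<le> M * exp (\<gamma> * (T - t))" using False ag M by (intro mult_left_mono) auto
    also have "\<dots> = M * exp (\<gamma> * T) * exp (- \<gamma> * t)" by (simp add: mult.assoc mult_exp_exp right_diff_distrib)
    also have "\<dots> \<le> max K (M * exp (\<gamma> * T)) * exp (- \<gamma> * t)" by (intro mult_right_mono) auto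
    finally show ?thesis .
  qed
  then show ?thesis using K(1) by (intro exI[of _ "max K (M * exp (\<gamma> * T))"]) auto
qed

lemma slow_global:
  assumes "slow a"
  shows "\<exists>c>0. \<forall>t\<ge>0. c \<le> a t"
proof -
  obtain c T where c: "c > 0" "\<And>t. t \<ge> T \<Longrightarrow> c \<le> a t" using assms unfolding slow_def by blast
  have "continuous_on {0..max T 0} a" using da DERIV_isCont by (intro continuous_at_imp_continuous_on) blast
  then have "\<exists>m\<in>{0..max T 0}. \<forall>t\<in>{0..max T 0}. a m \<le> a t"
    by (intro continuous_attains_inf) auto
  then obtain m where m: "\<And>t. t \<in> {0..max T 0} \<Longrightarrow> a m \<le> a t" by blast
  have "min c (a m) \<le> a t" if "t \<ge> 0" for t
    using c(2)[of t] m[of t] that by (cases "t \<ge> T") (auto simp: min_def)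
  then show ?thesis using c(1) apos[of m] by (intro exI[of _ "min c (a m)"]) auto
qed

end

section \<open>Moving spheres\<close>

text \<open>The region is unbounded and punctured, and \<open>w\<close> is merely nonnegative near 0
  and at infinity. Adding \<open>\<epsilon> + \<epsilon> * norm z powr (2 - n)\<close> dominates the
  barrier near both, so the minimum principle applies on the compact set left between them.\<close>

lemma exterior_lower_bound:
  fixes w :: "real^'n \<Rightarrow> real"
  assumes N: "CARD('n) \<ge> 3" and \<rho>: "0 < \<rho>" and c: "c \<ge> 0"
    and cont: "continuous_on {y. \<rho> \<le> norm (y - x) \<and> y \<noteq> 0} w"
    and nonneg: "\<And>y. \<rho> \<le> norm (y - x) \<Longrightarrow> y \<noteq> 0 \<Longrightarrow> 0 \<le> w y"
    and bd: "\<And>y. norm (y - x) = \<rho> \<Longrightarrow> y \<noteq> 0 \<Longrightarrow> c * \<rho> powr (2 - real CARD('n)) \<le> w y"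
    and lap: "\<And>y. \<rho> < norm (y - x) \<Longrightarrow> y \<noteq> 0 \<Longrightarrow> \<exists>l<0. has_lap w y l"
    and y: "\<rho> \<le> norm (y - x)" "y \<noteq> 0"
  shows "c * norm (y - x) powr (2 - real CARD('n)) \<le> w y"
proof (rule ccontr)
  define \<nu> where "\<nu> = real CARD('n) - 2"
  have \<nu>: "\<nu> > 0" "2 - real CARD('n) = - \<nu>" using N by (auto simp: \<nu>_def)
  assume neg: "\<not> ?thesis"
  define D where "D = c * norm (y - x) powr - \<nu> - w y"
  define A where "A = 1 + norm y powr - \<nu>"
  \<comment> \<open>Chosen so that the added terms use up only half of the assumed violation
    \<open>D\<close> at \<open>y\<close>.\<close>
  define \<epsilon> where "\<epsilon> = D / (2 * A)"
  have DA: "D > 0" "A > 0" using neg by (auto simp: D_def A_def \<nu> add_pos_nonneg)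
  then have \<epsilon>: "\<epsilon> > 0" by (simp add: \<epsilon>_def)
  have "((\<lambda>t. c * t powr - \<nu>) \<longlongrightarrow> c * 0) at_top"
    using \<nu> by (intro tendsto_intros tendsto_neg_powr filterlim_ident) auto
  then have "\<forall>\<^sub>F t in at_top. c * t powr - \<nu> < \<epsilon>" using \<epsilon> by (intro order_tendstoD(2)) auto
  then obtain R0 where R0: "\<And>t. t \<ge> R0 \<Longrightarrow> c * t powr - \<nu> < \<epsilon>" unfolding eventually_at_top_linorder by blast
  define R where "R = max R0 (norm (y - x)) + 1"
  have R: "R > norm (y - x)" "\<And>t. t \<ge> R \<Longrightarrow> c * t powr - \<nu> < \<epsilon>" using R0 by (auto simp: R_def)
  define B where "B = c * \<rho> powr - \<nu> + 1"
  have B: "B > 0" using c by (simp add: B_def add_nonneg_pos)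
  \<comment> \<open>Below this radius \<open>\<epsilon> * t powr - \<nu>\<close> exceeds
    \<open>B\<close>, a bound for the barrier; the 1 in \<open>B\<close> keeps it positive when
    \<open>c = 0\<close>.\<close>
  define X where "X = (\<epsilon> / B) powr (1 / \<nu>)"
  have X: "X > 0" using \<epsilon> B by (simp add: X_def)
  define r where "r = min (norm y) X / 2"
  have r: "0 < r" "r < norm y" "r \<le> X"
    using X y(2) by (auto simp: r_def min_def)
  have small: "c * s powr - \<nu> \<le> \<epsilon> * t powr - \<nu>" if "0 < t" "t \<le> r" "\<rho> \<le> s" for t s
  proof -
    have "t powr \<nu> \<le> X powr \<nu>" using that r \<nu> by (intro powr_mono2) auto
    also have "\<dots> = \<epsilon> / B" using \<nu> \<epsilon> B by (simp add: X_def powr_powr)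
    finally have "B \<le> \<epsilon> * t powr - \<nu>" using that(1) B by (simp add: powr_minus field_simps)
    moreover have "c * s powr - \<nu> \<le> c * \<rho> powr - \<nu>"
      using c \<rho> \<nu> that(3) by (intro mult_left_mono powr_mono2') auto
    ultimately show ?thesis by (simp add: B_def)
  qed
  define K where "K = {z. \<rho> \<le> norm (z - x)} \<inter> cball x R \<inter> {z. r \<le> norm z}"
  define \<zeta> where "\<zeta> z = w z - c * norm (z - x) powr - \<nu> + (\<epsilon> + \<epsilon> * norm (z - 0) powr - \<nu>)" for z
  have K: "compact K" unfolding K_def
    by (intro closed_Int_compact compact_Int_closed closed_Collect_le continuous_intros compact_cball)
  have K_sub: "K \<subseteq> {y. \<rho> \<le> norm (y - x) \<and> y \<noteq> 0}" using r by (auto simp: K_def)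
  have "\<zeta> y \<ge> 0"
  proof (rule minimum_principle[OF K])
    show "continuous_on K \<zeta>"
      unfolding \<zeta>_def using continuous_on_subset[OF cont K_sub] K_sub \<rho>
      by (intro continuous_intros) auto
    show "y \<in> K" using y r R by (simp add: K_def dist_norm norm_minus_commute)
    fix z assume z: "z \<in> K" "\<zeta> z < 0"
    have zz: "\<rho> \<le> norm (z - x)" "norm (z - x) \<le> R" "r \<le> norm z" "z \<noteq> 0"
      using z(1) r by (auto simp: K_def dist_norm norm_minus_commute)
    have wz: "w z \<ge> 0" using nonneg zz by blast
    have p: "\<epsilon> * norm z powr - \<nu> \<ge> 0" using \<epsilon> by simp
    have z1: "norm (z - x) \<noteq> \<rho>"
    proof
      assume "norm (z - x) = \<rho>"
      then show False using bd[of z] zz z(2) p \<epsilon> by (simp add: \<zeta>_def \<nu>)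
    qed
    have z2: "norm (z - x) \<noteq> R"
    proof
      assume "norm (z - x) = R"
      then show False using R(2)[of R] z(2) wz p by (simp add: \<zeta>_def)
    qed
    have z3: "norm z \<noteq> r"
    proof
      assume "norm z = r"
      then show False using small[OF r(1) order_refl zz(1)] z(2) wz \<epsilon> by (simp add: \<zeta>_def)
    qed
    have "z \<in> {z. \<rho> < norm (z - x)} \<inter> ball x R \<inter> {z. r < norm z}"
      using zz z1 z2 z3 by (auto simp: dist_norm norm_minus_commute)
    moreover have "open ({z. \<rho> < norm (z - x)} \<inter> ball x R \<inter> {z. r < norm z})"
      by (intro open_Int open_Collect_less continuous_intros open_ball)
    moreover have "{z. \<rho> < norm (z - x)} \<inter> ball x R \<inter> {z. r < norm z} \<subseteq> K" by (auto simp: K_def)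
    ultimately have int: "z \<in> interior K" using interior_maximal by blast
    obtain l where l: "l < 0" "has_lap w z l" using lap[of z] zz z1 by auto
    have "z \<noteq> x" using zz \<rho> by auto
    have "has_lap \<zeta> z (l - c * 0 + (0 + \<epsilon> * 0))"
      unfolding \<zeta>_def \<nu>(2)[symmetric]
      by (intro has_lap_add has_lap_diff has_lap_cmult has_lap_fundamental has_lap_const l \<open>z \<noteq> x\<close> \<open>z \<noteq> 0\<close>)
    then show "z \<in> interior K \<and> (\<exists>l<0. has_lap \<zeta> z l)" using int l by auto
  qed
  moreover have "\<zeta> y = - D + \<epsilon> * A" by (simp add: \<zeta>_def D_def A_def algebra_simps)
  moreover have "\<epsilon> * A = D / 2" using DA by (simp add: \<epsilon>_def)
  ultimately show False using DA by simp
qed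

text \<open>A quantitative Hopf lemma: the harmonic comparison function vanishes on the inner sphere
  and equals \<open>m\<close> on the outer one. Its positive slope at the inner sphere passes to
  \<open>w\<close> where \<open>w\<close> vanishes.\<close>

lemma hopf_lower_bound:
  fixes w :: "real^'n \<Rightarrow> real"
  assumes N: "CARD('n) \<ge> 3" and \<rho>: "0 < r" "r < \<rho>" and m: "m > 0"
    and cont: "continuous_on {y. r \<le> norm (y - x) \<and> norm (y - x) \<le> \<rho>} w"
    and nonneg: "\<And>y. r \<le> norm (y - x) \<Longrightarrow> norm (y - x) \<le> \<rho> \<Longrightarrow> 0 \<le> w y"
    and bd: "\<And>y. norm (y - x) = \<rho> \<Longrightarrow> m \<le> w y"
    and lap: "\<And>y. r < norm (y - x) \<Longrightarrow> norm (y - x) < \<rho> \<Longrightarrow> \<exists>l<0. has_lap w y l"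
  shows "\<exists>c>0. \<forall>y. r \<le> norm (y - x) \<and> norm (y - x) \<le> \<rho> \<longrightarrow>
     c * (r powr (2 - real CARD('n)) - norm (y - x) powr (2 - real CARD('n))) \<le> w y"
proof -
  define k where "k = 2 - real CARD('n)"
  have k: "k < 0" using N by (simp add: k_def)
  have dpos: "r powr k - \<rho> powr k > 0" using powr_less_mono2_neg[OF k \<rho>] by simp
  define c where "c = m / (r powr k - \<rho> powr k)"
  have c: "c > 0" using m dpos by (simp add: c_def)
  have c\<rho>: "c * (r powr k - \<rho> powr k) = m" using dpos by (simp add: c_def)
  define K where "K = {y. r \<le> norm (y - x) \<and> norm (y - x) \<le> \<rho>}"
  define \<zeta> where "\<zeta> y = w y - c * (r powr k - norm (y - x) powr k)" for y
  have "K = {y. r \<le> norm (y - x)} \<inter> cball x \<rho>" by (auto simp: K_def dist_norm norm_minus_commute)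
  then have K: "compact K"
    by (auto intro!: closed_Int_compact closed_Collect_le continuous_intros compact_cball)
  have "\<zeta> y \<ge> 0" if "y \<in> K" for y
  proof (rule minimum_principle[OF K _ _ that])
    show "continuous_on K \<zeta>"
      unfolding \<zeta>_def using cont \<rho> unfolding K_def[symmetric]
      by (intro continuous_intros) (auto simp: K_def)
    fix z assume z: "z \<in> K" "\<zeta> z < 0"
    have zz: "r \<le> norm (z - x)" "norm (z - x) \<le> \<rho>" using z(1) by (auto simp: K_def)
    have z1: "norm (z - x) \<noteq> r" using nonneg[of z] zz z(2) by (auto simp: \<zeta>_def)
    have z2: "norm (z - x) \<noteq> \<rho>" using bd[of z] z(2) c\<rho> by (auto simp: \<zeta>_def)
    have "z \<in> {z. r < norm (z - x)} \<inter> ball x \<rho>"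
      using zz z1 z2 by (auto simp: dist_norm norm_minus_commute)
    moreover have "open ({z. r < norm (z - x)} \<inter> ball x \<rho>)"
      by (intro open_Int open_Collect_less continuous_intros open_ball)
    moreover have "{z. r < norm (z - x)} \<inter> ball x \<rho> \<subseteq> K"
      by (auto simp: K_def dist_norm norm_minus_commute)
    ultimately have int: "z \<in> interior K" using interior_maximal by blast
    obtain l where l: "l < 0" "has_lap w z l" using lap[of z] zz z1 z2 by auto
    have "z \<noteq> x" using zz \<rho> by auto
    have "has_lap \<zeta> z (l - c * (0 - 0))"
      unfolding \<zeta>_def k_def
      by (intro has_lap_diff has_lap_cmult has_lap_fundamental has_lap_const l \<open>z \<noteq> x\<close>)
    then show "z \<in> interior K \<and> (\<exists>l<0. has_lap \<zeta> z l)" using int l by auto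
  qed
  then show ?thesis using c unfolding \<zeta>_def K_def k_def by (intro exI[of _ c]) auto
qed

section \<open>Radial monotonicity and Kelvin comparison near the sphere\<close>

text \<open>Up to the factor \<open>r powr (\<nu>/2 - 1)\<close>, with \<open>\<nu> = CARD('n) - 2\<close>, this is the radial derivative of
  \<open>r powr (\<nu>/2) * u (x + r \<theta>)\<close>, the quantity whose monotonicity in \<open>r\<close> expresses the Kelvin comparison.\<close>

definition radial_rate :: "real^'n \<Rightarrow> (real^'n \<Rightarrow> real) \<Rightarrow> real^'n \<Rightarrow> real" where
  "radial_rate x u y = (real CARD('n) - 2) / 2 * u y + (\<Sum>i\<in>UNIV. (y - x) $ i * partial u i y)"

lemma continuous_on_radial_rate:
  assumes "C2_on S u"
  shows "continuous_on S (radial_rate x u)"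
  unfolding radial_rate_def using C2_onD(1,2)[OF assms] by (intro continuous_intros) auto

lemma radial_derivative:
  fixes u :: "real^'n \<Rightarrow> real"
  assumes "C2_on S u" "open S" "x + r *\<^sub>R \<theta> \<in> S"
  shows "((\<lambda>r. u (x + r *\<^sub>R \<theta>)) has_real_derivative (\<Sum>i\<in>UNIV. \<theta> $ i * partial u i (x + r *\<^sub>R \<theta>))) (at r)"
  by (rule chain_rule_partials[OF assms(2)])
     (use assms C2_onD[OF assms(1)] in \<open>auto intro!: derivative_eq_intros\<close>)

lemma radial_monotone:
  fixes u :: "real^'n \<Rightarrow> real"
  assumes C2: "C2_on S u" and S: "open S" and \<theta>: "norm \<theta> = 1" and r: "0 < r1" "r1 \<le> r2"
    and pos: "\<And>r. r1 \<le> r \<Longrightarrow> r \<le> r2 \<Longrightarrow> x + r *\<^sub>R \<theta> \<in> S \<and> radial_rate x u (x + r *\<^sub>R \<theta>) \<ge> 0"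
  shows "r1 powr ((real CARD('n) - 2) / 2) * u (x + r1 *\<^sub>R \<theta>) \<le> r2 powr ((real CARD('n) - 2) / 2) * u (x + r2 *\<^sub>R \<theta>)"
proof (rule DERIV_nonneg_imp_nondecreasing[OF r(2)])
  fix t assume t: "r1 \<le> t" "t \<le> r2"
  define k where "k = (real CARD('n) - 2) / 2"
  have t0: "t > 0" using t r by simp
  have "((\<lambda>r. r powr k * u (x + r *\<^sub>R \<theta>)) has_real_derivative
     k * t powr (k - 1) * u (x + t *\<^sub>R \<theta>) + (\<Sum>i\<in>UNIV. \<theta> $ i * partial u i (x + t *\<^sub>R \<theta>)) * t powr k) (at t)"
    using DERIV_mult[OF has_real_derivative_powr[OF t0] radial_derivative[OF C2 S]] pos[OF t] by blast
  moreover have "k * t powr (k - 1) * u (x + t *\<^sub>R \<theta>) + (\<Sum>i\<in>UNIV. \<theta> $ i * partial u i (x + t *\<^sub>R \<theta>)) * t powr k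
     = t powr (k - 1) * radial_rate x u (x + t *\<^sub>R \<theta>)"
  proof -
    have "t powr k = t powr (k - 1) * t" using t0 by (simp add: powr_diff)
    then show ?thesis unfolding radial_rate_def k_def[symmetric]
      by (simp add: algebra_simps sum_distrib_left)
  qed
  ultimately have "((\<lambda>r. r powr k * u (x + r *\<^sub>R \<theta>)) has_real_derivative t powr (k - 1) * radial_rate x u (x + t *\<^sub>R \<theta>)) (at t)"
    by simp
  moreover have "t powr (k - 1) * radial_rate x u (x + t *\<^sub>R \<theta>) \<ge> 0" using pos[OF t] by simp
  ultimately show "\<exists>y. ((\<lambda>r. r powr ((real CARD('n) - 2) / 2) * u (x + r *\<^sub>R \<theta>)) has_real_derivative y) (at t) \<and> 0 \<le> y"
    unfolding k_def by blast
qed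

text \<open>Radius 0 is thereby a genuine starting sphere: the comparison at \<open>l = 0\<close> is
  positivity of \<open>u\<close> and \<open>v\<close>.\<close>

lemma kelvin_0: "CARD('n) \<ge> 3 \<Longrightarrow> kelvin x 0 u (y :: real^'n) = 0"
  by (simp add: kelvin_def)

text \<open>The inverted point lies on the same ray at radius \<open>l\<^sup>2 / r \<le> r\<close>,
  so the claim compares two values of one monotone function. The condition
  \<open>s * \<rho> \<le> l\<^sup>2\<close> keeps the smaller radius inside the shell of
  monotonicity.\<close>

lemma kelvin_le_if_radial_monotone:
  fixes u :: "real^'n \<Rightarrow> real"
  assumes C2: "C2_on S u" and S: "open S" and l: "0 < l" "l \<le> norm (y - x)" "norm (y - x) \<le> \<rho>" "s * \<rho> \<le> l\<^sup>2" "s \<ge> 0"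
    and pos: "\<And>y. s \<le> norm (y - x) \<Longrightarrow> norm (y - x) \<le> \<rho> \<Longrightarrow> y \<in> S \<and> radial_rate x u y \<ge> 0"
  shows "kelvin x l u y \<le> u y"
proof -
  define k where "k = (real CARD('n) - 2) / 2"
  define r where "r = norm (y - x)"
  define \<theta> where "\<theta> = (1 / r) *\<^sub>R (y - x)"
  have r: "r > 0" using l unfolding r_def by linarith
  have \<theta>: "norm \<theta> = 1" using r by (simp add: \<theta>_def r_def)
  have y: "y = x + r *\<^sub>R \<theta>" using r by (simp add: \<theta>_def)
  have le: "l\<^sup>2 / r \<le> r"
  proof -
    have "l * l \<le> r * r" using l by (intro mult_mono) (auto simp: r_def)
    then show ?thesis using r by (simp add: power2_eq_square field_simps)
  qed
  have ge: "s \<le> l\<^sup>2 / r"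
  proof -
    have "s * r \<le> s * \<rho>" using l by (intro mult_left_mono) (auto simp: r_def)
    then show ?thesis using r l by (simp add: field_simps)
  qed
  have "(l\<^sup>2 / r) powr k * u (x + (l\<^sup>2 / r) *\<^sub>R \<theta>) \<le> r powr k * u (x + r *\<^sub>R \<theta>)"
    unfolding k_def
  proof (rule radial_monotone[OF C2 S \<theta> _ le])
    show "0 < l\<^sup>2 / r" using l r by simp
    fix t assume t: "l\<^sup>2 / r \<le> t" "t \<le> r"
    have "t > 0" using t(1) \<open>0 < l\<^sup>2 / r\<close> by linarith
    show "x + t *\<^sub>R \<theta> \<in> S \<and> 0 \<le> radial_rate x u (x + t *\<^sub>R \<theta>)"
      by (rule pos) (use t ge \<theta> \<open>t > 0\<close> l in \<open>auto simp: r_def\<close>)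
  qed
  moreover have "(l\<^sup>2 / r) powr k = r powr k * (l / r) powr (real CARD('n) - 2)"
  proof -
    have "l\<^sup>2 / r = r * (l / r)\<^sup>2" using r by (simp add: power2_eq_square)
    then have "(l\<^sup>2 / r) powr k = r powr k * ((l / r)\<^sup>2) powr k" using r by (simp add: powr_mult)
    also have "((l / r)\<^sup>2) powr k = ((l / r) powr 2) powr k" using l r by simp
    also have "\<dots> = (l / r) powr (2 * k)" by (rule powr_powr)
    also have "2 * k = real CARD('n) - 2" by (simp add: k_def)
    finally show ?thesis .
  qed
  moreover have "(l / r)\<^sup>2 *\<^sub>R (y - x) = (l\<^sup>2 / r) *\<^sub>R \<theta>"
    using r by (simp add: \<theta>_def power2_eq_square)
  then have "kelvin x l u y = (l / r) powr (real CARD('n) - 2) * u (x + (l\<^sup>2 / r) *\<^sub>R \<theta>)"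
    unfolding kelvin_def r_def[symmetric] by (simp only:)
  ultimately have "r powr k * kelvin x l u y \<le> r powr k * u (x + r *\<^sub>R \<theta>)"
    by (simp only: mult.assoc)
  then have "r powr k * kelvin x l u y \<le> r powr k * u y" using y by (simp only:)
  then show ?thesis using r by simp
qed

section \<open>Dependence of the Kelvin transform on the radius\<close>

text \<open>The difference of two Kelvin transforms about \<open>x\<close> is \<open>norm (y - x) powr (2 - CARD('n))\<close> times a
  continuous function of the inverted point \<open>(y - x) / (norm (y - x))\<^sup>2\<close>, which stays in a compact ball.\<close>

lemma kelvin_uniform_perturbation:
  fixes u :: "real^'n \<Rightarrow> real"
  assumes N: "CARD('n) \<ge> 3" and cont: "continuous_on (- {0}) u" and \<rho>: "0 \<le> l0" "l0 < \<rho>" "\<rho> < norm x" and c: "c > 0"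
  shows "\<exists>\<epsilon>>0. \<forall>l y. l0 \<le> l \<longrightarrow> l < l0 + \<epsilon> \<longrightarrow> \<rho> \<le> norm (y - x) \<longrightarrow>
     kelvin x l u y - kelvin x l0 u y \<le> c * norm (y - x) powr (2 - real CARD('n))"
proof -
  define \<nu> where "\<nu> = real CARD('n) - 2"
  have \<nu>: "\<nu> > 0" using N by (simp add: \<nu>_def)
  define \<Phi> where "\<Phi> p = fst p powr \<nu> * u (x + (fst p)\<^sup>2 *\<^sub>R snd p)" for p :: "real \<times> (real^'n)"
  \<comment> \<open>On this compact set \<open>l\<^sup>2 * norm \<xi> \<le> \<rho> < norm x\<close>,
    so the inverted point never meets the singularity and \<Phi> is uniformly continuous.\<close>
  define D where "D = {0..\<rho>} \<times> cball (0::real^'n) (1 / \<rho>)"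
  have "continuous_on D \<Phi>"
    unfolding \<Phi>_def
  proof (intro continuous_on_mult continuous_on_powr' continuous_on_compose2[OF cont] continuous_intros)
    show "(\<lambda>p. x + (fst p)\<^sup>2 *\<^sub>R snd p) ` D \<subseteq> - {0}"
    proof clarsimp
      fix l :: real and \<xi> :: "real^'n" assume "(l, \<xi>) \<in> D" and z: "x + l\<^sup>2 *\<^sub>R \<xi> = 0"
      then have *: "0 \<le> l" "l \<le> \<rho>" "norm \<xi> \<le> 1 / \<rho>" by (auto simp: D_def)
      have "norm (l\<^sup>2 *\<^sub>R \<xi>) = l\<^sup>2 * norm \<xi>" by simp
      also have "\<dots> \<le> \<rho>\<^sup>2 * (1 / \<rho>)" using * \<rho> by (intro mult_mono power_mono) auto
      also have "\<dots> = \<rho>" by (simp add: power2_eq_square)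
      also have "\<rho> < norm x" by (rule \<rho>)
      finally show False using z by (metis add_eq_0_iff norm_minus_cancel less_irrefl)
    qed
  qed (use \<nu> in \<open>auto simp: D_def\<close>)
  moreover have "compact D" unfolding D_def by (intro compact_Times compact_Icc compact_cball)
  ultimately have "uniformly_continuous_on D \<Phi>" by (rule compact_uniformly_continuous)
  then obtain d where d: "d > 0" "\<And>p p'. p \<in> D \<Longrightarrow> p' \<in> D \<Longrightarrow> dist p' p < d \<Longrightarrow> dist (\<Phi> p') (\<Phi> p) < c"
    unfolding uniformly_continuous_on_def using c by blast
  have keq: "kelvin x l u y = norm (y - x) powr (2 - real CARD('n)) * \<Phi> (l, (1 / (norm (y - x))\<^sup>2) *\<^sub>R (y - x))"
    if "l \<ge> 0" for l y
  proof -
    have "norm (y - x) powr (2 - real CARD('n)) = inverse (norm (y - x) powr \<nu>)"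
      unfolding \<nu>_def by (metis minus_diff_eq powr_minus)
    then show ?thesis
      unfolding kelvin_def \<Phi>_def \<nu>_def[symmetric] using that by (simp add: powr_divide power_divide field_simps)
  qed
  show ?thesis
  proof (intro exI[of _ "min d (\<rho> - l0)"] conjI allI impI)
    show "0 < min d (\<rho> - l0)" using d \<rho> by simp
    fix l y assume l: "l0 \<le> l" "l < l0 + min d (\<rho> - l0)" and y: "\<rho> \<le> norm (y - x)"
    define \<xi> where "\<xi> = (1 / (norm (y - x))\<^sup>2) *\<^sub>R (y - x)"
    have "norm \<xi> = 1 / norm (y - x)" by (simp add: \<xi>_def power2_eq_square)
    then have \<xi>: "norm \<xi> \<le> 1 / \<rho>" using y \<rho> by (simp add: frac_le)
    have "dist (\<Phi> (l, \<xi>)) (\<Phi> (l0, \<xi>)) < c"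
      by (rule d(2)) (use l \<rho> \<xi> in \<open>auto simp: D_def dist_prod_def dist_real_def\<close>)
    then have "\<Phi> (l, \<xi>) - \<Phi> (l0, \<xi>) \<le> c" by (simp add: dist_real_def)
    then have "norm (y - x) powr (2 - real CARD('n)) * (\<Phi> (l, \<xi>) - \<Phi> (l0, \<xi>)) \<le> norm (y - x) powr (2 - real CARD('n)) * c"
      by (intro mult_left_mono) auto
    then show "kelvin x l u y - kelvin x l0 u y \<le> c * norm (y - x) powr (2 - real CARD('n))"
      using keq[of l y] keq[of l0 y] l \<rho> unfolding \<xi>_def[symmetric] by (simp add: algebra_simps)
  qed
qed

lemma kelvin_point_nonzero:
  fixes x y :: "real^'n"
  assumes "0 \<le> l" "l < norm x" "l \<le> norm (y - x)"
  shows "x + (l / norm (y - x))\<^sup>2 *\<^sub>R (y - x) \<noteq> 0"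
proof
  assume z: "x + (l / norm (y - x))\<^sup>2 *\<^sub>R (y - x) = 0"
  have "norm ((l / norm (y - x))\<^sup>2 *\<^sub>R (y - x)) \<le> l"
  proof (cases "y = x")
    case False
    then have "norm ((l / norm (y - x))\<^sup>2 *\<^sub>R (y - x)) = l * (l / norm (y - x))"
      by (simp add: power2_eq_square)
    also have "\<dots> \<le> l * 1" using assms False by (intro mult_left_mono) auto
    finally show ?thesis by simp
  qed (use assms in simp)
  then show False using z assms(2) by (metis add_eq_0_iff norm_minus_cancel not_less)
qed

lemma continuous_on_kelvin:
  fixes u :: "real^'n \<Rightarrow> real"
  assumes cont: "continuous_on (- {0}) u" and l: "0 < l" "l < norm x"
  shows "continuous_on {y. l \<le> norm (y - x)} (kelvin x l u)"
  unfolding kelvin_def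
  by (intro continuous_intros continuous_on_compose2[OF cont])
     (use l kelvin_point_nonzero[of l x] in \<open>auto simp: less_imp_le\<close>)

lemma open_nonzero: "open (- {0 :: 'a::real_normed_vector})"
  by (simp add: open_Compl)

lemma isCont_if_nonzero:
  fixes u :: "real^'n \<Rightarrow> real"
  assumes "continuous_on (- {0}) u" "z \<noteq> 0"
  shows "isCont u z"
  using assms continuous_on_eq_continuous_at[of "- {0}" u] by (auto simp: open_Compl)

lemma tendsto_kelvin_radius:
  fixes u :: "real^'n \<Rightarrow> real"
  assumes cont: "continuous_on (- {0}) u" and l: "0 < l" "y \<noteq> x" "x + (l / norm (y - x))\<^sup>2 *\<^sub>R (y - x) \<noteq> 0"
  shows "((\<lambda>l. kelvin x l u y) \<longlongrightarrow> kelvin x l u y) (at_left l)"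
proof -
  have "isCont u (x + (l / norm (y - x))\<^sup>2 *\<^sub>R (y - x))"
    by (rule isCont_if_nonzero[OF cont l(3)])
  then show ?thesis unfolding kelvin_def using l
    by (intro tendsto_intros isCont_tendsto_compose[of _ u]) auto
qed

lemma kelvin_le_at_left_limit:
  fixes u :: "real^'n \<Rightarrow> real"
  assumes cont: "continuous_on (- {0}) u" and l: "0 < l" "y \<noteq> x" "x + (l / norm (y - x))\<^sup>2 *\<^sub>R (y - x) \<noteq> 0"
    and le: "\<And>l'. 0 < l' \<Longrightarrow> l' < l \<Longrightarrow> kelvin x l' u y \<le> u y"
  shows "kelvin x l u y \<le> u y"
proof (rule tendsto_upperbound[OF tendsto_kelvin_radius[OF cont l]])
  show "\<forall>\<^sub>F l' in at_left l. kelvin x l' u y \<le> u y"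
    using eventually_at_left_real[OF l(1)] by eventually_elim (use le in auto)
qed simp

section \<open>Moving the spheres up to the singularity\<close>

locale subcritical_system =
  fixes u v :: "real^'n \<Rightarrow> real" and q \<mu>1 \<mu>2 \<beta> :: real
  assumes N3: "CARD('n) \<ge> 3" and par: "\<mu>1 > 0" "\<mu>2 > 0" "\<beta> > 0" "q > 0"
    and subcritical: "2 * q + 1 < (real CARD('n) + 2) / (real CARD('n) - 2)"
    and sol: "pos_solution q \<mu>1 \<mu>2 \<beta> u v"
begin

lemma swapped: "subcritical_system v u q \<mu>2 \<mu>1 \<beta>"
  by unfold_locales (use N3 par subcritical sol in \<open>auto simp: pos_solution_def\<close>)

lemma C2: "C2_on (- {0}) u" "C2_on (- {0}) v"
  and pos: "y \<noteq> 0 \<Longrightarrow> u y > 0" "y \<noteq> 0 \<Longrightarrow> v y > 0"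
  and lap: "y \<noteq> 0 \<Longrightarrow> laplacian u y = - nl \<mu>1 \<beta> q (u y) (v y)"
  using sol by (auto simp: pos_solution_def nl_def minus_equation_iff)

lemma cont: "continuous_on (- {0}) u"
  using C2(1) C2_onD(1) by blast

text \<open>Strict superharmonicity holds because the exponent \<open>2 * q + 1\<close> is subcritical.\<close>

lemma kelvin_difference_superharmonic:
  assumes l: "0 \<le> l" "l < norm x" "l < norm (y - x)" "y \<noteq> 0"
    and le: "kelvin x l u y \<le> u y" "kelvin x l v y \<le> v y"
  shows "\<exists>k<0. has_lap (\<lambda>y. u y - kelvin x l u y) y k"
proof -
  have hu: "has_lap u y (- nl \<mu>1 \<beta> q (u y) (v y))"
    using has_lap_laplacian[OF C2(1) open_nonzero, of y] l lap by simp
  have f: "nl \<mu>1 \<beta> q (u y) (v y) > 0" using nl_pos par pos l by simp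
  show ?thesis
  proof (cases "l = 0")
    case True
    then have "(\<lambda>y. u y - kelvin x l u y) = u" using kelvin_0[OF N3] by auto
    then show ?thesis using hu f by (intro exI[of _ "- nl \<mu>1 \<beta> q (u y) (v y)"]) simp
  next
    case False
    then have l0: "l > 0" using l by simp
    define N where "N = real CARD('n)"
    have N: "N - 2 > 0" using N3 by (simp add: N_def)
    define Y where "Y = x + (l / norm (y - x))\<^sup>2 *\<^sub>R (y - x)"
    have Y: "Y \<noteq> 0" unfolding Y_def using kelvin_point_nonzero[of l x y] l by simp
    define k where "k = l / norm (y - x)"
    have "0 < norm (y - x)" using l l0 by linarith
    then have k: "0 < k" "k < 1" using l l0 by (simp_all add: k_def)
    have yx: "y \<noteq> x" using l l0 by auto
    have hk: "has_lap (kelvin x l u) y (k powr (N + 2) * laplacian u Y)"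
      using has_lap_kelvin[OF l0 yx open_nonzero C2(1)] Y unfolding Y_def k_def N_def by simp
    have "k powr (N + 2) < (k powr (N - 2)) powr (2 * q + 1)"
    proof -
      have "(N - 2) * (2 * q + 1) < N + 2" using subcritical N unfolding N_def by (simp add: field_simps)
      then show ?thesis unfolding powr_powr using k by (simp add: powr_less_mono')
    qed
    then have "k powr (N + 2) * nl \<mu>1 \<beta> q (u Y) (v Y) < (k powr (N - 2)) powr (2 * q + 1) * nl \<mu>1 \<beta> q (u Y) (v Y)"
      using nl_pos[of \<mu>1 \<beta> "u Y" "v Y" q] par pos[OF Y] by simp
    also have "\<dots> = nl \<mu>1 \<beta> q (k powr (N - 2) * u Y) (k powr (N - 2) * v Y)"
      using k pos[OF Y] by (simp add: nl_scale)
    \<comment> \<open>With \<open>\<beta> > 0\<close> the system is cooperative: \<open>nl\<close>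
      increases in both arguments, so the comparison of both components is used for each
      one.\<close>
    also have "\<dots> \<le> nl \<mu>1 \<beta> q (u y) (v y)"
    proof -
      have "k powr (N - 2) * u Y \<le> u y" "k powr (N - 2) * v Y \<le> v y"
        using le unfolding kelvin_def Y_def k_def N_def .
      then show ?thesis using par pos[OF Y] by (intro nl_mono) (auto simp: less_imp_le)
    qed
    finally have "- nl \<mu>1 \<beta> q (u y) (v y) - k powr (N + 2) * laplacian u Y < 0"
      using lap[OF Y] by simp
    then show ?thesis using has_lap_diff[OF hu hk] by blast
  qed
qed

definition sphere_ok :: "real^'n \<Rightarrow> real \<Rightarrow> bool" where
  "sphere_ok x l \<longleftrightarrow> (\<forall>y. l \<le> norm (y - x) \<longrightarrow> y \<noteq> 0 \<longrightarrow> kelvin x l u y \<le> u y \<and> kelvin x l v y \<le> v y)"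

lemma continuous_on_difference:
  assumes "0 \<le> l" "l < norm x"
  shows "continuous_on {y. l \<le> norm (y - x) \<and> y \<noteq> 0} (\<lambda>y. u y - kelvin x l u y)"
proof (cases "l = 0")
  case True
  then have "(\<lambda>y. u y - kelvin x l u y) = u" using kelvin_0[OF N3] by auto
  then show ?thesis by (simp only:) (rule continuous_on_subset[OF cont], auto)
next
  case False
  then have "continuous_on {y. l \<le> norm (y - x)} (kelvin x l u)"
    using assms continuous_on_kelvin[OF cont, of l x] by simp
  then show ?thesis
    by (intro continuous_on_diff continuous_on_subset[OF cont]) (auto elim: continuous_on_subset)
qed

text \<open>A point of equality outside the sphere would be a local minimum of a strictly
  superharmonic function.\<close>

lemma strict:
  assumes l: "0 \<le> l" "l < norm x" and ok: "sphere_ok x l" and y: "l < norm (y - x)" "y \<noteq> 0"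
  shows "kelvin x l u y < u y"
proof (rule ccontr)
  assume "\<not> ?thesis"
  then have eq: "u y - kelvin x l u y = 0" using ok y by (force simp: sphere_ok_def)
  obtain k where k: "k < 0" "has_lap (\<lambda>y. u y - kelvin x l u y) y k"
    using kelvin_difference_superharmonic[OF l y] ok y by (auto simp: sphere_ok_def)
  have "open ({y. l < norm (y - x)} \<inter> - {0})"
    by (intro open_Int open_Collect_less continuous_intros open_nonzero)
  then have "\<forall>\<^sub>F z in nhds y. z \<in> {y. l < norm (y - x)} \<inter> - {0}"
    by (rule eventually_nhds_in_open) (use y in auto)
  then have "\<forall>\<^sub>F z in nhds y. u y - kelvin x l u y \<le> u z - kelvin x l u z"
    by eventually_elim (use ok eq in \<open>auto simp: sphere_ok_def\<close>)
  from has_lap_nonneg_at_local_min[OF k(2) this] k(1) show False by simp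
qed

text \<open>The difference \<open>w\<close> vanishes on the sphere, and its outward derivative there
  is \<open>2 / l\<close> times \<open>radial_rate\<close>; the Hopf bound makes it positive. At
  radius 0 the rate is \<open>(n - 2) / 2 * u x\<close>.\<close>

lemma radial_rate_pos_on_sphere:
  assumes l: "0 \<le> l" "l < norm x" and ok: "sphere_ok x l" and y: "norm (y - x) = l"
  shows "radial_rate x u y > 0"
proof (cases "l = 0")
  case True
  then have "y = x" "x \<noteq> 0" using y l by auto
  then show ?thesis using pos(1)[of x] N3 by (simp add: radial_rate_def)
next
  case False
  then have l0: "l > 0" using l by simp
  define N where "N = real CARD('n)"
  have N: "N > 2" using N3 by (simp add: N_def)
  define w where "w y = u y - kelvin x l u y" for y
  define \<rho> where "\<rho> = (l + norm x) / 2"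
  have \<rho>: "l < \<rho>" "\<rho> < norm x" using l by (auto simp: \<rho>_def)
  have nz: "z \<noteq> 0" if "norm (z - x) \<le> \<rho>" for z using that \<rho> by auto
  have cw: "continuous_on {y. l \<le> norm (y - x) \<and> y \<noteq> 0} w"
    unfolding w_def by (rule continuous_on_difference[OF l])
  have "\<exists>z\<in>sphere x \<rho>. \<forall>y\<in>sphere x \<rho>. w z \<le> w y"
  proof (rule continuous_attains_inf)
    show "sphere x \<rho> \<noteq> {}" using \<rho> l by simp
    show "continuous_on (sphere x \<rho>) w"
      by (rule continuous_on_subset[OF cw]) (use \<rho> nz in \<open>auto simp: dist_norm norm_minus_commute\<close>)
  qed simp
  then obtain z where z: "norm (z - x) = \<rho>" "\<And>y. norm (y - x) = \<rho> \<Longrightarrow> w z \<le> w y"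
    unfolding sphere_def by (auto simp: dist_norm norm_minus_commute)
  have wz: "w z > 0" using strict[OF l ok, of z] z \<rho> nz[of z] by (simp add: w_def)
  obtain c where c: "c > 0" "\<And>y. l \<le> norm (y - x) \<Longrightarrow> norm (y - x) \<le> \<rho> \<Longrightarrow>
     c * (l powr (2 - N) - norm (y - x) powr (2 - N)) \<le> w y"
  proof -
    have "\<exists>c>0. \<forall>y. l \<le> norm (y - x) \<and> norm (y - x) \<le> \<rho> \<longrightarrow>
       c * (l powr (2 - real CARD('n)) - norm (y - x) powr (2 - real CARD('n))) \<le> w y"
    proof (rule hopf_lower_bound[OF N3 l0 \<rho>(1) wz])
      show "continuous_on {y. l \<le> norm (y - x) \<and> norm (y - x) \<le> \<rho>} w"
        by (rule continuous_on_subset[OF cw]) (use nz in auto)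
      show "0 \<le> w y" if "l \<le> norm (y - x)" "norm (y - x) \<le> \<rho>" for y
        using ok nz that by (auto simp: sphere_ok_def w_def)
      show "w z \<le> w y" if "norm (y - x) = \<rho>" for y using z that by blast
      show "\<exists>k<0. has_lap w y k" if "l < norm (y - x)" "norm (y - x) < \<rho>" for y
        unfolding w_def using kelvin_difference_superharmonic[OF l that(1)] ok nz[of y] that
        by (auto simp: sphere_ok_def)
    qed
    then show thesis using that unfolding N_def by blast
  qed
  define \<theta> where "\<theta> = (1 / l) *\<^sub>R (y - x)"
  have \<theta>: "norm \<theta> = 1" using l0 y by (simp add: \<theta>_def)
  have yeq: "y = x + l *\<^sub>R \<theta>" using l0 by (simp add: \<theta>_def)
  define G where "G r = u (x + r *\<^sub>R \<theta>)" for r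
  define d where "d = (\<Sum>i\<in>UNIV. \<theta> $ i * partial u i y)"
  have yS: "x + l *\<^sub>R \<theta> \<in> - {0}" using nz[of y] y \<rho> yeq by auto
  have dG: "(G has_real_derivative d) (at l)"
    unfolding G_def d_def yeq by (rule radial_derivative[OF C2(1) open_nonzero yS])
  \<comment> \<open>\<open>W\<close> is \<open>w\<close> along the ray minus the Hopf barrier. It is
    0 at \<open>l\<close> and nonnegative to the right, so its derivative at \<open>l\<close> is
    nonnegative. The function and its inverted copy each contribute \<open>d\<close>, whence the
    factor 2 below.\<close>
  define W where "W r = G r - (l / r) powr (N - 2) * G (l\<^sup>2 / r) - c * (l powr (2 - N) - r powr (2 - N))" for r
  have W0: "W l = 0" using l0 by (simp add: W_def power2_eq_square)
  have W_nonneg: "W r \<ge> 0" if "l \<le> r" "r \<le> \<rho>" for r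
  proof -
    have nr: "norm ((x + r *\<^sub>R \<theta>) - x) = r" using \<theta> l0 that by simp
    have "kelvin x l u (x + r *\<^sub>R \<theta>) = (l / r) powr (N - 2) * G (l\<^sup>2 / r)"
      unfolding kelvin_def nr G_def N_def using l0 that by (simp add: power2_eq_square)
    then show ?thesis using c(2)[of "x + r *\<^sub>R \<theta>"] that unfolding nr by (simp add: W_def w_def G_def)
  qed
  have dWl: "(W has_real_derivative 2 * d + (N - 2) / l * G l - c * (N - 2) * l powr (1 - N)) (at l)"
  proof -
    have dq: "((\<lambda>r. l\<^sup>2 / r) has_real_derivative -1) (at l)"
      using l0 by (auto intro!: derivative_eq_intros simp: power2_eq_square)
    have l2: "l\<^sup>2 / l = l" using l0 by (simp add: power2_eq_square)
    have "(G has_real_derivative d) (at (l\<^sup>2 / l))" using dG l2 by simp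
    from DERIV_chain2[OF this dq] have dG2: "((\<lambda>r. G (l\<^sup>2 / r)) has_real_derivative - d) (at l)" by simp
    have dr: "((\<lambda>r. l / r) has_real_derivative - (1 / l)) (at l)"
      using l0 by (auto intro!: derivative_eq_intros simp: power2_eq_square)
    have dp: "((\<lambda>r. (l / r) powr (N - 2)) has_real_derivative - ((N - 2) / l)) (at l)"
      using DERIV_fun_powr[OF dr, of "N - 2"] l0 by simp
    have dk: "((\<lambda>r. r powr (2 - N)) has_real_derivative (2 - N) * l powr (1 - N)) (at l)"
      using has_real_derivative_powr[OF l0, of "2 - N"] by simp
    show ?thesis unfolding W_def
      by (rule DERIV_cong[OF DERIV_diff[OF DERIV_diff[OF dG DERIV_mult[OF dp dG2]] DERIV_cmult[OF DERIV_diff[OF DERIV_const dk]]]])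
         (use l0 in \<open>simp add: l2 algebra_simps\<close>)
  qed
  have "2 * d + (N - 2) / l * G l - c * (N - 2) * l powr (1 - N) \<ge> 0"
  proof (rule ccontr)
    assume "\<not> ?thesis"
    then obtain e where e: "e > 0" "\<And>h. h > 0 \<Longrightarrow> h < e \<Longrightarrow> W (l + h) < W l"
      using DERIV_neg_dec_right[OF dWl] by auto
    define h where "h = min e (\<rho> - l) / 2"
    have "h > 0" "2 * h \<le> e" "2 * h \<le> \<rho> - l" using e \<rho> by (simp_all add: h_def)
    then have "h > 0" "h < e" "l + h \<le> \<rho>" using e \<rho> by linarith+
    then show False using e(2)[of h] W0 W_nonneg[of "l + h"] by simp
  qed
  moreover have "c * (N - 2) * l powr (1 - N) > 0" using c N l0 by simp
  ultimately have "2 * d + (N - 2) / l * G l > 0" by linarith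
  then have "l / 2 * (2 * d + (N - 2) / l * G l) > 0" using l0 by simp
  moreover have "l / 2 * (2 * d + (N - 2) / l * G l) = radial_rate x u y"
  proof -
    have "(y - x) $ i = l * \<theta> $ i" for i using l0 by (simp add: \<theta>_def)
    then have "(\<Sum>i\<in>UNIV. (y - x) $ i * partial u i y) = l * d"
      by (simp add: d_def sum_distrib_left mult_ac)
    moreover have "l / 2 * (2 * d + (N - 2) / l * G l) = (N - 2) / 2 * G l + l * d"
      using l0 by (simp add: field_simps)
    moreover have "G l = u y" by (simp add: G_def yeq[symmetric])
    ultimately show ?thesis by (simp only: radial_rate_def N_def)
  qed
  ultimately show ?thesis by simp
qed

text \<open>Compactness of the sphere spreads positivity to a shell. For \<open>l > 0\<close> the
  shell has radii \<open>l - d\<close> and \<open>l + d\<close>, whose product is below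
  \<open>l\<^sup>2\<close>, as the Kelvin comparison requires; for \<open>l = 0\<close> it is a full
  ball.\<close>

lemma radial_rate_pos_near_sphere:
  assumes l: "0 \<le> l" "l < norm x" and ok: "sphere_ok x l"
  shows "\<exists>s \<rho>. 0 \<le> s \<and> l < \<rho> \<and> \<rho> < norm x \<and> s * \<rho> \<le> l\<^sup>2 \<and>
    (\<forall>y. s \<le> norm (y - x) \<longrightarrow> norm (y - x) \<le> \<rho> \<longrightarrow> radial_rate x u y > 0)"
proof -
  define U where "U = {y \<in> - {0}. radial_rate x u y > 0}"
  have U: "open U" unfolding U_def
    using continuous_open_preimage[OF continuous_on_radial_rate[OF C2(1)] open_nonzero, of "{0<..}"]
    by (simp add: vimage_def Int_def)
  have "sphere x l \<subseteq> U"
    using radial_rate_pos_on_sphere[OF l ok] l by (auto simp: U_def dist_norm norm_minus_commute)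
  then obtain e where e: "e > 0" "(\<Union>y\<in>sphere x l. ball y e) \<subseteq> U"
    using compact_subset_open_imp_ball_epsilon_subset[OF compact_sphere U] by blast
  \<comment> \<open>\<open>z\<close> is the radial projection of \<open>y\<close> onto the sphere.
    The centre has none unless \<open>l = 0\<close>, when the sphere consists of the centre
    alone.\<close>
  have near: "radial_rate x u y > 0" if y: "\<bar>norm (y - x) - l\<bar> < e" "y \<noteq> x \<or> l = 0" for y
  proof -
    define z where "z = x + (l / norm (y - x)) *\<^sub>R (y - x)"
    have "norm (z - x) = l" using y l by (auto simp: z_def)
    moreover have "dist z y = \<bar>norm (y - x) - l\<bar>"
    proof (cases "y = x")
      case False
      have "y - z = (1 - l / norm (y - x)) *\<^sub>R (y - x)" by (simp add: z_def algebra_simps)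
      then have "dist z y = \<bar>1 - l / norm (y - x)\<bar> * \<bar>norm (y - x)\<bar>" by (simp add: dist_norm norm_minus_commute)
      also have "\<dots> = \<bar>norm (y - x) - l\<bar>"
      proof -
        have "(1 - l / norm (y - x)) * norm (y - x) = norm (y - x) - l" using False by (simp add: left_diff_distrib)
        then show ?thesis unfolding abs_mult[symmetric] by (simp only:)
      qed
      finally show ?thesis .
    qed (use y in \<open>simp add: z_def\<close>)
    ultimately have "y \<in> U" using e(2) y(1) by (force simp: dist_norm norm_minus_commute)
    then show ?thesis by (simp add: U_def)
  qed
  show ?thesis
  proof (cases "l = 0")
    case True
    define \<rho> where "\<rho> = min e (norm x) / 2"
    have "0 < \<rho>" "\<rho> < e" "\<rho> < norm x" using e l True by (auto simp: \<rho>_def min_def)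
    then show ?thesis using True near by (intro exI[of _ 0] exI[of _ \<rho>]) auto
  next
    case False
    define d where "d = min (min e l) (norm x - l) / 2"
    have "0 < d" "2 * d \<le> e" "2 * d \<le> l" "2 * d \<le> norm x - l" using e l False by (simp_all add: d_def)
    then have d: "0 < d" "d < e" "d < l" "l + d < norm x" using e l by linarith+
    have "(l - d) * (l + d) \<le> l\<^sup>2" by (simp add: algebra_simps power2_eq_square)
    moreover have "radial_rate x u y > 0" if "l - d \<le> norm (y - x)" "norm (y - x) \<le> l + d" for y
      by (rule near) (use d that in auto)
    ultimately show ?thesis using d by (intro exI[of _ "l - d"] exI[of _ "l + d"]) auto
  qed
qed

text \<open>Close to the sphere the comparison for larger radii follows from radial monotonicity.
  Beyond \<rho> the old difference is at least \<open>c * norm (y - x) powr (2 - n)\<close>, which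
  has the same decay as the change of the Kelvin transform and so absorbs it uniformly up to
  infinity.\<close>

lemma extend_one:
  assumes l: "0 \<le> l" "l < norm x" and ok: "sphere_ok x l"
  shows "\<exists>\<epsilon>>0. \<forall>l' y. l \<le> l' \<longrightarrow> 0 < l' \<longrightarrow> l' < l + \<epsilon> \<longrightarrow> l' \<le> norm (y - x) \<longrightarrow> y \<noteq> 0 \<longrightarrow> kelvin x l' u y \<le> u y"
proof -
  define N where "N = real CARD('n)"
  obtain s \<rho> where s: "0 \<le> s" "l < \<rho>" "\<rho> < norm x" "s * \<rho> \<le> l\<^sup>2"
    and H: "\<And>y. s \<le> norm (y - x) \<Longrightarrow> norm (y - x) \<le> \<rho> \<Longrightarrow> radial_rate x u y > 0"
    using radial_rate_pos_near_sphere[OF l ok] by blast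
  define w where "w y = u y - kelvin x l u y" for y
  have nz: "z \<noteq> 0" if "norm (z - x) \<le> \<rho>" for z using that s by auto
  have cw: "continuous_on {y. l \<le> norm (y - x) \<and> y \<noteq> 0} w"
    unfolding w_def by (rule continuous_on_difference[OF l])
  have "\<exists>z\<in>sphere x \<rho>. \<forall>y\<in>sphere x \<rho>. w z \<le> w y"
  proof (rule continuous_attains_inf)
    show "sphere x \<rho> \<noteq> {}" using s l by simp
    show "continuous_on (sphere x \<rho>) w"
      by (rule continuous_on_subset[OF cw]) (use s nz in \<open>auto simp: dist_norm norm_minus_commute\<close>)
  qed simp
  then obtain z where z: "norm (z - x) = \<rho>" "\<And>y. norm (y - x) = \<rho> \<Longrightarrow> w z \<le> w y"
    unfolding sphere_def by (auto simp: dist_norm norm_minus_commute)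
  have wz: "w z > 0" using strict[OF l ok, of z] z s nz[of z] by (simp add: w_def)
  define c where "c = w z / \<rho> powr (2 - N)"
  have \<rho>0: "\<rho> > 0" using s l by simp
  have c: "c > 0" using wz \<rho>0 by (simp add: c_def)
  have c\<rho>: "c * \<rho> powr (2 - N) = w z" using \<rho>0 by (simp add: c_def)
  have low: "c * norm (y - x) powr (2 - N) \<le> w y" if "\<rho> \<le> norm (y - x)" "y \<noteq> 0" for y
    unfolding N_def
  proof (rule exterior_lower_bound[OF N3 \<rho>0 less_imp_le[OF c] _ _ _ _ that])
    show "continuous_on {y. \<rho> \<le> norm (y - x) \<and> y \<noteq> 0} w"
      by (rule continuous_on_subset[OF cw]) (use s in auto)
    show "0 \<le> w y" if "\<rho> \<le> norm (y - x)" "y \<noteq> 0" for y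
      using ok that s by (auto simp: sphere_ok_def w_def)
    show "c * \<rho> powr (2 - real CARD('n)) \<le> w y" if "norm (y - x) = \<rho>" for y
      using z(2)[OF that] c\<rho> by (simp add: N_def)
    show "\<exists>k<0. has_lap w y k" if "\<rho> < norm (y - x)" "y \<noteq> 0" for y
      unfolding w_def using kelvin_difference_superharmonic[OF l _ that(2)] ok that s
      by (auto simp: sphere_ok_def)
  qed
  obtain \<epsilon> where \<epsilon>: "\<epsilon> > 0" "\<And>l' y. l \<le> l' \<Longrightarrow> l' < l + \<epsilon> \<Longrightarrow> \<rho> \<le> norm (y - x) \<Longrightarrow>
     kelvin x l' u y - kelvin x l u y \<le> c * norm (y - x) powr (2 - N)"
    using kelvin_uniform_perturbation[OF N3 cont l(1) s(2,3) c] unfolding N_def by blast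
  have "kelvin x l' u y \<le> u y" if l': "l \<le> l'" "0 < l'" "l' < l + \<epsilon>" "l' \<le> norm (y - x)" and y: "y \<noteq> 0" for l' y
  proof (cases "\<rho> \<le> norm (y - x)")
    case True
    then show ?thesis using low[OF True y] \<epsilon>(2)[OF l'(1,3) True] by (simp add: w_def)
  next
    case False
    have "l\<^sup>2 \<le> l'\<^sup>2" using l l' by (intro power_mono) auto
    then have "s * \<rho> \<le> l'\<^sup>2" using s by linarith
    then show ?thesis
      by (intro kelvin_le_if_radial_monotone[OF C2(1) open_nonzero l'(2,4), of \<rho> s])
         (use False s H nz in \<open>auto intro: less_imp_le\<close>)
  qed
  then show ?thesis using \<epsilon>(1) by blast
qed

text \<open>Consider the infimum of the failing radii. The comparison holds there by continuity from
  below, or by positivity at radius 0, and then extends strictly past it for both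
  components.\<close>

lemma sphere_ok_all:
  assumes "0 \<le> l1" "l1 < norm x"
  shows "sphere_ok x l1"
proof (rule ccontr)
  interpret S: subcritical_system v u q \<mu>2 \<mu>1 \<beta> by (rule swapped)
  have ok_eq: "S.sphere_ok x l = sphere_ok x l" for l
    unfolding S.sphere_ok_def sphere_ok_def by (simp only: conj_commute)
  assume bad: "\<not> sphere_ok x l1"
  define B where "B = {l. 0 \<le> l \<and> l \<le> l1 \<and> \<not> sphere_ok x l}"
  define l where "l = Inf B"
  have "l1 \<in> B" using bad assms by (simp add: B_def)
  then have B: "B \<noteq> {}" by blast
  have lower: "l \<le> l'" if "l' \<in> B" for l'
    unfolding l_def by (rule cInf_lower[OF that]) (rule bdd_belowI[of _ 0], simp add: B_def)
  have l0: "0 \<le> l" unfolding l_def by (rule cInf_greatest[OF B]) (simp add: B_def)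
  have ll1: "l \<le> l1" by (rule lower[OF \<open>l1 \<in> B\<close>])
  then have lx: "l < norm x" using assms by simp
  have below: "sphere_ok x l'" if "0 \<le> l'" "l' < l" for l'
  proof (rule ccontr)
    assume "\<not> sphere_ok x l'"
    then have "l' \<in> B" using that ll1 by (simp add: B_def)
    then show False using lower[of l'] that by simp
  qed
  have okl: "sphere_ok x l"
  proof (cases "l = 0")
    case True
    then show ?thesis unfolding sphere_ok_def by (simp add: kelvin_0[OF N3] less_imp_le[OF pos(1)] less_imp_le[OF pos(2)])
  next
    case False
    show ?thesis unfolding sphere_ok_def
    proof (intro allI impI)
      fix y assume y: "l \<le> norm (y - x)" "y \<noteq> 0"
      have lpos: "0 < l" using l0 False by simp
      have yx: "y \<noteq> x" using y(1) lpos by auto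
      have nz: "x + (l / norm (y - x))\<^sup>2 *\<^sub>R (y - x) \<noteq> 0" by (rule kelvin_point_nonzero[OF l0 lx y(1)])
      have le: "kelvin x l' u y \<le> u y" "kelvin x l' v y \<le> v y" if "0 < l'" "l' < l" for l'
      proof -
        have "sphere_ok x l'" by (rule below) (use that in auto)
        moreover have "l' \<le> norm (y - x)" using that y by simp
        ultimately show "kelvin x l' u y \<le> u y" "kelvin x l' v y \<le> v y"
          using y(2) unfolding sphere_ok_def by blast+
      qed
      show "kelvin x l u y \<le> u y \<and> kelvin x l v y \<le> v y"
        by (rule conjI; rule kelvin_le_at_left_limit[OF _ lpos yx nz])
           (rule cont S.cont le; assumption)+
    qed
  qed
  obtain \<epsilon>1 where \<epsilon>1: "\<epsilon>1 > 0" "\<And>l' y. l \<le> l' \<Longrightarrow> 0 < l' \<Longrightarrow> l' < l + \<epsilon>1 \<Longrightarrow> l' \<le> norm (y - x) \<Longrightarrow> y \<noteq> 0 \<Longrightarrow> kelvin x l' u y \<le> u y"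
    using extend_one[OF l0 lx okl] by blast
  obtain \<epsilon>2 where \<epsilon>2: "\<epsilon>2 > 0" "\<And>l' y. l \<le> l' \<Longrightarrow> 0 < l' \<Longrightarrow> l' < l + \<epsilon>2 \<Longrightarrow> l' \<le> norm (y - x) \<Longrightarrow> y \<noteq> 0 \<Longrightarrow> kelvin x l' v y \<le> v y"
    using S.extend_one[OF l0 lx okl[folded ok_eq]] by blast
  have "l + min \<epsilon>1 \<epsilon>2 \<le> Inf B"
  proof (rule cInf_greatest[OF B])
    fix l' assume l': "l' \<in> B"
    show "l + min \<epsilon>1 \<epsilon>2 \<le> l'"
    proof (rule ccontr)
      assume "\<not> ?thesis"
      then have lt: "l' < l + \<epsilon>1" "l' < l + \<epsilon>2" by auto
      have ll: "l \<le> l'" by (rule lower[OF l'])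
      moreover have "l' \<noteq> l" using l' okl by (auto simp: B_def)
      ultimately have "l' > 0" using l0 by linarith
      then have "sphere_ok x l'" unfolding sphere_ok_def using \<epsilon>1(2)[OF ll _ lt(1)] \<epsilon>2(2)[OF ll _ lt(2)] by blast
      then show False using l' by (simp add: B_def)
    qed
  qed
  then show False using \<epsilon>1(1) \<epsilon>2(1) by (simp add: l_def)
qed

section \<open>Spheres through the origin, reflections and radial symmetry\<close>

text \<open>The limit of growing radii is allowed because the inverted point still avoids the
  origin: it could only be 0 if \<open>y\<close> lay on the sphere, but then inversion fixes
  \<open>y\<close>, which is nonzero.\<close>

lemma kelvin_le_full:
  assumes "x \<noteq> 0" "y \<noteq> 0" "norm x \<le> norm (y - x)"
  shows "kelvin x (norm x) u y \<le> u y"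
proof (rule kelvin_le_at_left_limit[OF cont])
  show "y \<noteq> x" using assms by auto
  show "x + (norm x / norm (y - x))\<^sup>2 *\<^sub>R (y - x) \<noteq> 0"
  proof
    assume z: "x + (norm x / norm (y - x))\<^sup>2 *\<^sub>R (y - x) = 0"
    then have "norm x = norm ((norm x / norm (y - x))\<^sup>2 *\<^sub>R (y - x))" by (metis add_eq_0_iff norm_minus_cancel)
    also have "\<dots> = (norm x)\<^sup>2 / norm (y - x)"
      using \<open>y \<noteq> x\<close> by (simp add: power2_eq_square)
    finally have "norm x * norm (y - x) = norm x * norm x"
      using \<open>y \<noteq> x\<close> by (simp add: power2_eq_square field_simps)
    then have "norm (y - x) = norm x" using assms(1) by simp
    then have "x + (y - x) = 0" using z assms(1) by simp
    then show False using assms(2) by simp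
  qed
  show "kelvin x l' u y \<le> u y" if "0 < l'" "l' < norm x" for l'
    using sphere_ok_all[of l' x] that assms by (auto simp: sphere_ok_def)
qed (use assms in simp)

lemma reflection_le:
  assumes e: "norm e = 1" and y: "y \<noteq> 0" "y \<bullet> e \<le> 0"
  shows "u (y - (2 * (y \<bullet> e)) *\<^sub>R e) \<le> u y"
proof -
  define D where "D R = (norm (y - R *\<^sub>R e))\<^sup>2" for R
  have ee: "e \<bullet> e = 1" using e by (simp add: norm_eq_1)
  have D: "D R = R\<^sup>2 - 2 * R * (y \<bullet> e) + (norm y)\<^sup>2" for R
    unfolding D_def power2_norm_eq_inner
    by (simp add: inner_diff_left inner_diff_right inner_commute ee power2_eq_square algebra_simps)
  \<comment> \<open>Here \<open>y \<bullet> e \<le> 0\<close> enters: \<open>y\<close> lies in no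
    open ball of radius \<open>R\<close> about \<open>R *\<^sub>R e\<close>.\<close>
  have DR: "R\<^sup>2 \<le> D R" if "R > 0" for R
  proof -
    have "2 * R * (y \<bullet> e) \<le> 0" using that y(2) by (intro mult_nonneg_nonpos) auto
    then show ?thesis unfolding D using zero_le_power2[of "norm y"] by linarith
  qed
  \<comment> \<open>This is the inverted point with its parts of order \<open>R\<close> cancelled by
    hand; the remaining coefficients converge since \<open>R\<^sup>2 / D R\<close> tends to
    1.\<close>
  define P where "P R = y - (2 * (R\<^sup>2 / D R) * (y \<bullet> e)) *\<^sub>R e + (R * (norm y)\<^sup>2 / D R) *\<^sub>R e - (1 - R\<^sup>2 / D R) *\<^sub>R y" for R
  have le: "(R\<^sup>2 / D R) powr ((real CARD('n) - 2) / 2) * u (P R) \<le> u y" if R: "R > 0" for R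
  proof -
    have nR: "norm (R *\<^sub>R e) = R" using R e by simp
    have DRp: "D R > 0" using DR[OF R] R by (meson less_le_trans zero_less_power)
    have n: "norm (y - R *\<^sub>R e) = sqrt (D R)" by (simp add: D_def)
    have "R *\<^sub>R e \<noteq> 0" using R e by auto
    moreover have "R \<le> norm (y - R *\<^sub>R e)" unfolding n using DR[OF R] by (simp add: real_le_rsqrt)
    ultimately have "kelvin (R *\<^sub>R e) R u y \<le> u y" using kelvin_le_full[of "R *\<^sub>R e" y] y nR by simp
    moreover have "(R / norm (y - R *\<^sub>R e))\<^sup>2 = R\<^sup>2 / D R" by (simp add: power_divide D_def)
    moreover have "(R / norm (y - R *\<^sub>R e)) powr (real CARD('n) - 2) = (R\<^sup>2 / D R) powr ((real CARD('n) - 2) / 2)"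
    proof -
      have "R\<^sup>2 / D R = (R / norm (y - R *\<^sub>R e)) powr 2"
        using R by (simp add: power_divide D_def)
      then have "(R\<^sup>2 / D R) powr ((real CARD('n) - 2) / 2) = (R / norm (y - R *\<^sub>R e)) powr (2 * ((real CARD('n) - 2) / 2))"
        by (simp only: powr_powr)
      moreover have "2 * ((real CARD('n) - 2) / 2) = real CARD('n) - 2" by simp
      ultimately show ?thesis by (simp only:)
    qed
    moreover have "R *\<^sub>R e + (R\<^sup>2 / D R) *\<^sub>R (y - R *\<^sub>R e) = P R"
    proof -
      have "R - R\<^sup>2 / D R * R = R * (norm y)\<^sup>2 / D R - 2 * (R\<^sup>2 / D R) * (y \<bullet> e)"
      proof -
        have "R - R\<^sup>2 / D R * R = R * (D R - R\<^sup>2) / D R" using DRp by (simp add: field_simps)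
        also have "D R - R\<^sup>2 = (norm y)\<^sup>2 - 2 * R * (y \<bullet> e)" unfolding D by simp
        finally show ?thesis by (simp add: right_diff_distrib diff_divide_distrib power2_eq_square)
      qed
      then have "(R - R\<^sup>2 / D R * R) *\<^sub>R e = (R * (norm y)\<^sup>2 / D R) *\<^sub>R e - (2 * (R\<^sup>2 / D R) * (y \<bullet> e)) *\<^sub>R e"
        by (simp add: scaleR_diff_left)
      then show ?thesis by (simp add: P_def algebra_simps)
    qed
    ultimately show ?thesis unfolding kelvin_def by simp
  qed
  have lim1: "((\<lambda>R. R\<^sup>2 / D R) \<longlongrightarrow> 1) at_top"
  proof (rule Lim_transform_eventually)
    have i: "((\<lambda>R::real. inverse R) \<longlongrightarrow> 0) at_top" by (rule tendsto_inverse_0_at_top[OF filterlim_ident])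
    have "((\<lambda>R. 1 / (1 - 2 * (y \<bullet> e) * inverse R + (norm y)\<^sup>2 * (inverse R)\<^sup>2)) \<longlongrightarrow> 1 / (1 - 2 * (y \<bullet> e) * 0 + (norm y)\<^sup>2 * 0\<^sup>2)) at_top"
      by (intro tendsto_intros i) simp
    then show "((\<lambda>R. 1 / (1 - 2 * (y \<bullet> e) * inverse R + (norm y)\<^sup>2 * (inverse R)\<^sup>2)) \<longlongrightarrow> 1) at_top" by simp
    show "\<forall>\<^sub>F R in at_top. 1 / (1 - 2 * (y \<bullet> e) * inverse R + (norm y)\<^sup>2 * (inverse R)\<^sup>2) = R\<^sup>2 / D R"
      using eventually_gt_at_top[of 0]
    proof eventually_elim
      case (elim R)
      have "1 - 2 * (y \<bullet> e) * inverse R + (norm y)\<^sup>2 * (inverse R)\<^sup>2 = D R / R\<^sup>2"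
        using elim unfolding D by (simp add: field_simps power2_eq_square)
      then show ?case by simp
    qed
  qed
  have lim2: "((\<lambda>R. R * (norm y)\<^sup>2 / D R) \<longlongrightarrow> 0) at_top"
  proof (rule Lim_transform_eventually)
    have i: "((\<lambda>R::real. inverse R) \<longlongrightarrow> 0) at_top" by (rule tendsto_inverse_0_at_top[OF filterlim_ident])
    have "((\<lambda>R. (norm y)\<^sup>2 * inverse R * (R\<^sup>2 / D R)) \<longlongrightarrow> (norm y)\<^sup>2 * 0 * 1) at_top"
      by (intro tendsto_mult tendsto_const i lim1)
    then show "((\<lambda>R. (norm y)\<^sup>2 * inverse R * (R\<^sup>2 / D R)) \<longlongrightarrow> 0) at_top" by simp
    show "\<forall>\<^sub>F R in at_top. (norm y)\<^sup>2 * inverse R * (R\<^sup>2 / D R) = R * (norm y)\<^sup>2 / D R"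
      using eventually_gt_at_top[of 0] by eventually_elim (simp add: power2_eq_square)
  qed
  have "(P \<longlongrightarrow> y - (2 * 1 * (y \<bullet> e)) *\<^sub>R e + 0 *\<^sub>R e - (1 - 1) *\<^sub>R y) at_top"
    unfolding P_def by (intro tendsto_intros lim1 lim2)
  then have P: "(P \<longlongrightarrow> y - (2 * (y \<bullet> e)) *\<^sub>R e) at_top" by simp
  have "y - (2 * (y \<bullet> e)) *\<^sub>R e \<noteq> 0"
  proof
    assume z: "y - (2 * (y \<bullet> e)) *\<^sub>R e = 0"
    then have "y \<bullet> e - 2 * (y \<bullet> e) * (e \<bullet> e) = 0" by (metis inner_diff_left inner_scaleR_left inner_zero_left)
    then have "y \<bullet> e = 0" by (simp add: ee)
    then show False using z y by simp
  qed
  then have "isCont u (y - (2 * (y \<bullet> e)) *\<^sub>R e)"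
    by (rule isCont_if_nonzero[OF cont])
  then have "((\<lambda>R. (R\<^sup>2 / D R) powr ((real CARD('n) - 2) / 2) * u (P R)) \<longlongrightarrow> 1 powr ((real CARD('n) - 2) / 2) * u (y - (2 * (y \<bullet> e)) *\<^sub>R e)) at_top"
    by (intro tendsto_intros lim1 isCont_tendsto_compose[of _ u] P) auto
  then have "1 powr ((real CARD('n) - 2) / 2) * u (y - (2 * (y \<bullet> e)) *\<^sub>R e) \<le> u y"
  proof (rule tendsto_upperbound)
    show "\<forall>\<^sub>F R in at_top. (R\<^sup>2 / D R) powr ((real CARD('n) - 2) / 2) * u (P R) \<le> u y"
      using eventually_gt_at_top[of 0] by eventually_elim (rule le)
  qed simp
  then show ?thesis by simp
qed

text \<open>For points of equal norm, the reflection along the direction from \<open>y\<close> to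
  \<open>z\<close> exchanges them, and \<open>y\<close> lies on the admissible side. Exchanging the
  roles gives the reverse inequality.\<close>

theorem radially_symmetric:
  assumes "norm y = norm z" "y \<noteq> 0"
  shows "u y = u z"
proof -
  have one: "u z \<le> u y" if yz: "norm y = norm z" "y \<noteq> 0" "y \<noteq> z" for y z
  proof -
    define e where "e = (1 / norm (z - y)) *\<^sub>R (z - y)"
    have nzy: "norm (z - y) > 0" using yz by simp
    have "norm e = 1" using nzy by (simp add: e_def)
    have sq: "(norm (z - y))\<^sup>2 = 2 * (y \<bullet> y - y \<bullet> z)"
      using yz(1) unfolding power2_norm_eq_inner norm_eq
      by (simp add: inner_diff_left inner_diff_right inner_commute)
    have "y \<bullet> e = (y \<bullet> z - y \<bullet> y) / norm (z - y)" by (simp add: e_def inner_diff_right)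
    then have "y \<bullet> e * norm (z - y) = y \<bullet> z - y \<bullet> y" using nzy by simp
    then have "(2 * (y \<bullet> e) + norm (z - y)) * norm (z - y) = 0" using sq by (simp add: algebra_simps power2_eq_square)
    then have ye: "2 * (y \<bullet> e) = - norm (z - y)" using nzy by simp
    then have "y \<bullet> e \<le> 0" by (smt (verit) norm_ge_zero)
    from reflection_le[OF \<open>norm e = 1\<close> yz(2) this]
    have "u (y - (2 * (y \<bullet> e)) *\<^sub>R e) \<le> u y" .
    moreover have "y - (2 * (y \<bullet> e)) *\<^sub>R e = z" unfolding ye using nzy by (simp add: e_def)
    ultimately show ?thesis by simp
  qed
  have "z \<noteq> 0" using assms by auto
  then show ?thesis using one[of y z] one[of z y] assms by (cases "y = z") (auto intro: antisym)
qed

end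

section \<open>Reduction to the Emden system\<close>

text \<open>The axis is arbitrary but fixed, so that the same definition applied to the partial
  derivatives along it gives the radial derivatives, although those partials are not radial
  functions.\<close>

definition profile :: "(real^'n \<Rightarrow> real) \<Rightarrow> real \<Rightarrow> real" where
  "profile w r = w (r *\<^sub>R axis (SOME i. True) 1)"

definition emden_var :: "real \<Rightarrow> (real^'n \<Rightarrow> real) \<Rightarrow> real \<Rightarrow> real" where
  "emden_var q w t = exp (t / q) * profile w (exp t)"

definition emden_var1 :: "real \<Rightarrow> (real^'n \<Rightarrow> real) \<Rightarrow> real \<Rightarrow> real" where
  "emden_var1 q w t = emden_var q w t / q + exp (t / q) * (exp t * profile (partial w (SOME i. True)) (exp t))"

lemma norm_axis_plus_axis:
  assumes "i \<noteq> (k :: 'n :: finite)"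
  shows "norm (r *\<^sub>R axis k 1 + t *\<^sub>R axis i 1 :: real^'n) = sqrt (r\<^sup>2 + t\<^sup>2)"
  using assms unfolding norm_eq_sqrt_inner
  by (simp add: inner_add_left inner_add_right inner_axis_axis power2_eq_square)

context subcritical_system
begin

lemma eq_profile:
  assumes "x \<noteq> 0"
  shows "u x = profile u (norm x)"
  unfolding profile_def using assms by (intro radially_symmetric) (auto simp: norm_axis_1)

lemma profile_derivatives:
  fixes k :: 'n
  defines "k \<equiv> SOME i. True"
  assumes r: "r > 0"
  shows "(profile u has_real_derivative profile (partial u k) r) (at r)"
    and "(profile (partial u k) has_real_derivative profile (partial (partial u k) k) r) (at r)"
proof -
  have nz: "(0 :: real^'n) + r *\<^sub>R axis k 1 \<in> - {0}" using r by (simp add: axis_eq_0_iff)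
  show "(profile u has_real_derivative profile (partial u k) r) (at r)"
    using partial_has_derivative_shift[OF C2_onD(4)[OF C2(1) nz, of k]]
    unfolding profile_def[abs_def] k_def by simp
  show "(profile (partial u k) has_real_derivative profile (partial (partial u k) k) r) (at r)"
    using partial_has_derivative_shift[OF C2_onD(5)[OF C2(1) nz, of k k]]
    unfolding profile_def[abs_def] k_def by simp
qed

text \<open>On a line orthogonal to the radius, \<open>u\<close> is its profile at
  \<open>sqrt (r\<^sup>2 + t\<^sup>2)\<close>. Each of the \<open>n - 1\<close> such directions
  contributes \<open>1 / r\<close> times the radial derivative to the Laplacian.\<close>

lemma tangential_second_partial:
  fixes k :: 'n
  defines "k \<equiv> SOME i. True"
  assumes r: "r > 0" and i: "i \<noteq> k"
  shows "partial (partial u i) i (r *\<^sub>R axis k 1) = profile (partial u k) r / r"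
proof -
  define x where "x = r *\<^sub>R (axis k 1 :: real^'n)"
  define R where "R t = sqrt (r\<^sup>2 + t\<^sup>2)" for t
  have Rpos: "R t > 0" for t unfolding R_def using r by (intro real_sqrt_gt_zero add_pos_nonneg) auto
  have nR: "norm (x + t *\<^sub>R axis i 1) = R t" for t
    unfolding x_def R_def by (rule norm_axis_plus_axis[OF i])
  have nz: "x + t *\<^sub>R axis i 1 \<in> - {0}" for t using nR[of t] Rpos[of t] by auto
  have ueq: "u (x + t *\<^sub>R axis i 1) = profile u (R t)" for t
    using eq_profile[of "x + t *\<^sub>R axis i 1"] nz[of t] nR[of t] by simp
  have dR: "(R has_real_derivative t / R t) (at t)" for t
  proof -
    have "r\<^sup>2 + t\<^sup>2 > 0" using r by (intro add_pos_nonneg) auto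
    then show ?thesis unfolding R_def[abs_def] by (auto intro!: derivative_eq_intros simp: field_simps)
  qed
  have p1: "partial u i (x + t *\<^sub>R axis i 1) = profile (partial u k) (R t) * (t / R t)" for t
  proof (rule DERIV_unique)
    show "((\<lambda>t. u (x + t *\<^sub>R axis i 1)) has_real_derivative partial u i (x + t *\<^sub>R axis i 1)) (at t)"
      by (rule partial_has_derivative_shift[OF C2_onD(4)[OF C2(1) nz]])
    show "((\<lambda>t. u (x + t *\<^sub>R axis i 1)) has_real_derivative profile (partial u k) (R t) * (t / R t)) (at t)"
      unfolding ueq using DERIV_chain2[OF profile_derivatives(1)[OF Rpos] dR] unfolding k_def .
  qed
  have R0: "R 0 = r" using r by (simp add: R_def)
  show ?thesis unfolding x_def[symmetric]
  proof (rule DERIV_unique)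
    have x0: "x \<in> - {0}" using nz[of 0] by simp
    show "((\<lambda>t. partial u i (x + t *\<^sub>R axis i 1)) has_real_derivative partial (partial u i) i x) (at 0)"
      by (rule partial_has_derivative[OF C2_onD(5)[OF C2(1) x0]])
    have d1: "((\<lambda>t. profile (partial u k) (R t)) has_real_derivative profile (partial (partial u k) k) (R 0) * (0 / R 0)) (at 0)"
      using DERIV_chain2[OF profile_derivatives(2)[OF Rpos] dR] unfolding k_def .
    have d2: "((\<lambda>t. t / R t) has_real_derivative 1 / r) (at 0)"
      using DERIV_divide[OF DERIV_ident dR, of 0] Rpos[of 0] R0 by simp
    show "((\<lambda>t. partial u i (x + t *\<^sub>R axis i 1)) has_real_derivative profile (partial u k) r / r) (at 0)"
      unfolding p1 using DERIV_mult[OF d1 d2] by (simp add: R0)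
  qed
qed

lemma profile_equation:
  assumes r: "r > 0"
  shows "profile (partial (partial u (SOME i. True)) (SOME i. True)) r
    + (real CARD('n) - 1) * (profile (partial u (SOME i. True)) r / r) = - nl \<mu>1 \<beta> q (profile u r) (profile v r)"
proof -
  define k :: 'n where "k = (SOME i. True)"
  define x where "x = r *\<^sub>R (axis k 1 :: real^'n)"
  have x: "x \<noteq> 0" using r by (simp add: x_def axis_eq_0_iff)
  have "laplacian u x = partial (partial u k) k x + (\<Sum>i\<in>UNIV - {k}. partial (partial u i) i x)"
    unfolding laplacian_def by (rule sum.remove) auto
  also have "(\<Sum>i\<in>UNIV - {k}. partial (partial u i) i x) = (\<Sum>i\<in>UNIV - {k}. profile (partial u k) r / r)"
    unfolding x_def k_def by (intro sum.cong refl tangential_second_partial r) auto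
  also have "\<dots> = (real CARD('n) - 1) * (profile (partial u k) r / r)"
    using N3 by (simp add: card_Diff_singleton of_nat_diff)
  finally show ?thesis using lap[OF x] by (simp add: x_def k_def profile_def)
qed

lemma emden_var_pos: "emden_var q u t > 0"
  unfolding emden_var_def profile_def by (intro mult_pos_pos pos) (auto simp: axis_eq_0_iff)

lemma emden_derivatives:
  fixes \<gamma> :: real
  defines "\<gamma> \<equiv> real CARD('n) - 2 - 1 / q"
  shows "(emden_var q u has_real_derivative emden_var1 q u t) (at t)"
    and "(emden_var1 q u has_real_derivative
      (1 / q - \<gamma>) * emden_var1 q u t + 1 / q * \<gamma> * emden_var q u t - nl \<mu>1 \<beta> q (emden_var q u t) (emden_var q v t)) (at t)"
proof -
  interpret S: subcritical_system v u q \<mu>2 \<mu>1 \<beta> by (rule swapped)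
  define \<alpha> where "\<alpha> = 1 / q"
  define N where "N = real CARD('n)"
  define k :: 'n where "k = (SOME i. True)"
  define P where "P = profile u"
  define P1 where "P1 = profile (partial u k)"
  define P2 where "P2 = profile (partial (partial u k) k)"
  have dP: "((\<lambda>t. P (exp t)) has_real_derivative P1 (exp t) * exp t) (at t)" for t
    using DERIV_chain2[OF profile_derivatives(1)[OF exp_gt_zero] DERIV_exp] unfolding P_def P1_def k_def .
  have dP1: "((\<lambda>t. P1 (exp t)) has_real_derivative P2 (exp t) * exp t) (at t)" for t
    using DERIV_chain2[OF profile_derivatives(2)[OF exp_gt_zero] DERIV_exp] unfolding P1_def P2_def k_def .
  have ev: "emden_var q u = (\<lambda>t. exp (\<alpha> * t) * P (exp t))"
    unfolding emden_var_def P_def \<alpha>_def by (simp add: fun_eq_iff)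
  have ev1: "emden_var1 q u = (\<lambda>t. \<alpha> * (exp (\<alpha> * t) * P (exp t)) + exp (\<alpha> * t) * (exp t * P1 (exp t)))"
    unfolding emden_var1_def ev P1_def k_def \<alpha>_def by (simp add: fun_eq_iff)
  have dexp: "((\<lambda>t. exp (\<alpha> * t)) has_real_derivative \<alpha> * exp (\<alpha> * t)) (at t)" for t
    by (auto intro!: derivative_eq_intros)
  show d: "(emden_var q u has_real_derivative emden_var1 q u t) (at t)" for t
    unfolding ev ev1 by (rule DERIV_cong[OF DERIV_mult[OF dexp dP]]) (simp add: algebra_simps)
  have A: "(emden_var1 q u has_real_derivative
     \<alpha> * emden_var1 q u t + (\<alpha> * exp (\<alpha> * t) * (exp t * P1 (exp t)) + (exp t * P1 (exp t) + P2 (exp t) * exp t * exp t) * exp (\<alpha> * t))) (at t)"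
  proof -
    have "emden_var1 q u = (\<lambda>t. \<alpha> * emden_var q u t + exp (\<alpha> * t) * (exp t * P1 (exp t)))"
      unfolding ev1 ev ..
    then show ?thesis
      using DERIV_add[OF DERIV_cmult[OF d, of \<alpha>] DERIV_mult[OF dexp DERIV_mult[OF DERIV_exp dP1]]] by simp
  qed
  have B: "P2 (exp t) = - ((N - 1) * (P1 (exp t) / exp t)) - nl \<mu>1 \<beta> q (profile u (exp t)) (profile v (exp t))"
    using profile_equation[OF exp_gt_zero, of t] unfolding P1_def P2_def k_def N_def by linarith
  \<comment> \<open>Since \<open>(2 * q + 1) / q = 2 + 1 / q\<close>, the nonlinearity scales like
    the second \<open>t\<close>-derivative, so no explicit \<open>t\<close> remains in the
    equation.\<close>
  have C: "nl \<mu>1 \<beta> q (emden_var q u t) (emden_var q v t) = exp t * exp t * exp (\<alpha> * t) * nl \<mu>1 \<beta> q (profile u (exp t)) (profile v (exp t))"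
  proof -
    have "exp (t / q) powr (2 * q + 1) = exp t * exp t * exp (\<alpha> * t)"
      using par(4) by (simp add: exp_powr_real \<alpha>_def mult_exp_exp field_simps)
    moreover have "profile u (exp t) > 0" "profile v (exp t) > 0"
      unfolding profile_def by (intro pos; simp add: axis_eq_0_iff)+
    ultimately show ?thesis unfolding emden_var_def by (simp add: nl_scale)
  qed
  have D: "exp (\<alpha> * t) * (exp t * P1 (exp t)) = emden_var1 q u t - \<alpha> * emden_var q u t"
    unfolding ev ev1 by simp
  show "(emden_var1 q u has_real_derivative
      (1 / q - \<gamma>) * emden_var1 q u t + 1 / q * \<gamma> * emden_var q u t - nl \<mu>1 \<beta> q (emden_var q u t) (emden_var q v t)) (at t)"
  proof -
    define w where "w = exp (\<alpha> * t) * (exp t * P1 (exp t))"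
    define F where "F = nl \<mu>1 \<beta> q (profile u (exp t)) (profile v (exp t))"
    have "P2 (exp t) * exp t * exp t * exp (\<alpha> * t) = - (N - 1) * w - exp t * exp t * exp (\<alpha> * t) * F"
    proof -
      define X where "X = P1 (exp t) / exp t"
      have "P1 (exp t) = X * exp t" by (simp add: X_def)
      then show ?thesis unfolding B F_def[symmetric] w_def X_def[symmetric] by (simp add: algebra_simps)
    qed
    then have "\<alpha> * exp (\<alpha> * t) * (exp t * P1 (exp t)) + (exp t * P1 (exp t) + P2 (exp t) * exp t * exp t) * exp (\<alpha> * t)
      = \<alpha> * w + w - (N - 1) * w - exp t * exp t * exp (\<alpha> * t) * F"
      unfolding w_def by (simp add: algebra_simps)
    with A have "(emden_var1 q u has_real_derivative
        \<alpha> * emden_var1 q u t + (\<alpha> * w + w - (N - 1) * w - exp t * exp t * exp (\<alpha> * t) * F)) (at t)"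
      by (simp only:)
    moreover have "emden_var1 q u t = w + \<alpha> * emden_var q u t" using D unfolding w_def by simp
    ultimately show ?thesis
      unfolding C F_def[symmetric] \<gamma>_def N_def[symmetric] \<alpha>_def[symmetric]
      by (elim DERIV_cong) (simp add: algebra_simps)
  qed
qed

end

section \<open>Translation between decay in space and Emden variables\<close>

lemma semi_singular_inf_commute: "semi_singular_inf p u v \<longleftrightarrow> semi_singular_inf p v u"
  unfolding semi_singular_inf_def by (subst disj_commute) (rule refl)

locale exterior_system = subcritical_system u v q \<mu>1 \<mu>2 \<beta>
  for u v :: "real^'n \<Rightarrow> real" and q \<mu>1 \<mu>2 \<beta> :: real +
  assumes supercritical: "real CARD('n) / (real CARD('n) - 2) < 2 * q + 1"
begin

text \<open>The two bounds on \<open>p\<close> are the two bounds on \<gamma>: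
  \<open>n / (n - 2) < p\<close> says \<open>\<gamma> > 0\<close>, and
  \<open>p < (n + 2) / (n - 2)\<close> says \<open>\<gamma> < 1 / q\<close>, the sign for which the
  energy increases.\<close>

sublocale E: emden_system "emden_var q u" "emden_var1 q u" "emden_var q v" "emden_var1 q v" \<mu>1 \<mu>2 \<beta> q "1 / q" "real CARD('n) - 2 - 1 / q"
proof -
  interpret S: subcritical_system v u q \<mu>2 \<mu>1 \<beta> by (rule swapped)
  have N: "real CARD('n) - 2 > 0" using N3 by simp
  have "0 < real CARD('n) - 2 - 1 / q"
    using supercritical N par by (simp add: field_simps)
  moreover have "real CARD('n) - 2 - 1 / q < 1 / q"
  proof -
    have "(2 * q + 1) * (real CARD('n) - 2) < real CARD('n) + 2" using subcritical N by (simp add: pos_less_divide_eq)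
    then have "(real CARD('n) - 2) * q < 2" by (simp add: algebra_simps)
    then have "real CARD('n) - 2 < 2 / q" using par by (simp add: pos_less_divide_eq)
    then show ?thesis by simp
  qed
  ultimately show "emden_system (emden_var q u) (emden_var1 q u) (emden_var q v) (emden_var1 q v) \<mu>1 \<mu>2 \<beta> q (1 / q) (real CARD('n) - 2 - 1 / q)"
    by unfold_locales (use par emden_var_pos S.emden_var_pos emden_derivatives S.emden_derivatives in auto)
qed

lemma exterior_swapped: "exterior_system v u q \<mu>2 \<mu>1 \<beta>"
  by (intro exterior_system.intro swapped exterior_system_axioms.intro supercritical)

lemma eq_emden_var:
  assumes "x \<noteq> 0"
  shows "u x = norm x powr - (1 / q) * emden_var q u (ln (norm x))"
  using assms eq_profile[OF assms]
  by (simp add: emden_var_def powr_def exp_minus field_simps flip: exp_add)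

lemma exp_ln_norm:
  assumes "x \<noteq> 0"
  shows "norm x powr - (1 / q) * exp (- (real CARD('n) - 2 - 1 / q) * ln (norm x)) = norm (x :: real^'n) powr - (real CARD('n) - 2)"
  using assms by (simp add: powr_def algebra_simps flip: exp_add)

lemma upper: "\<exists>C>0. \<forall>x. x \<noteq> 0 \<longrightarrow> u x \<le> C * norm x powr - (1 / q)"
proof -
  obtain M where M: "M > 0" "\<And>t. emden_var q u t \<le> M" using E.bounded_a by blast
  then show ?thesis by (intro exI[of _ M]) (auto simp: eq_emden_var mult.commute[of M] intro!: mult_left_mono)
qed

lemma fast_upper:
  assumes "E.fast (emden_var q u)"
  shows "\<exists>C>0. \<forall>x. norm x \<ge> 1 \<longrightarrow> u x \<le> C * norm x powr - (real CARD('n) - 2)"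
proof -
  obtain K where K: "K > 0" "\<And>t. t \<ge> 0 \<Longrightarrow> emden_var q u t \<le> K * exp (- (real CARD('n) - 2 - 1 / q) * t)"
    using E.fast_global[OF assms] by blast
  have "u x \<le> K * norm x powr - (real CARD('n) - 2)" if "norm x \<ge> 1" for x
  proof -
    have x: "x \<noteq> 0" using that by auto
    have "u x \<le> norm x powr - (1 / q) * (K * exp (- (real CARD('n) - 2 - 1 / q) * ln (norm x)))"
      unfolding eq_emden_var[OF x] using that by (intro mult_left_mono K) auto
    also have "\<dots> = K * norm x powr - (real CARD('n) - 2)" unfolding exp_ln_norm[OF x, symmetric] by simp
    finally show ?thesis .
  qed
  then show ?thesis using K by blast
qed

lemma slow_lower:
  assumes "E.slow (emden_var q u)"
  shows "\<exists>c>0. \<forall>x. norm x \<ge> 1 \<longrightarrow> c * norm x powr - (1 / q) \<le> u x"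
proof -
  obtain c where c: "c > 0" "\<And>t. t \<ge> 0 \<Longrightarrow> c \<le> emden_var q u t"
    using E.slow_global[OF assms] by blast
  have "c * norm x powr - (1 / q) \<le> u x" if "norm x \<ge> 1" for x
  proof -
    have x: "x \<noteq> 0" using that by auto
    have "norm x powr - (1 / q) * c \<le> norm x powr - (1 / q) * emden_var q u (ln (norm x))"
      using that by (intro mult_left_mono c) auto
    then show ?thesis unfolding eq_emden_var[OF x] by (simp add: mult.commute)
  qed
  then show ?thesis using c by blast
qed

lemma fast_if_upper:
  assumes C: "C > 0" and le: "\<And>x. norm x \<ge> R \<Longrightarrow> u x \<le> C * norm x powr - (real CARD('n) - 2)"
  shows "E.fast (emden_var q u)"
proof -
  \<comment> \<open>\<open>R\<close> comes from a statement about large arguments and may be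
    nonpositive; \<open>max R 1\<close> makes its logarithm meaningful.\<close>
  have "emden_var q u t \<le> C * exp (- (real CARD('n) - 2 - 1 / q) * t)" if t: "t \<ge> ln (max R 1)" for t
  proof -
    define x where "x = exp t *\<^sub>R (axis (SOME i. True) 1 :: real^'n)"
    have x: "x \<noteq> 0" and n: "norm x = exp t" by (simp_all add: x_def axis_eq_0_iff norm_axis_1)
    have "max R 1 = exp (ln (max R 1))" by (simp add: less_max_iff_disj)
    also have "\<dots> \<le> exp t" using t by (simp only: exp_le_cancel_iff)
    finally have "max R 1 \<le> exp t" .
    then have "u x \<le> C * norm x powr - (real CARD('n) - 2)" by (intro le) (simp add: n)
    then have "norm x powr - (1 / q) * emden_var q u t \<le> norm x powr - (1 / q) * (C * exp (- (real CARD('n) - 2 - 1 / q) * t))"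
      unfolding exp_ln_norm[OF x, symmetric] eq_emden_var[OF x] by (simp add: n mult_ac)
    then show ?thesis using x by simp
  qed
  then show ?thesis unfolding E.fast_def using C by blast
qed

lemma slow_if_lower:
  assumes C: "C > 0" and le: "\<And>x. norm x \<ge> R \<Longrightarrow> C * norm x powr - (1 / q) \<le> u x"
  shows "E.slow (emden_var q u)"
proof -
  have "C \<le> emden_var q u t" if t: "t \<ge> ln (max R 1)" for t
  proof -
    define x where "x = exp t *\<^sub>R (axis (SOME i. True) 1 :: real^'n)"
    have x: "x \<noteq> 0" and n: "norm x = exp t" by (simp_all add: x_def axis_eq_0_iff norm_axis_1)
    have "max R 1 = exp (ln (max R 1))" by (simp add: less_max_iff_disj)
    also have "\<dots> \<le> exp t" using t by (simp only: exp_le_cancel_iff)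
    finally have "max R 1 \<le> exp t" .
    then have "C * norm x powr - (1 / q) \<le> u x" by (intro le) (simp add: n)
    then have "norm x powr - (1 / q) * C \<le> norm x powr - (1 / q) * emden_var q u t"
      unfolding eq_emden_var[OF x] by (simp add: n mult_ac)
    then show ?thesis using x by simp
  qed
  then show ?thesis unfolding E.slow_def using C by blast
qed

lemma semi_singular_imp_fast_slow:
  assumes "C > 0" "C1 > 0"
    and "\<And>x. norm x \<ge> R \<Longrightarrow> u x \<le> C * norm x powr - (real CARD('n) - 2) \<and> C1 * norm x powr - (1 / q) \<le> v x"
  shows "E.fast (emden_var q u) \<and> E.slow (emden_var q v)"
proof -
  interpret S: exterior_system v u q \<mu>2 \<mu>1 \<beta> by (rule exterior_swapped)
  have "S.E.slow = E.slow" by (simp add: fun_eq_iff S.E.slow_def E.slow_def)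
  then show ?thesis using fast_if_upper[of C R] S.slow_if_lower[of C1 R] assms by auto
qed

lemma fast_slow_imp_semi_singular:
  assumes "E.fast (emden_var q u)" "E.slow (emden_var q v)" and p: "p = 2 * q + 1"
  shows "semi_singular_inf p u v"
proof -
  interpret S: exterior_system v u q \<mu>2 \<mu>1 \<beta> by (rule exterior_swapped)
  have eq: "S.E.slow = E.slow" by (simp add: fun_eq_iff S.E.slow_def E.slow_def)
  have e: "- 2 / (p - 1) = - (1 / q)" using p by simp
  obtain C where C: "C > 0" "\<And>x. norm x \<ge> 1 \<Longrightarrow> u x \<le> C * norm x powr - (real CARD('n) - 2)"
    using fast_upper[OF assms(1)] by blast
  obtain C1 where C1: "C1 > 0" "\<And>x. norm x \<ge> 1 \<Longrightarrow> C1 * norm x powr - (1 / q) \<le> v x"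
    using S.slow_lower assms(2) eq by auto
  obtain C2 where C2: "C2 > 0" "\<And>x. x \<noteq> 0 \<Longrightarrow> v x \<le> C2 * norm x powr - (1 / q)"
    using S.upper by blast
  have nz: "x \<noteq> 0" if "norm x \<ge> 1" for x :: "real^'n" using that by auto
  show ?thesis unfolding semi_singular_inf_def e
    by (rule exI[of _ C], rule exI[of _ C1], rule exI[of _ C2], rule exI[of _ 1]) (use C C1 C2 nz in auto)
qed

lemma not_semi_singular:
  assumes "q < 1" and p: "p = 2 * q + 1"
  shows "\<not> semi_singular_inf p u v"
proof
  interpret S: exterior_system v u q \<mu>2 \<mu>1 \<beta> by (rule exterior_swapped)
  have e: "- 2 / (p - 1) = - (1 / q)" using p by simp
  assume "semi_singular_inf p u v"
  then obtain C C1 R where C: "C > 0" "C1 > 0"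
    and alt: "(\<forall>x. norm x \<ge> R \<longrightarrow> u x \<le> C * norm x powr - (real CARD('n) - 2) \<and> C1 * norm x powr - (1 / q) \<le> v x) \<or>
     (\<forall>x. norm x \<ge> R \<longrightarrow> v x \<le> C * norm x powr - (real CARD('n) - 2) \<and> C1 * norm x powr - (1 / q) \<le> u x)"
    unfolding semi_singular_inf_def e by blast
  then show False
    using E.not_fast_slow[OF assms(1)] S.E.not_fast_slow[OF assms(1)]
      semi_singular_imp_fast_slow[OF C, of R] S.semi_singular_imp_fast_slow[OF C, of R] by blast
qed

lemma dichotomy:
  assumes p: "p = 2 * q + 1" and q: "q < 1 \<or> q > 1 \<and> \<not> semi_singular_inf p u v"
  shows "(\<exists>C3>0. \<forall>x. norm x \<ge> 1 \<longrightarrow>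
                 u x \<le> C3 * norm x powr (- (real CARD('n) - 2)) \<and>
                 v x \<le> C3 * norm x powr (- (real CARD('n) - 2)))
           \<or> (\<exists>C1 C2. 0 < C1 \<and> C1 \<le> C2 \<and> (\<forall>x. norm x \<ge> 1 \<longrightarrow>
                 C1 * norm x powr (- 2 / (p - 1)) \<le> u x \<and> u x \<le> C2 * norm x powr (- 2 / (p - 1)) \<and>
                 C1 * norm x powr (- 2 / (p - 1)) \<le> v x \<and> v x \<le> C2 * norm x powr (- 2 / (p - 1))))"
proof -
  interpret S: exterior_system v u q \<mu>2 \<mu>1 \<beta> by (rule exterior_swapped)
  have eq: "S.E.slow = E.slow" "S.E.fast = E.fast"
    by (simp_all add: fun_eq_iff S.E.slow_def E.slow_def S.E.fast_def E.fast_def)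
  have e: "- 2 / (p - 1) = - (1 / q)" using p by simp
  let ?a = "emden_var q u" and ?b = "emden_var q v"
  have "\<not> (q > 1 \<and> (E.fast ?a \<and> E.slow ?b \<or> E.fast ?b \<and> E.slow ?a))"
    using q fast_slow_imp_semi_singular[OF _ _ p] S.fast_slow_imp_semi_singular[OF _ _ p] eq
      semi_singular_inf_commute[of p u v] by auto
  then consider "E.fast ?a" "E.fast ?b" | "E.slow ?a" "E.slow ?b"
    using E.alternatives q by fastforce
  then show ?thesis
  proof cases
    case 1
    obtain C where C: "C > 0" "\<And>x. norm x \<ge> 1 \<Longrightarrow> u x \<le> C * norm x powr - (real CARD('n) - 2)"
      using fast_upper[OF 1(1)] by blast
    obtain C' where C': "C' > 0" "\<And>x. norm x \<ge> 1 \<Longrightarrow> v x \<le> C' * norm x powr - (real CARD('n) - 2)"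
      using S.fast_upper 1(2) eq by auto
    have "u x \<le> max C C' * norm x powr - (real CARD('n) - 2)" "v x \<le> max C C' * norm x powr - (real CARD('n) - 2)"
      if "norm x \<ge> 1" for x
      using C(2)[OF that] C'(2)[OF that]
      by (auto elim!: order_trans intro!: mult_right_mono)
    then show ?thesis using C(1) by (intro disjI1 exI[of _ "max C C'"]) auto
  next
    case 2
    obtain c where c: "c > 0" "\<And>x. norm x \<ge> 1 \<Longrightarrow> c * norm x powr - (1 / q) \<le> u x"
      using slow_lower[OF 2(1)] by blast
    obtain c' where c': "c' > 0" "\<And>x. norm x \<ge> 1 \<Longrightarrow> c' * norm x powr - (1 / q) \<le> v x"
      using S.slow_lower 2(2) eq by auto
    obtain C where C: "C > 0" "\<And>x. x \<noteq> 0 \<Longrightarrow> u x \<le> C * norm x powr - (1 / q)" using upper by blast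
    obtain C' where C': "C' > 0" "\<And>x. x \<noteq> 0 \<Longrightarrow> v x \<le> C' * norm x powr - (1 / q)" using S.upper by blast
    define m where "m = min c c'"
    define M where "M = max m (max C C')"
    have m: "m > 0" "m \<le> c" "m \<le> c'" "m \<le> M" "C \<le> M" "C' \<le> M" using c(1) c'(1) by (auto simp: m_def M_def)
    have "m * norm x powr - (1 / q) \<le> u x \<and> u x \<le> M * norm x powr - (1 / q) \<and>
          m * norm x powr - (1 / q) \<le> v x \<and> v x \<le> M * norm x powr - (1 / q)" if x: "norm x \<ge> 1" for x :: "real^'n"
    proof -
      define k where "k = norm x powr - (1 / q)"
      have "m * k \<le> c * k" "m * k \<le> c' * k" "C * k \<le> M * k" "C' * k \<le> M * k"
        using m by (auto intro!: mult_right_mono simp: k_def)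
      moreover have "x \<noteq> 0" using x by auto
      ultimately show ?thesis using c(2)[OF x] c'(2)[OF x] C(2)[of x] C'(2)[of x] unfolding k_def by linarith
    qed
    then show ?thesis unfolding e using m by (intro disjI2) blast
  qed
qed

end

theorem theorem1p2:
  fixes \<mu>1 \<mu>2 \<beta> p q :: real
  assumes n3: "CARD('n) \<ge> 3"
    and pos: "\<mu>1 > 0" "\<mu>2 > 0" "\<beta> > 0"
    and pq: "p = 2 * q + 1"
    and plow: "real CARD('n) / (real CARD('n) - 2) < p"
    and pup: "p < (real CARD('n) + 2) / (real CARD('n) - 2)"
  shows "(CARD('n) \<ge> 4 \<longrightarrow>
            \<not> (\<exists>u v :: real^'n \<Rightarrow> real.
                  pos_solution q \<mu>1 \<mu>2 \<beta> u v \<and> semi_singular_inf p u v))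
       \<and>
         ((CARD('n) \<ge> 4 \<or>
           (CARD('n) = 3 \<and> \<not> (\<exists>u v :: real^'n \<Rightarrow> real.
                  pos_solution q \<mu>1 \<mu>2 \<beta> u v \<and> semi_singular_inf p u v))) \<longrightarrow>
          (\<forall>u v :: real^'n \<Rightarrow> real. pos_solution q \<mu>1 \<mu>2 \<beta> u v \<longrightarrow>
             (\<exists>C3>0. \<forall>x. norm x \<ge> 1 \<longrightarrow>
                 u x \<le> C3 * norm x powr (- (real CARD('n) - 2)) \<and>
                 v x \<le> C3 * norm x powr (- (real CARD('n) - 2)))
           \<or> (\<exists>C1 C2. 0 < C1 \<and> C1 \<le> C2 \<and> (\<forall>x. norm x \<ge> 1 \<longrightarrow>
                 C1 * norm x powr (- 2 / (p - 1)) \<le> u x \<and> u x \<le> C2 * norm x powr (- 2 / (p - 1)) \<and>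
                 C1 * norm x powr (- 2 / (p - 1)) \<le> v x \<and> v x \<le> C2 * norm x powr (- 2 / (p - 1))))))"
proof -
  have N: "real CARD('n) - 2 > 0" using n3 by simp
  have low: "2 / (real CARD('n) - 2) < 2 * q"
    using plow N unfolding pq by (simp add: field_simps)
  have up: "2 * q * (real CARD('n) - 2) < 4"
    using pup N unfolding pq by (simp add: pos_less_divide_eq algebra_simps)
  have "0 < 2 / (real CARD('n) - 2)" using N by simp
  then have q: "q > 0" using low by linarith
  have sys: "exterior_system u v q \<mu>1 \<mu>2 \<beta>" if "pos_solution q \<mu>1 \<mu>2 \<beta> u v" for u v :: "real^'n \<Rightarrow> real"
    by unfold_locales (use n3 pos q pup plow that in \<open>auto simp: pq\<close>)
  \<comment> \<open>In this range \<open>n - 2 \<ge> 2\<close>, so the subcritical bound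
    \<open>2 * q * (n - 2) < 4\<close> forces \<open>q < 1\<close>.\<close>
  have q4: "q < 1" if "CARD('n) \<ge> 4"
  proof -
    have "2 * q * 2 \<le> 2 * q * (real CARD('n) - 2)" using q that by (intro mult_left_mono) auto
    then show ?thesis using up by linarith
  qed
  \<comment> \<open>For \<open>n = 3\<close> the lower bound on \<open>p\<close> reads
    \<open>p > 3\<close>. Together with the case \<open>n \<ge> 4\<close> this keeps
    \<open>q\<close> away from the borderline value 1.\<close>
  have q3: "q > 1" if "CARD('n) = 3"
    using low that by simp
  show ?thesis
  proof (intro conjI impI allI)
    assume "CARD('n) \<ge> 4"
    then show "\<not> (\<exists>u v :: real^'n \<Rightarrow> real. pos_solution q \<mu>1 \<mu>2 \<beta> u v \<and> semi_singular_inf p u v)"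
      using exterior_system.not_semi_singular[OF sys q4 pq] by blast
  next
    fix u v :: "real^'n \<Rightarrow> real"
    assume "CARD('n) \<ge> 4 \<or> (CARD('n) = 3 \<and> \<not> (\<exists>u v :: real^'n \<Rightarrow> real.
        pos_solution q \<mu>1 \<mu>2 \<beta> u v \<and> semi_singular_inf p u v))" and sol: "pos_solution q \<mu>1 \<mu>2 \<beta> u v"
    then have "q < 1 \<or> q > 1 \<and> \<not> semi_singular_inf p u v" using q3 q4 by blast
    from exterior_system.dichotomy[OF sys[OF sol] pq this]
    show "(\<exists>C3>0. \<forall>x. norm x \<ge> 1 \<longrightarrow>
                 u x \<le> C3 * norm x powr (- (real CARD('n) - 2)) \<and>
                 v x \<le> C3 * norm x powr (- (real CARD('n) - 2)))
           \<or> (\<exists>C1 C2. 0 < C1 \<and> C1 \<le> C2 \<and> (\<forall>x. norm x \<ge> 1 \<longrightarrow>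
                 C1 * norm x powr (- 2 / (p - 1)) \<le> u x \<and> u x \<le> C2 * norm x powr (- 2 / (p - 1)) \<and>
                 C1 * norm x powr (- 2 / (p - 1)) \<le> v x \<and> v x \<le> C2 * norm x powr (- 2 / (p - 1))))" .
  qed
qed

end
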